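(* Let $k$ be a field and let $\mathcal{C}$ be a $k$-category; for each object $x$ put $A_x={}_x\mathcal{C}_x$. For each object $x$ let $B_x$ be a $k$-algebra, $P_x$ a $(B_x,A_x)$-bimodule and $Q_x$ an $(A_x,B_x)$-bimodule such that $P_x\otimes_{A_x}Q_x\cong B_x$ as $B_x$-bimodules and $Q_x\otimes_{B_x}P_x\cong A_x$ as $A_x$-bimodules. For each $x$ fix an isomorphism of $A_x$-bimodules $\varphi_x:Q_x\otimes_{B_x}P_x\to A_x$, and let $\phi_x:Q_x\otimes_k P_x\to A_x$ be the composition of the projection $Q_x\otimes_kP_x\to Q_x\otimes_{B_x}P_x$ with $\varphi_x$. Let $\mathcal{D}$ be the $k$-category with the same objects as $\mathcal{C}$, with morphisms $${}_y\mathcal{D}_x=P_y\otimes_{A_y}{}_y\mathcal{C}_x\otimes_{A_x}Q_x$$ and with composition $$(p_z\otimes g\otimes q_y)(p_y\otimes f\otimes q_x)=p_z\otimes g\,[\phi_y(q_y\otimes p_y)]\,f\otimes q_x .$$ Then $\mathcal{C}$ and $\mathcal{D}$ are Morita equivalent.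
   Context: A $k$-category is a category whose objects form a set, whose morphism sets ${}_y\mathcal{C}_x$ (from $x$ to $y$) are $k$-vector spaces, and whose composition is $k$-bilinear; in particular each ${}_x\mathcal{C}_x$ is a $k$-algebra and ${}_y\mathcal{C}_x$ is a $({}_y\mathcal{C}_y,{}_x\mathcal{C}_x)$-bimodule. Functors and equivalences between $k$-linear categories are understood to be $k$-linear. A left $\mathcal{C}$-module is a $k$-linear covariant functor from $\mathcal{C}$ to $k$-vector spaces, with natural transformations as morphisms; two $k$-categories are Morita equivalent if their categories of left modules are equivalent. *)

theory Defs
  imports "HOL-Algebra.Free_Abelian_Groups" "HOL-Algebra.Generated_Groups" "HOL-Algebra.Module"
begin

section \<open>Algebras and bimodules over a field\<close>

text \<open>
  A vector space over \<^term>\<open>k\<close> is a HOL-Algebra module over the field \<^term>\<open>k\<close>; the fields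
  \<^const>\<open>monoid.mult\<close> and \<^const>\<open>one\<close> of the record carry no meaning unless the space is
  regarded as an algebra. The locale \<^locale>\<open>algebra\<close> of HOL-Algebra is restricted to commutative
  algebras, so associative unital algebras are introduced here.
\<close>

locale k_algebra = field k + module k A + ring A
  for k :: "('k, 'e) ring_scheme" and A :: "('k, 'a, 'f) module_scheme" +
  assumes smult_mult_left: "\<lbrakk>c \<in> carrier k; a \<in> carrier A; b \<in> carrier A\<rbrakk> \<Longrightarrow>
      (c \<odot>\<^bsub>A\<^esub> a) \<otimes>\<^bsub>A\<^esub> b = c \<odot>\<^bsub>A\<^esub> (a \<otimes>\<^bsub>A\<^esub> b)"
    and smult_mult_right: "\<lbrakk>c \<in> carrier k; a \<in> carrier A; b \<in> carrier A\<rbrakk> \<Longrightarrow>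
      a \<otimes>\<^bsub>A\<^esub> (c \<odot>\<^bsub>A\<^esub> b) = c \<odot>\<^bsub>A\<^esub> (a \<otimes>\<^bsub>A\<^esub> b)"

record ('k, 'm, 'a, 'b) bimod = "('k, 'm) module" +
  lact :: "'a \<Rightarrow> 'm \<Rightarrow> 'm"
  ract :: "'m \<Rightarrow> 'b \<Rightarrow> 'm"

text \<open>
  Bimodules over \<^term>\<open>k\<close>-algebras are unital, and \<^term>\<open>k\<close> acts in the same way through both
  algebras: this is what \<^term>\<open>k\<close>-bilinearity of the two actions expresses.
\<close>

locale bimodule = field k + module k M + L: k_algebra k A + R: k_algebra k B
  for k :: "('k, 'e) ring_scheme"
    and A :: "('k, 'a, 'f) module_scheme"
    and B :: "('k, 'b, 'g) module_scheme"
    and M :: "('k, 'm, 'a, 'b, 'h) bimod_scheme" +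
  assumes lact_closed: "\<lbrakk>a \<in> carrier A; m \<in> carrier M\<rbrakk> \<Longrightarrow> lact M a m \<in> carrier M"
    and lact_add_left: "\<lbrakk>a \<in> carrier A; a' \<in> carrier A; m \<in> carrier M\<rbrakk> \<Longrightarrow>
      lact M (a \<oplus>\<^bsub>A\<^esub> a') m = lact M a m \<oplus>\<^bsub>M\<^esub> lact M a' m"
    and lact_add_right: "\<lbrakk>a \<in> carrier A; m \<in> carrier M; m' \<in> carrier M\<rbrakk> \<Longrightarrow>
      lact M a (m \<oplus>\<^bsub>M\<^esub> m') = lact M a m \<oplus>\<^bsub>M\<^esub> lact M a m'"
    and lact_smult_left: "\<lbrakk>c \<in> carrier k; a \<in> carrier A; m \<in> carrier M\<rbrakk> \<Longrightarrow>
      lact M (c \<odot>\<^bsub>A\<^esub> a) m = c \<odot>\<^bsub>M\<^esub> lact M a m"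
    and lact_smult_right: "\<lbrakk>c \<in> carrier k; a \<in> carrier A; m \<in> carrier M\<rbrakk> \<Longrightarrow>
      lact M a (c \<odot>\<^bsub>M\<^esub> m) = c \<odot>\<^bsub>M\<^esub> lact M a m"
    and lact_mult: "\<lbrakk>a \<in> carrier A; a' \<in> carrier A; m \<in> carrier M\<rbrakk> \<Longrightarrow>
      lact M (a \<otimes>\<^bsub>A\<^esub> a') m = lact M a (lact M a' m)"
    and lact_one: "m \<in> carrier M \<Longrightarrow> lact M \<one>\<^bsub>A\<^esub> m = m"
    and ract_closed: "\<lbrakk>m \<in> carrier M; b \<in> carrier B\<rbrakk> \<Longrightarrow> ract M m b \<in> carrier M"
    and ract_add_left: "\<lbrakk>m \<in> carrier M; m' \<in> carrier M; b \<in> carrier B\<rbrakk> \<Longrightarrow>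
      ract M (m \<oplus>\<^bsub>M\<^esub> m') b = ract M m b \<oplus>\<^bsub>M\<^esub> ract M m' b"
    and ract_add_right: "\<lbrakk>m \<in> carrier M; b \<in> carrier B; b' \<in> carrier B\<rbrakk> \<Longrightarrow>
      ract M m (b \<oplus>\<^bsub>B\<^esub> b') = ract M m b \<oplus>\<^bsub>M\<^esub> ract M m b'"
    and ract_smult_left: "\<lbrakk>c \<in> carrier k; m \<in> carrier M; b \<in> carrier B\<rbrakk> \<Longrightarrow>
      ract M (c \<odot>\<^bsub>M\<^esub> m) b = c \<odot>\<^bsub>M\<^esub> ract M m b"
    and ract_smult_right: "\<lbrakk>c \<in> carrier k; m \<in> carrier M; b \<in> carrier B\<rbrakk> \<Longrightarrow>
      ract M m (c \<odot>\<^bsub>B\<^esub> b) = c \<odot>\<^bsub>M\<^esub> ract M m b"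
    and ract_mult: "\<lbrakk>m \<in> carrier M; b \<in> carrier B; b' \<in> carrier B\<rbrakk> \<Longrightarrow>
      ract M m (b \<otimes>\<^bsub>B\<^esub> b') = ract M (ract M m b) b'"
    and ract_one: "m \<in> carrier M \<Longrightarrow> ract M m \<one>\<^bsub>B\<^esub> = m"
    and lact_ract: "\<lbrakk>a \<in> carrier A; m \<in> carrier M; b \<in> carrier B\<rbrakk> \<Longrightarrow>
      ract M (lact M a m) b = lact M a (ract M m b)"

definition linear_map ::
  "('k, 'e) ring_scheme \<Rightarrow> ('k, 'v, 'f) module_scheme \<Rightarrow> ('k, 'w, 'g) module_scheme \<Rightarrow> ('v \<Rightarrow> 'w) \<Rightarrow> bool" where
  "linear_map k V W f \<longleftrightarrow>
     f \<in> carrier V \<rightarrow> carrier W \<and>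
     (\<forall>v\<in>carrier V. \<forall>v'\<in>carrier V. f (v \<oplus>\<^bsub>V\<^esub> v') = f v \<oplus>\<^bsub>W\<^esub> f v') \<and>
     (\<forall>c\<in>carrier k. \<forall>v\<in>carrier V. f (c \<odot>\<^bsub>V\<^esub> v) = c \<odot>\<^bsub>W\<^esub> f v)"

definition bimod_hom ::
  "('k, 'e) ring_scheme \<Rightarrow> ('k, 'a, 'f) module_scheme \<Rightarrow> ('k, 'b, 'g) module_scheme \<Rightarrow>
   ('k, 'm, 'a, 'b, 'h) bimod_scheme \<Rightarrow> ('k, 'n, 'a, 'b, 'i) bimod_scheme \<Rightarrow> ('m \<Rightarrow> 'n) \<Rightarrow> bool" where
  "bimod_hom k A B M N f \<longleftrightarrow>
     linear_map k M N f \<and>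
     (\<forall>a\<in>carrier A. \<forall>m\<in>carrier M. f (lact M a m) = lact N a (f m)) \<and>
     (\<forall>m\<in>carrier M. \<forall>b\<in>carrier B. f (ract M m b) = ract N (f m) b)"

definition bimod_iso ::
  "('k, 'e) ring_scheme \<Rightarrow> ('k, 'a, 'f) module_scheme \<Rightarrow> ('k, 'b, 'g) module_scheme \<Rightarrow>
   ('k, 'm, 'a, 'b, 'h) bimod_scheme \<Rightarrow> ('k, 'n, 'a, 'b, 'i) bimod_scheme \<Rightarrow> ('m \<Rightarrow> 'n) \<Rightarrow> bool" where
  "bimod_iso k A B M N f \<longleftrightarrow> bimod_hom k A B M N f \<and> bij_betw f (carrier M) (carrier N)"

definition bimod_isomorphic ::
  "('k, 'e) ring_scheme \<Rightarrow> ('k, 'a, 'f) module_scheme \<Rightarrow> ('k, 'b, 'g) module_scheme \<Rightarrow>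
   ('k, 'm, 'a, 'b, 'h) bimod_scheme \<Rightarrow> ('k, 'n, 'a, 'b, 'i) bimod_scheme \<Rightarrow> bool" where
  "bimod_isomorphic k A B M N \<longleftrightarrow> (\<exists>f. bimod_iso k A B M N f)"

definition regular_bimod :: "('k, 'a) module \<Rightarrow> ('k, 'a, 'a, 'a) bimod" where
  "regular_bimod A = module.extend A (bimod.fields (monoid.mult A) (monoid.mult A))"

text \<open>A vector space as a bimodule over the ground field, used to form \<open>\<otimes>\<^sub>k\<close>.\<close>

definition scalar_bimod :: "('k, 'm, 'h) module_scheme \<Rightarrow> ('k, 'm, 'k, 'k) bimod" where
  "scalar_bimod M =
     module.extend (module.truncate M) (bimod.fields (smult M) (\<lambda>m c. c \<odot>\<^bsub>M\<^esub> m))"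


section \<open>Tensor products\<close>

text \<open>
  \<open>M \<otimes>\<^sub>A N\<close> is the free abelian group on \<open>M \<times> N\<close> modulo the subgroup generated by the
  biadditivity and \<open>A\<close>-balancing relators, so that its elements are cosets.
\<close>

type_synonym ('m, 'n) tensor = "('m \<times> 'n \<Rightarrow>\<^sub>0 int) set"

definition tensor_relators ::
  "('a, 'f) ring_scheme \<Rightarrow> ('k, 'm, 'b, 'a, 'h) bimod_scheme \<Rightarrow> ('k, 'n, 'a, 'c, 'i) bimod_scheme \<Rightarrow>
   ('m \<times> 'n \<Rightarrow>\<^sub>0 int) set" where
  "tensor_relators A M N =
     {frag_of (m \<oplus>\<^bsub>M\<^esub> m', n) - frag_of (m, n) - frag_of (m', n) | m m' n.
        m \<in> carrier M \<and> m' \<in> carrier M \<and> n \<in> carrier N} \<union>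
     {frag_of (m, n \<oplus>\<^bsub>N\<^esub> n') - frag_of (m, n) - frag_of (m, n') | m n n'.
        m \<in> carrier M \<and> n \<in> carrier N \<and> n' \<in> carrier N} \<union>
     {frag_of (ract M m a, n) - frag_of (m, lact N a n) | m a n.
        m \<in> carrier M \<and> a \<in> carrier A \<and> n \<in> carrier N}"

definition tensor_kernel ::
  "('a, 'f) ring_scheme \<Rightarrow> ('k, 'm, 'b, 'a, 'h) bimod_scheme \<Rightarrow> ('k, 'n, 'a, 'c, 'i) bimod_scheme \<Rightarrow>
   ('m \<times> 'n \<Rightarrow>\<^sub>0 int) set" where
  "tensor_kernel A M N =
     generate (free_Abelian_group (carrier M \<times> carrier N)) (tensor_relators A M N)"

definition tensor_group ::
  "('a, 'f) ring_scheme \<Rightarrow> ('k, 'm, 'b, 'a, 'h) bimod_scheme \<Rightarrow> ('k, 'n, 'a, 'c, 'i) bimod_scheme \<Rightarrow>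
   ('m, 'n) tensor monoid" where
  "tensor_group A M N = free_Abelian_group (carrier M \<times> carrier N) Mod tensor_kernel A M N"

definition pure_tensor ::
  "('a, 'f) ring_scheme \<Rightarrow> ('k, 'm, 'b, 'a, 'h) bimod_scheme \<Rightarrow> ('k, 'n, 'a, 'c, 'i) bimod_scheme \<Rightarrow>
   'm \<Rightarrow> 'n \<Rightarrow> ('m, 'n) tensor" where
  "pure_tensor A M N m n =
     tensor_kernel A M N #>\<^bsub>free_Abelian_group (carrier M \<times> carrier N)\<^esub> frag_of (m, n)"

text \<open>
  The additive map to \<open>W\<close> with \<open>m \<otimes> n \<mapsto> h m n\<close>, evaluated on a representative; the result does
  not depend on the representative when \<open>h\<close> is biadditive and balanced.
\<close>

definition tensor_lift ::
  "('w, 'f) ring_scheme \<Rightarrow> ('m \<Rightarrow> 'n \<Rightarrow> 'w) \<Rightarrow> ('m, 'n) tensor \<Rightarrow> 'w" where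
  "tensor_lift W h t =
     (let r = (SOME r. r \<in> t)
      in \<Oplus>\<^bsub>W\<^esub>z \<in> Poly_Mapping.keys r. [Poly_Mapping.lookup r z] \<cdot>\<^bsub>W\<^esub> h (fst z) (snd z))"

definition tensor_additive ::
  "('a, 'f) ring_scheme \<Rightarrow> ('k, 'm, 'b, 'a, 'h) bimod_scheme \<Rightarrow> ('k, 'n, 'a, 'c, 'i) bimod_scheme \<Rightarrow>
   ('m, 'n) tensor ring" where
  "tensor_additive A M N =
     \<lparr>carrier = carrier (tensor_group A M N), monoid.mult = undefined, one = undefined,
      zero = one (tensor_group A M N), add = monoid.mult (tensor_group A M N)\<rparr>"

definition tensor ::
  "('a, 'f) ring_scheme \<Rightarrow> ('k, 'm, 'b, 'a, 'h) bimod_scheme \<Rightarrow> ('k, 'n, 'a, 'c, 'i) bimod_scheme \<Rightarrow>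
   ('k, ('m, 'n) tensor, 'b, 'c) bimod" where
  "tensor A M N = (let T = tensor_additive A M N in
     \<lparr>carrier = carrier T, monoid.mult = monoid.mult T, one = one T, zero = zero T, add = add T,
      smult = (\<lambda>c. tensor_lift T (\<lambda>m n. pure_tensor A M N (c \<odot>\<^bsub>M\<^esub> m) n)),
      lact = (\<lambda>b. tensor_lift T (\<lambda>m n. pure_tensor A M N (lact M b m) n)),
      ract = (\<lambda>t c. tensor_lift T (\<lambda>m n. pure_tensor A M N m (ract N n c)) t)\<rparr>)"

text \<open>The projection \<open>M \<otimes>\<^sub>k N \<rightarrow> M \<otimes>\<^sub>A N\<close>.\<close>

definition tensor_proj ::
  "('a, 'f) ring_scheme \<Rightarrow> ('k, 'm, 'b, 'a, 'h) bimod_scheme \<Rightarrow> ('k, 'n, 'a, 'c, 'i) bimod_scheme \<Rightarrow>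
   ('m, 'n) tensor \<Rightarrow> ('m, 'n) tensor" where
  "tensor_proj A M N = tensor_lift (tensor_additive A M N) (pure_tensor A M N)"


section \<open>Linear categories\<close>

text \<open>
  \<open>cat_hom C x y\<close> is the space of morphisms from \<open>x\<close> to \<open>y\<close> (\<open>\<^bsub>y\<^esub>C\<^bsub>x\<^esub>\<close>), and
  \<open>cat_comp C x y z g f\<close> is the composite of \<open>f\<close> from \<open>x\<close> to \<open>y\<close> and \<open>g\<close> from \<open>y\<close> to \<open>z\<close>.
\<close>

record ('k, 'o, 'm) kcat =
  cat_obj :: "'o set"
  cat_hom :: "'o \<Rightarrow> 'o \<Rightarrow> ('k, 'm) module"
  cat_comp :: "'o \<Rightarrow> 'o \<Rightarrow> 'o \<Rightarrow> 'm \<Rightarrow> 'm \<Rightarrow> 'm"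
  cat_id :: "'o \<Rightarrow> 'm"

locale k_category = field k
  for k :: "('k, 'e) ring_scheme" +
  fixes C :: "('k, 'o, 'm) kcat"
  assumes hom_module: "\<lbrakk>x \<in> cat_obj C; y \<in> cat_obj C\<rbrakk> \<Longrightarrow> module k (cat_hom C x y)"
    and id_closed: "x \<in> cat_obj C \<Longrightarrow> cat_id C x \<in> carrier (cat_hom C x x)"
    and comp_closed: "\<lbrakk>x \<in> cat_obj C; y \<in> cat_obj C; z \<in> cat_obj C;
        f \<in> carrier (cat_hom C x y); g \<in> carrier (cat_hom C y z)\<rbrakk> \<Longrightarrow>
      cat_comp C x y z g f \<in> carrier (cat_hom C x z)"
    and comp_assoc: "\<lbrakk>w \<in> cat_obj C; x \<in> cat_obj C; y \<in> cat_obj C; z \<in> cat_obj C;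
        f \<in> carrier (cat_hom C w x); g \<in> carrier (cat_hom C x y); h \<in> carrier (cat_hom C y z)\<rbrakk> \<Longrightarrow>
      cat_comp C w y z h (cat_comp C w x y g f) = cat_comp C w x z (cat_comp C x y z h g) f"
    and comp_id_left: "\<lbrakk>x \<in> cat_obj C; y \<in> cat_obj C; f \<in> carrier (cat_hom C x y)\<rbrakk> \<Longrightarrow>
      cat_comp C x y y (cat_id C y) f = f"
    and comp_id_right: "\<lbrakk>x \<in> cat_obj C; y \<in> cat_obj C; f \<in> carrier (cat_hom C x y)\<rbrakk> \<Longrightarrow>
      cat_comp C x x y f (cat_id C x) = f"
    and comp_linear_left: "\<lbrakk>x \<in> cat_obj C; y \<in> cat_obj C; z \<in> cat_obj C;
        f \<in> carrier (cat_hom C x y)\<rbrakk> \<Longrightarrow>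
      linear_map k (cat_hom C y z) (cat_hom C x z) (\<lambda>g. cat_comp C x y z g f)"
    and comp_linear_right: "\<lbrakk>x \<in> cat_obj C; y \<in> cat_obj C; z \<in> cat_obj C;
        g \<in> carrier (cat_hom C y z)\<rbrakk> \<Longrightarrow>
      linear_map k (cat_hom C x y) (cat_hom C x z) (\<lambda>f. cat_comp C x y z g f)"

definition end_algebra :: "('k, 'o, 'm) kcat \<Rightarrow> 'o \<Rightarrow> ('k, 'm) module" where
  "end_algebra C x = (cat_hom C x x)\<lparr>monoid.mult := cat_comp C x x x, one := cat_id C x\<rparr>"

definition hom_bimod :: "('k, 'o, 'm) kcat \<Rightarrow> 'o \<Rightarrow> 'o \<Rightarrow> ('k, 'm, 'm, 'm) bimod" where
  "hom_bimod C x y = module.extend (cat_hom C x y)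
     (bimod.fields (cat_comp C x y y) (cat_comp C x x y))"


section \<open>Linear functors and equivalences\<close>

record ('o, 'm, 'p, 'n) kfun =
  fun_obj :: "'o \<Rightarrow> 'p"
  fun_map :: "'o \<Rightarrow> 'o \<Rightarrow> 'm \<Rightarrow> 'n"

definition k_functor ::
  "('k, 'e) ring_scheme \<Rightarrow> ('k, 'o, 'm) kcat \<Rightarrow> ('k, 'p, 'n) kcat \<Rightarrow> ('o, 'm, 'p, 'n) kfun \<Rightarrow> bool" where
  "k_functor k C D F \<longleftrightarrow>
     fun_obj F \<in> cat_obj C \<rightarrow> cat_obj D \<and>
     (\<forall>x\<in>cat_obj C. \<forall>y\<in>cat_obj C.
        linear_map k (cat_hom C x y) (cat_hom D (fun_obj F x) (fun_obj F y)) (fun_map F x y)) \<and>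
     (\<forall>x\<in>cat_obj C. fun_map F x x (cat_id C x) = cat_id D (fun_obj F x)) \<and>
     (\<forall>x\<in>cat_obj C. \<forall>y\<in>cat_obj C. \<forall>z\<in>cat_obj C.
        \<forall>f\<in>carrier (cat_hom C x y). \<forall>g\<in>carrier (cat_hom C y z).
          fun_map F x z (cat_comp C x y z g f) =
          cat_comp D (fun_obj F x) (fun_obj F y) (fun_obj F z) (fun_map F y z g) (fun_map F x y f))"

definition id_functor :: "('o, 'm, 'o, 'm) kfun" where
  "id_functor = \<lparr>fun_obj = (\<lambda>x. x), fun_map = (\<lambda>x y f. f)\<rparr>"

definition comp_functor ::
  "('p, 'n, 'q, 'l) kfun \<Rightarrow> ('o, 'm, 'p, 'n) kfun \<Rightarrow> ('o, 'm, 'q, 'l) kfun" where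
  "comp_functor G F =
     \<lparr>fun_obj = (\<lambda>x. fun_obj G (fun_obj F x)),
      fun_map = (\<lambda>x y f. fun_map G (fun_obj F x) (fun_obj F y) (fun_map F x y f))\<rparr>"

definition nat_trans ::
  "('k, 'o, 'm) kcat \<Rightarrow> ('k, 'p, 'n) kcat \<Rightarrow> ('o, 'm, 'p, 'n) kfun \<Rightarrow> ('o, 'm, 'p, 'n) kfun \<Rightarrow>
   ('o \<Rightarrow> 'n) set" where
  "nat_trans C D F G =
     {\<eta> \<in> (\<Pi>\<^sub>E x\<in>cat_obj C. carrier (cat_hom D (fun_obj F x) (fun_obj G x))).
        \<forall>x\<in>cat_obj C. \<forall>y\<in>cat_obj C. \<forall>f\<in>carrier (cat_hom C x y).
          cat_comp D (fun_obj F x) (fun_obj F y) (fun_obj G y) (\<eta> y) (fun_map F x y f) =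
          cat_comp D (fun_obj F x) (fun_obj G x) (fun_obj G y) (fun_map G x y f) (\<eta> x)}"

definition cat_iso :: "('k, 'o, 'm) kcat \<Rightarrow> 'o \<Rightarrow> 'o \<Rightarrow> 'm \<Rightarrow> bool" where
  "cat_iso C x y f \<longleftrightarrow>
     f \<in> carrier (cat_hom C x y) \<and>
     (\<exists>g\<in>carrier (cat_hom C y x).
        cat_comp C x y x g f = cat_id C x \<and> cat_comp C y x y f g = cat_id C y)"

definition naturally_isomorphic ::
  "('k, 'o, 'm) kcat \<Rightarrow> ('k, 'p, 'n) kcat \<Rightarrow> ('o, 'm, 'p, 'n) kfun \<Rightarrow> ('o, 'm, 'p, 'n) kfun \<Rightarrow> bool" where
  "naturally_isomorphic C D F G \<longleftrightarrow>
     (\<exists>\<eta>\<in>nat_trans C D F G. \<forall>x\<in>cat_obj C. cat_iso D (fun_obj F x) (fun_obj G x) (\<eta> x))"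

definition k_equivalent ::
  "('k, 'e) ring_scheme \<Rightarrow> ('k, 'o, 'm) kcat \<Rightarrow> ('k, 'p, 'n) kcat \<Rightarrow> bool" where
  "k_equivalent k C D \<longleftrightarrow>
     (\<exists>F G. k_functor k C D F \<and> k_functor k D C G \<and>
        naturally_isomorphic C C (comp_functor G F) id_functor \<and>
        naturally_isomorphic D D (comp_functor F G) id_functor)"


section \<open>Left modules and Morita equivalence\<close>

text \<open>
  HOL has no type of all vector spaces. The category of vector spaces is therefore relative to a
  type \<open>'u\<close> playing the role of a universe: its objects are the vector spaces whose
  carriers are subsets of \<open>'u\<close>. Objects which agree on their carriers, but differ in the values
  of the operations elsewhere or in the unused record fields, are isomorphic.
\<close>

definition vect_cat :: "'u itself \<Rightarrow> ('k, 'e) ring_scheme \<Rightarrow> ('k, ('k, 'u) module, 'u \<Rightarrow> 'u) kcat" where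
  "vect_cat U k =
     \<lparr>cat_obj = {V. module k V},
      cat_hom = (\<lambda>V W.
        \<lparr>carrier = {f \<in> extensional (carrier V). linear_map k V W f},
         monoid.mult = undefined, one = undefined,
         zero = (\<lambda>v\<in>carrier V. \<zero>\<^bsub>W\<^esub>),
         add = (\<lambda>f g. \<lambda>v\<in>carrier V. f v \<oplus>\<^bsub>W\<^esub> g v),
         smult = (\<lambda>c f. \<lambda>v\<in>carrier V. c \<odot>\<^bsub>W\<^esub> f v)\<rparr>),
      cat_comp = (\<lambda>V W X g f. compose (carrier V) g f),
      cat_id = (\<lambda>V. \<lambda>v\<in>carrier V. v)\<rparr>"

definition functor_cat ::
  "('k, 'e) ring_scheme \<Rightarrow> ('k, 'o, 'm) kcat \<Rightarrow> ('k, 'p, 'n) kcat \<Rightarrow>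
   ('k, ('o, 'm, 'p, 'n) kfun, 'o \<Rightarrow> 'n) kcat" where
  "functor_cat k C D =
     \<lparr>cat_obj = {F. k_functor k C D F},
      cat_hom = (\<lambda>F G.
        \<lparr>carrier = nat_trans C D F G,
         monoid.mult = undefined, one = undefined,
         zero = (\<lambda>x\<in>cat_obj C. \<zero>\<^bsub>cat_hom D (fun_obj F x) (fun_obj G x)\<^esub>),
         add = (\<lambda>\<eta> \<theta>. \<lambda>x\<in>cat_obj C. \<eta> x \<oplus>\<^bsub>cat_hom D (fun_obj F x) (fun_obj G x)\<^esub> \<theta> x),
         smult = (\<lambda>c \<eta>. \<lambda>x\<in>cat_obj C. c \<odot>\<^bsub>cat_hom D (fun_obj F x) (fun_obj G x)\<^esub> \<eta> x)\<rparr>),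
      cat_comp = (\<lambda>F G H \<theta> \<eta>. \<lambda>x\<in>cat_obj C.
        cat_comp D (fun_obj F x) (fun_obj G x) (fun_obj H x) (\<theta> x) (\<eta> x)),
      cat_id = (\<lambda>F. \<lambda>x\<in>cat_obj C. cat_id D (fun_obj F x))\<rparr>"

definition left_modules ::
  "'u itself \<Rightarrow> ('k, 'e) ring_scheme \<Rightarrow> ('k, 'o, 'm) kcat \<Rightarrow>
   ('k, ('o, 'm, ('k, 'u) module, 'u \<Rightarrow> 'u) kfun, 'o \<Rightarrow> 'u \<Rightarrow> 'u) kcat" where
  "left_modules U k C = functor_cat k C (vect_cat U k)"

definition morita_equivalent ::
  "'u itself \<Rightarrow> ('k, 'e) ring_scheme \<Rightarrow> ('k, 'o, 'm) kcat \<Rightarrow> ('k, 'p, 'n) kcat \<Rightarrow> bool" where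
  "morita_equivalent U k C D \<longleftrightarrow> k_equivalent k (left_modules U k C) (left_modules U k D)"


section \<open>The category built from pointwise Morita data\<close>

text \<open>\<open>\<phi>\<^sub>x : Q\<^sub>x \<otimes>\<^sub>k P\<^sub>x \<rightarrow> Q\<^sub>x \<otimes>\<^bsub>B\<^sub>x\<^esub> P\<^sub>x \<rightarrow> A\<^sub>x\<close>, where \<open>vphi\<close> is the second map.\<close>

definition pairing ::
  "('o \<Rightarrow> ('k, 'b) module) \<Rightarrow> ('o \<Rightarrow> ('k, 'p, 'b, 'm) bimod) \<Rightarrow> ('o \<Rightarrow> ('k, 'q, 'm, 'b) bimod) \<Rightarrow>
   ('o \<Rightarrow> ('q, 'p) tensor \<Rightarrow> 'm) \<Rightarrow> 'o \<Rightarrow> ('q, 'p) tensor \<Rightarrow> 'm" where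
  "pairing B P Q vphi x t = vphi x (tensor_proj (B x) (Q x) (P x) t)"

definition morita_hom ::
  "('k, 'o, 'm) kcat \<Rightarrow> ('o \<Rightarrow> ('k, 'p, 'b, 'm) bimod) \<Rightarrow> ('o \<Rightarrow> ('k, 'q, 'm, 'b) bimod) \<Rightarrow>
   'o \<Rightarrow> 'o \<Rightarrow> ('k, (('p, 'm) tensor, 'q) tensor, 'b, 'b) bimod" where
  "morita_hom C P Q x y =
     tensor (end_algebra C x) (tensor (end_algebra C y) (P y) (hom_bimod C x y)) (Q x)"

text \<open>The element \<open>p \<otimes> f \<otimes> q\<close> for \<open>f\<close> from \<open>x\<close> to \<open>y\<close>.\<close>

definition triple_tensor ::
  "('k, 'o, 'm) kcat \<Rightarrow> ('o \<Rightarrow> ('k, 'p, 'b, 'm) bimod) \<Rightarrow> ('o \<Rightarrow> ('k, 'q, 'm, 'b) bimod) \<Rightarrow>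
   'o \<Rightarrow> 'o \<Rightarrow> 'p \<Rightarrow> 'm \<Rightarrow> 'q \<Rightarrow> (('p, 'm) tensor, 'q) tensor" where
  "triple_tensor C P Q x y p f q =
     pure_tensor (end_algebra C x) (tensor (end_algebra C y) (P y) (hom_bimod C x y)) (Q x)
       (pure_tensor (end_algebra C y) (P y) (hom_bimod C x y) p f) q"

definition triple_lift ::
  "('w, 'f) ring_scheme \<Rightarrow> ('p \<Rightarrow> 'm \<Rightarrow> 'q \<Rightarrow> 'w) \<Rightarrow> (('p, 'm) tensor, 'q) tensor \<Rightarrow> 'w" where
  "triple_lift W h = tensor_lift W (\<lambda>s q. tensor_lift W (\<lambda>p f. h p f q) s)"

definition morita_comp ::
  "('k, 'e) ring_scheme \<Rightarrow> ('k, 'o, 'm) kcat \<Rightarrow> ('o \<Rightarrow> ('k, 'b) module) \<Rightarrow>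
   ('o \<Rightarrow> ('k, 'p, 'b, 'm) bimod) \<Rightarrow> ('o \<Rightarrow> ('k, 'q, 'm, 'b) bimod) \<Rightarrow>
   ('o \<Rightarrow> ('q, 'p) tensor \<Rightarrow> 'm) \<Rightarrow> 'o \<Rightarrow> 'o \<Rightarrow> 'o \<Rightarrow>
   (('p, 'm) tensor, 'q) tensor \<Rightarrow> (('p, 'm) tensor, 'q) tensor \<Rightarrow> (('p, 'm) tensor, 'q) tensor" where
  "morita_comp k C B P Q vphi x y z v u =
     triple_lift (morita_hom C P Q x z) (\<lambda>pz g qy.
       triple_lift (morita_hom C P Q x z) (\<lambda>py f qx.
         triple_tensor C P Q x z pz
           (cat_comp C x y z g
             (cat_comp C x y y
               (pairing B P Q vphi y
                 (pure_tensor k (scalar_bimod (Q y)) (scalar_bimod (P y)) qy py))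
               f))
           qx) u) v"

text \<open>The identity morphisms of a category are determined by its composition.\<close>

definition morita_cat ::
  "('k, 'e) ring_scheme \<Rightarrow> ('k, 'o, 'm) kcat \<Rightarrow> ('o \<Rightarrow> ('k, 'b) module) \<Rightarrow>
   ('o \<Rightarrow> ('k, 'p, 'b, 'm) bimod) \<Rightarrow> ('o \<Rightarrow> ('k, 'q, 'm, 'b) bimod) \<Rightarrow>
   ('o \<Rightarrow> ('q, 'p) tensor \<Rightarrow> 'm) \<Rightarrow> ('k, 'o, (('p, 'm) tensor, 'q) tensor) kcat" where
  "morita_cat k C B P Q vphi =
     \<lparr>cat_obj = cat_obj C,
      cat_hom = (\<lambda>x y. module.truncate (morita_hom C P Q x y)),
      cat_comp = morita_comp k C B P Q vphi,
      cat_id = (\<lambda>x. THE e. e \<in> carrier (morita_hom C P Q x x) \<and>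
        (\<forall>y\<in>cat_obj C. \<forall>u\<in>carrier (morita_hom C P Q x y).
           morita_comp k C B P Q vphi x x y u e = u) \<and>
        (\<forall>y\<in>cat_obj C. \<forall>u\<in>carrier (morita_hom C P Q y x).
           morita_comp k C B P Q vphi y x x e u = u))\<rparr>"

end

theory Submission
  imports Defs
begin

text \<open>
  Write \<open>\<phi>(q, p)\<close> for the pairing \<open>Q\<^sub>x \<times> P\<^sub>x \<rightarrow> A\<^sub>x\<close>. Since \<open>P\<^sub>x \<otimes> Q\<^sub>x \<cong> B\<^sub>x\<close> and \<open>Q\<^sub>x \<otimes> P\<^sub>x \<cong> A\<^sub>x\<close>, there are
  finite families with \<open>\<Sum> p\<^sub>a \<phi>(q\<^sub>a, p) = p\<close>, \<open>\<Sum> \<phi>(q, p\<^sub>a) q\<^sub>a = q\<close> and with \<open>\<Sum> \<phi>(q'\<^sub>i, p'\<^sub>i) = 1\<close>; the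
  first one gives the identity \<open>\<Sum> p\<^sub>a \<otimes> 1 \<otimes> q\<^sub>a\<close> of \<open>x\<close> in \<open>D\<close>. Then \<open>f \<mapsto> (p'\<^sub>i \<otimes> f \<otimes> q'\<^sub>j)\<close> and
  \<open>p \<otimes> f \<otimes> q \<mapsto> (\<phi>(q\<^sub>a, p) f \<phi>(q, p\<^sub>b))\<close> are multiplicative maps from the morphisms of \<open>C\<close> to matrices
  over \<open>D\<close> and conversely. Along such a map a module \<open>N\<close> is pulled back to the tuples in \<open>N(x)\<close> that
  are fixed by the idempotent matrix of the identity. This replaces \<open>P\<^sub>x \<otimes> N(x)\<close> and \<open>Q\<^sub>x \<otimes> N(x)\<close> by
  spaces of tuples, which can be encoded in the infinite universe \<open>'u\<close>. Both composites are
  conjugations \<open>f \<mapsto> s f t\<close> by a column \<open>s\<close> and a row \<open>t\<close> with \<open>t s = 1\<close>, so pulling back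
  twice is isomorphic to the identity.
\<close>

section \<open>Additive maps and the universal property of the tensor product\<close>

text \<open>The obstacle is size. A module over C takes values in spaces carried by
  \<open>'u\<close>, whereas P_x \<otimes> N(x) is a space of cosets of another type, and nothing
  bounds P_x by \<open>'u\<close>. The invertibility of P_x and Q_x removes it: P_x is a direct
  summand of a finite power of A_x, and Q_x of a finite power of B_x, so each tensor product with a
  module is a summand of a finite power of that module, cut out by an idempotent. Finite powers of
  subsets of an infinite \<open>'u\<close> can be placed in \<open>'u\<close> again.

  Two finite families are kept apart because they have different origins: the dual basis comes from
  the unit of B_x and makes the passage from D to C multiplicative, the other family comes from the
  unit of A_x and does this for the passage from C to D. The composition of D involves only \<phi>,
  while \<psi> is merely some isomorphism, so every identity that is used has to be expressed
  through \<phi>.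

  Tensor products consist of cosets and maps out of them are evaluated on chosen representatives;
  the universal property isolates this, after which only values on pure tensors are
  computed.\<close>

definition additive_map ::
  "('v, 'f) ring_scheme \<Rightarrow> ('w, 'g) ring_scheme \<Rightarrow> ('v \<Rightarrow> 'w) \<Rightarrow> bool" where
  "additive_map V W f \<longleftrightarrow> f \<in> carrier V \<rightarrow> carrier W \<and>
     (\<forall>v\<in>carrier V. \<forall>v'\<in>carrier V. f (v \<oplus>\<^bsub>V\<^esub> v') = f v \<oplus>\<^bsub>W\<^esub> f v')"

lemma additive_mapI:
  assumes "\<And>v. v \<in> carrier V \<Longrightarrow> f v \<in> carrier W"
    and "\<And>v v'. \<lbrakk>v \<in> carrier V; v' \<in> carrier V\<rbrakk> \<Longrightarrow> f (v \<oplus>\<^bsub>V\<^esub> v') = f v \<oplus>\<^bsub>W\<^esub> f v'"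
  shows "additive_map V W f"
  using assms by (auto simp: additive_map_def)

lemma additive_map_closed: "\<lbrakk>additive_map V W f; v \<in> carrier V\<rbrakk> \<Longrightarrow> f v \<in> carrier W"
  by (auto simp: additive_map_def)

lemma additive_map_add:
  "\<lbrakk>additive_map V W f; v \<in> carrier V; v' \<in> carrier V\<rbrakk> \<Longrightarrow> f (v \<oplus>\<^bsub>V\<^esub> v') = f v \<oplus>\<^bsub>W\<^esub> f v'"
  by (auto simp: additive_map_def)

lemma additive_map_zero:
  assumes "additive_map V W f" "abelian_group V" "abelian_group W"
  shows "f \<zero>\<^bsub>V\<^esub> = \<zero>\<^bsub>W\<^esub>"
proof -
  interpret V: abelian_group V by fact
  interpret W: abelian_group W by fact
  have c: "f \<zero>\<^bsub>V\<^esub> \<in> carrier W" using additive_map_closed[OF assms(1)] by simp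
  have "f \<zero>\<^bsub>V\<^esub> \<oplus>\<^bsub>W\<^esub> f \<zero>\<^bsub>V\<^esub> = f \<zero>\<^bsub>V\<^esub>"
    using additive_map_add[OF assms(1), of "\<zero>\<^bsub>V\<^esub>" "\<zero>\<^bsub>V\<^esub>"] by simp
  then show ?thesis using c by simp
qed

lemma additive_map_minus:
  assumes "additive_map V W f" "abelian_group V" "abelian_group W" "v \<in> carrier V"
  shows "f (\<ominus>\<^bsub>V\<^esub> v) = \<ominus>\<^bsub>W\<^esub> f v"
proof -
  interpret V: abelian_group V by fact
  interpret W: abelian_group W by fact
  have "f (\<ominus>\<^bsub>V\<^esub> v) \<oplus>\<^bsub>W\<^esub> f v = \<zero>\<^bsub>W\<^esub>"
    using additive_map_add[OF assms(1), of "\<ominus>\<^bsub>V\<^esub> v" v] additive_map_zero[OF assms(1-3)] assms(4)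
    by (simp add: V.l_neg)
  then show ?thesis using additive_map_closed[OF assms(1)] assms(4) by (simp add: W.minus_equality)
qed

lemma additive_map_finsum:
  assumes f: "additive_map V W f" and V: "abelian_group V" and W: "abelian_group W"
    and "finite I" and "\<And>i. i \<in> I \<Longrightarrow> v i \<in> carrier V"
  shows "f (finsum V v I) = (\<Oplus>\<^bsub>W\<^esub>i\<in>I. f (v i))"
proof -
  interpret V: abelian_group V by fact
  interpret W: abelian_group W by fact
  show ?thesis using assms(4,5)
  proof (induction I)
    case empty
    then show ?case by (simp add: additive_map_zero[OF f V W])
  next
    case (insert i I)
    then have 1: "v \<in> I \<rightarrow> carrier V" and 2: "(\<lambda>i. f (v i)) \<in> I \<rightarrow> carrier W"
      using additive_map_closed[OF f] by auto
    have "f (finsum V v (insert i I)) = f (v i \<oplus>\<^bsub>V\<^esub> finsum V v I)"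
      using insert 1 by (subst V.finsum_insert) auto
    also have "\<dots> = f (v i) \<oplus>\<^bsub>W\<^esub> f (finsum V v I)"
      using insert 1 by (intro additive_map_add[OF f]) auto
    also have "\<dots> = (\<Oplus>\<^bsub>W\<^esub>i\<in>insert i I. f (v i))"
      using insert 2 additive_map_closed[OF f] by (subst W.finsum_insert) auto
    finally show ?case .
  qed
qed

lemma additive_map_compose:
  assumes "additive_map U V f" "additive_map V W g"
  shows "additive_map U W (\<lambda>u. g (f u))"
  using assms by (auto simp: additive_map_def Pi_iff)

lemma (in abelian_group) additive_map_sum:
  assumes "additive_map V G f" "additive_map V G g"
  shows "additive_map V G (\<lambda>v. f v \<oplus> g v)"
  using assms by (auto intro!: additive_mapI simp: additive_map_closed additive_map_add a_ac)

text \<open>Serves to recognise a matrix product, a finite sum of composites, as an additive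
  function of one factor, so that it can be tested on generators.\<close>

lemma (in abelian_group) additive_map_sum_family:
  assumes "\<And>i. i \<in> I \<Longrightarrow> additive_map V G (f i)"
  shows "additive_map V G (\<lambda>v. \<Oplus>i\<in>I. f i v)"
proof (rule additive_mapI)
  note closed = additive_map_closed[OF assms] and add = additive_map_add[OF assms]
  fix v assume v: "v \<in> carrier V"
  show "(\<Oplus>i\<in>I. f i v) \<in> carrier G" using v closed by (auto intro!: finsum_closed)
  fix w assume w: "w \<in> carrier V"
  have "(\<Oplus>i\<in>I. f i (v \<oplus>\<^bsub>V\<^esub> w)) = (\<Oplus>i\<in>I. f i v \<oplus> f i w)"
    using v w closed add by (intro finsum_cong') auto
  also have "\<dots> = (\<Oplus>i\<in>I. f i v) \<oplus> (\<Oplus>i\<in>I. f i w)"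
    using v w closed by (intro finsum_addf) auto
  finally show "(\<Oplus>i\<in>I. f i (v \<oplus>\<^bsub>V\<^esub> w)) = (\<Oplus>i\<in>I. f i v) \<oplus> (\<Oplus>i\<in>I. f i w)" .
qed

text \<open>The interchange of sums behind the associativity of matrix products acting on
  tuples.\<close>

lemma (in abelian_group) finsum_swap:
  assumes "finite I" "finite J" "\<And>i j. \<lbrakk>i \<in> I; j \<in> J\<rbrakk> \<Longrightarrow> f i j \<in> carrier G"
  shows "(\<Oplus>i\<in>I. \<Oplus>j\<in>J. f i j) = (\<Oplus>j\<in>J. \<Oplus>i\<in>I. f i j)"
  using assms(1,3)
proof (induction I)
  case empty
  then show ?case by simp
next
  case (insert i I)
  have "(\<Oplus>i\<in>insert i I. \<Oplus>j\<in>J. f i j) = (\<Oplus>j\<in>J. f i j) \<oplus> (\<Oplus>i\<in>I. \<Oplus>j\<in>J. f i j)"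
    using insert by (intro finsum_insert) (auto intro!: finsum_closed)
  also have "\<dots> = (\<Oplus>j\<in>J. f i j) \<oplus> (\<Oplus>j\<in>J. \<Oplus>i\<in>I. f i j)"
    using insert by simp
  also have "\<dots> = (\<Oplus>j\<in>J. f i j \<oplus> (\<Oplus>i\<in>I. f i j))"
    using insert by (intro finsum_addf[symmetric]) (auto intro!: finsum_closed)
  also have "\<dots> = (\<Oplus>j\<in>J. \<Oplus>i\<in>insert i I. f i j)"
    using insert by (intro finsum_cong') (auto intro!: finsum_closed simp: finsum_insert Pi_def)
  finally show ?case .
qed

text \<open>The homomorphism out of the free abelian group that extends \<open>f\<close>. Its body
  is the expression inside \<open>tensor_lift\<close>, which is thus \<open>frag_eval\<close> at a
  chosen representative.\<close>

definition frag_eval :: "('w, 'f) ring_scheme \<Rightarrow> ('a \<Rightarrow> 'w) \<Rightarrow> ('a \<Rightarrow>\<^sub>0 int) \<Rightarrow> 'w" where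
  "frag_eval W f r = (\<Oplus>\<^bsub>W\<^esub>z\<in>Poly_Mapping.keys r. [Poly_Mapping.lookup r z] \<cdot>\<^bsub>W\<^esub> f z)"

context abelian_group
begin

text \<open>Cancellation can make the support of a sum smaller than the union of the supports.
  Additivity is therefore compared on a common finite index set, where the extra terms are zero
  multiples.\<close>

lemma frag_eval_superset:
  assumes f: "f \<in> S \<rightarrow> carrier G" and K: "finite K" "K \<subseteq> S" "Poly_Mapping.keys r \<subseteq> K"
  shows "frag_eval G f r = (\<Oplus>z\<in>K. [Poly_Mapping.lookup r z] \<cdot> f z)"
  unfolding frag_eval_def
proof (rule add.finprod_mono_neutral_cong_left)
  show "[Poly_Mapping.lookup r z] \<cdot> f z = \<zero>" if "z \<in> K - Poly_Mapping.keys r" for z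
    using that by (simp add: in_keys_iff add_pow_def)
  show "(\<lambda>z. [Poly_Mapping.lookup r z] \<cdot> f z) \<in> K \<rightarrow> carrier G"
    using f K by auto
qed (use K in auto)

lemma frag_eval_hom:
  assumes f: "f \<in> S \<rightarrow> carrier G"
  shows "frag_eval G f \<in> hom (free_Abelian_group S) (add_monoid G)"
proof (rule homI)
  fix r assume "r \<in> carrier (free_Abelian_group S)"
  then show "frag_eval G f r \<in> carrier (add_monoid G)"
    using f by (auto simp: frag_eval_def intro!: finsum_closed)
next
  fix r s assume rs: "r \<in> carrier (free_Abelian_group S)" "s \<in> carrier (free_Abelian_group S)"
  let ?K = "Poly_Mapping.keys r \<union> Poly_Mapping.keys s"
  have K: "finite ?K" "?K \<subseteq> S" "Poly_Mapping.keys (r + s) \<subseteq> ?K"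
    using rs keys_add[of r s] by auto
  have fK: "f z \<in> carrier G" if "z \<in> ?K" for z
    using f K(2) that by blast
  have cl: "(\<lambda>z. [n z] \<cdot> f z) \<in> ?K \<rightarrow> carrier G" for n :: "_ \<Rightarrow> int"
    using f K by auto
  have "frag_eval G f (r + s) = (\<Oplus>z\<in>?K. [Poly_Mapping.lookup (r + s) z] \<cdot> f z)"
    by (rule frag_eval_superset[OF f K])
  also have "\<dots> = (\<Oplus>z\<in>?K. [Poly_Mapping.lookup r z] \<cdot> f z \<oplus> [Poly_Mapping.lookup s z] \<cdot> f z)"
    using fK by (intro finsum_cong') (auto simp: lookup_add add.int_pow_mult simp del: Un_iff)
  also have "\<dots> = (\<Oplus>z\<in>?K. [Poly_Mapping.lookup r z] \<cdot> f z) \<oplus> (\<Oplus>z\<in>?K. [Poly_Mapping.lookup s z] \<cdot> f z)"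
    by (rule finsum_addf[OF cl cl])
  also have "\<dots> = frag_eval G f r \<oplus> frag_eval G f s"
    using K by (simp add: frag_eval_superset[OF f, of ?K])
  finally show "frag_eval G f (r \<otimes>\<^bsub>free_Abelian_group S\<^esub> s) = frag_eval G f r \<otimes>\<^bsub>add_monoid G\<^esub> frag_eval G f s"
    by simp
qed

lemma frag_eval_frag_of: "f z \<in> carrier G \<Longrightarrow> frag_eval G f (frag_of z) = f z"
  by (simp add: frag_eval_def)

lemma frag_eval_diff:
  assumes "f \<in> S \<rightarrow> carrier G" "Poly_Mapping.keys r \<subseteq> S" "Poly_Mapping.keys s \<subseteq> S"
  shows "frag_eval G f (r - s) = frag_eval G f r \<ominus> frag_eval G f s"
proof -
  interpret h: group_hom "free_Abelian_group S" "add_monoid G" "frag_eval G f"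
    using frag_eval_hom[OF assms(1)] by (simp add: group_hom_def group_hom_axioms_def add.is_group)
  have "frag_eval G f (r \<otimes>\<^bsub>free_Abelian_group S\<^esub> inv\<^bsub>free_Abelian_group S\<^esub> s) =
      frag_eval G f r \<oplus> \<ominus> frag_eval G f s"
    using assms h.hom_mult[of r "inv\<^bsub>free_Abelian_group S\<^esub> s"] h.hom_inv[of s] by (simp add: a_inv_def)
  then show ?thesis using assms by (simp add: minus_eq)
qed

end

section \<open>Balanced maps and the additive group of a tensor product\<close>

definition balanced_map ::
  "('a, 'f) ring_scheme \<Rightarrow> ('k, 'm, 'b, 'a, 'h) bimod_scheme \<Rightarrow> ('k, 'n, 'a, 'c, 'i) bimod_scheme \<Rightarrow>
   ('w, 'g) ring_scheme \<Rightarrow> ('m \<Rightarrow> 'n \<Rightarrow> 'w) \<Rightarrow> bool" where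
  "balanced_map A M N W h \<longleftrightarrow>
     (\<forall>m\<in>carrier M. additive_map N W (h m)) \<and>
     (\<forall>n\<in>carrier N. additive_map M W (\<lambda>m. h m n)) \<and>
     (\<forall>m\<in>carrier M. \<forall>a\<in>carrier A. \<forall>n\<in>carrier N. h (ract M m a) n = h m (lact N a n))"

lemma balanced_mapI:
  assumes "\<And>m n. \<lbrakk>m \<in> carrier M; n \<in> carrier N\<rbrakk> \<Longrightarrow> h m n \<in> carrier W"
    and "\<And>m n n'. \<lbrakk>m \<in> carrier M; n \<in> carrier N; n' \<in> carrier N\<rbrakk> \<Longrightarrow> h m (n \<oplus>\<^bsub>N\<^esub> n') = h m n \<oplus>\<^bsub>W\<^esub> h m n'"
    and "\<And>m m' n. \<lbrakk>m \<in> carrier M; m' \<in> carrier M; n \<in> carrier N\<rbrakk> \<Longrightarrow> h (m \<oplus>\<^bsub>M\<^esub> m') n = h m n \<oplus>\<^bsub>W\<^esub> h m' n"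
    and "\<And>m a n. \<lbrakk>m \<in> carrier M; a \<in> carrier A; n \<in> carrier N\<rbrakk> \<Longrightarrow> h (ract M m a) n = h m (lact N a n)"
  shows "balanced_map A M N W h"
  using assms by (auto simp: balanced_map_def additive_map_def)

lemma balanced_map_closed:
  "\<lbrakk>balanced_map A M N W h; m \<in> carrier M; n \<in> carrier N\<rbrakk> \<Longrightarrow> h m n \<in> carrier W"
  by (auto simp: balanced_map_def additive_map_def)

lemma balanced_map_right:
  "\<lbrakk>balanced_map A M N W h; m \<in> carrier M\<rbrakk> \<Longrightarrow> additive_map N W (h m)"
  by (auto simp: balanced_map_def)

lemma balanced_map_left:
  "\<lbrakk>balanced_map A M N W h; n \<in> carrier N\<rbrakk> \<Longrightarrow> additive_map M W (\<lambda>m. h m n)"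
  by (auto simp: balanced_map_def)

lemma balanced_map_balanced:
  "\<lbrakk>balanced_map A M N W h; m \<in> carrier M; a \<in> carrier A; n \<in> carrier N\<rbrakk> \<Longrightarrow>
   h (ract M m a) n = h m (lact N a n)"
  by (auto simp: balanced_map_def)

text \<open>Formulated with the additive groups and the two inner actions only, so that it covers
  bimodules as well as vector spaces turned into \<open>scalar_bimod\<close> for the tensor product
  over \<open>k\<close>.\<close>

locale tensor_product = M: abelian_group M + N: abelian_group N
  for A :: "('a, 'f) ring_scheme" and M :: "('k, 'm, 'b, 'a, 'h) bimod_scheme"
    and N :: "('k, 'n, 'a, 'c, 'i) bimod_scheme" +
  assumes ract_closed: "\<lbrakk>m \<in> carrier M; a \<in> carrier A\<rbrakk> \<Longrightarrow> ract M m a \<in> carrier M"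
    and lact_closed: "\<lbrakk>a \<in> carrier A; n \<in> carrier N\<rbrakk> \<Longrightarrow> lact N a n \<in> carrier N"
begin

abbreviation "F \<equiv> free_Abelian_group (carrier M \<times> carrier N)"
abbreviation "K \<equiv> tensor_kernel A M N"
abbreviation "T \<equiv> tensor A M N"
abbreviation "pt \<equiv> pure_tensor A M N"

lemma keys_diff_subset:
  "\<lbrakk>Poly_Mapping.keys r \<subseteq> S; Poly_Mapping.keys s \<subseteq> S\<rbrakk> \<Longrightarrow> Poly_Mapping.keys (r - s) \<subseteq> S"
  for r s :: "'z \<Rightarrow>\<^sub>0 int"
  using keys_diff[of r s] by blast

lemma relators_closed: "tensor_relators A M N \<subseteq> carrier F"
  unfolding tensor_relators_def
  by (intro Un_least subsetI; elim CollectE exE conjE; simp add: keys_diff_subset ract_closed lact_closed)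

lemma kernel_normal: "K \<lhd> F"
  unfolding tensor_kernel_def
  by (rule comm_group.normal_iff_subgroup[THEN iffD2, OF abelian_free_Abelian_group
      group.generate_is_subgroup[OF group_free_Abelian_group relators_closed]])

lemma T_simps: "carrier T = rcosets\<^bsub>F\<^esub> K" "zero T = K" "add T = set_mult F"
  "carrier (tensor_additive A M N) = carrier T" "add (tensor_additive A M N) = add T"
  "zero (tensor_additive A M N) = zero T"
  by (simp_all add: tensor_def tensor_additive_def tensor_group_def FactGroup_def Let_def)

lemma tensor_group_comm: "comm_group (tensor_group A M N)"
  unfolding tensor_group_def
  using comm_group.abelian_FactGroup[OF abelian_free_Abelian_group normal_imp_subgroup[OF kernel_normal]] .

lemma abelian_additive: "abelian_group (tensor_additive A M N)"
proof -
  have "add_monoid (tensor_additive A M N) = tensor_group A M N"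
    by (simp add: tensor_additive_def tensor_group_def FactGroup_def)
  then have "comm_group (add_monoid (tensor_additive A M N))" using tensor_group_comm by simp
  then show ?thesis
    by (simp add: abelian_group_def abelian_group_axioms_def abelian_monoid_def comm_group.axioms)
qed

lemma abelian_T: "abelian_group T"
proof -
  interpret X: abelian_group "tensor_additive A M N" by (rule abelian_additive)
  show ?thesis
  proof (rule abelian_groupI)
    fix t assume t: "t \<in> carrier T"
    show "\<exists>s\<in>carrier T. s \<oplus>\<^bsub>T\<^esub> t = \<zero>\<^bsub>T\<^esub>"
      using X.l_neg[of t] X.a_inv_closed[of t] t by (auto simp: T_simps(4-6))
  qed (use X.a_closed X.zero_closed X.a_assoc X.a_comm X.l_zero in \<open>simp_all add: T_simps(4-6)\<close>)
qed

text \<open>The actions in the record \<open>tensor\<close> are lifts with values in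
  \<open>tensor_additive\<close>, which has the same additive structure. This equation moves their
  additivity to \<open>T\<close>.\<close>

lemma additive_map_tensor_additive:
  "additive_map V (tensor_additive A M N) = additive_map V T"
  by (simp add: additive_map_def T_simps fun_eq_iff)

lemma coset_add:
  "\<lbrakk>r \<in> carrier F; s \<in> carrier F\<rbrakk> \<Longrightarrow> (K #>\<^bsub>F\<^esub> r) \<oplus>\<^bsub>T\<^esub> (K #>\<^bsub>F\<^esub> s) = K #>\<^bsub>F\<^esub> (r + s)"
  by (simp add: T_simps normal.rcos_sum[OF kernel_normal] del: carrier_free_Abelian_group_iff)

lemma coset_eqI:
  assumes "r \<in> carrier F" "s \<in> carrier F" "r - s \<in> K"
  shows "K #>\<^bsub>F\<^esub> r = K #>\<^bsub>F\<^esub> s"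
proof -
  have "r = (r - s) \<otimes>\<^bsub>F\<^esub> s" by simp
  then have "r \<in> K #>\<^bsub>F\<^esub> s" using assms(3) unfolding r_coset_def by blast
  then show ?thesis
    using group.repr_independence[OF group_free_Abelian_group _ _ normal_imp_subgroup[OF kernel_normal]]
      assms(2) by metis
qed

lemma relator_in_kernel: "r \<in> tensor_relators A M N \<Longrightarrow> r \<in> K"
  unfolding tensor_kernel_def by (rule generate.incl)

lemma pure_closed: "\<lbrakk>m \<in> carrier M; n \<in> carrier N\<rbrakk> \<Longrightarrow> pt m n \<in> carrier T"
  by (auto simp: T_simps pure_tensor_def RCOSETS_def)

lemma pure_balanced: "balanced_map A M N T pt"
proof (rule balanced_mapI)
  fix m n n' assume *: "m \<in> carrier M" "n \<in> carrier N" "n' \<in> carrier N"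
  have "frag_of (m, n \<oplus>\<^bsub>N\<^esub> n') - (frag_of (m, n) + frag_of (m, n')) \<in> K"
    using * by (intro relator_in_kernel) (force simp: tensor_relators_def diff_diff_eq)
  then show "pt m (n \<oplus>\<^bsub>N\<^esub> n') = pt m n \<oplus>\<^bsub>T\<^esub> pt m n'"
    unfolding pure_tensor_def
    using * keys_add[of "frag_of (m, n)" "frag_of (m, n')"] coset_add[of "frag_of (m, n)" "frag_of (m, n')"]
    by (simp, intro coset_eqI) auto
next
  fix m m' n assume *: "m \<in> carrier M" "m' \<in> carrier M" "n \<in> carrier N"
  have "frag_of (m \<oplus>\<^bsub>M\<^esub> m', n) - (frag_of (m, n) + frag_of (m', n)) \<in> K"
    using * by (intro relator_in_kernel) (force simp: tensor_relators_def diff_diff_eq)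
  then show "pt (m \<oplus>\<^bsub>M\<^esub> m') n = pt m n \<oplus>\<^bsub>T\<^esub> pt m' n"
    unfolding pure_tensor_def
    using * keys_add[of "frag_of (m, n)" "frag_of (m', n)"] coset_add[of "frag_of (m, n)" "frag_of (m', n)"]
    by (simp, intro coset_eqI) auto
next
  fix m a n assume *: "m \<in> carrier M" "a \<in> carrier A" "n \<in> carrier N"
  have "frag_of (ract M m a, n) - frag_of (m, lact N a n) \<in> K"
    using * by (intro relator_in_kernel) (force simp: tensor_relators_def)
  then show "pt (ract M m a) n = pt m (lact N a n)"
    unfolding pure_tensor_def using * by (intro coset_eqI) (auto simp: ract_closed lact_closed)
qed (rule pure_closed)

text \<open>Pure tensors generate the group under addition alone, because 0 = 0 \<otimes> 0 and -(m
  \<otimes> n) = (-m) \<otimes> n are themselves pure.\<close>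

lemma tensor_induct [consumes 1, case_names pure add]:
  assumes t: "t \<in> carrier T"
    and pure: "\<And>m n. \<lbrakk>m \<in> carrier M; n \<in> carrier N\<rbrakk> \<Longrightarrow> R (pt m n)"
    and add: "\<And>s t. \<lbrakk>s \<in> carrier T; t \<in> carrier T; R s; R t\<rbrakk> \<Longrightarrow> R (s \<oplus>\<^bsub>T\<^esub> t)"
  shows "R t"
proof -
  interpret T: abelian_group T by (rule abelian_T)
  have zero: "\<zero>\<^bsub>T\<^esub> = pt \<zero>\<^bsub>M\<^esub> \<zero>\<^bsub>N\<^esub>"
    using additive_map_zero[OF balanced_map_right[OF pure_balanced] N.abelian_group_axioms abelian_T] by simp
  have coset_zero: "K #>\<^bsub>F\<^esub> 0 = \<zero>\<^bsub>T\<^esub>"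
    using group.coset_mult_one[OF group_free_Abelian_group]
      subgroup.subset[OF normal_imp_subgroup[OF kernel_normal]]
    by (metis one_free_Abelian_group T_simps(2))
  from t obtain r where r: "Poly_Mapping.keys r \<subseteq> carrier M \<times> carrier N" "t = K #>\<^bsub>F\<^esub> r"
    by (auto simp: T_simps RCOSETS_def)
  \<comment> \<open>The induction on formal sums has a case for differences, so the claim is carried
    for r and -r together: x - y is x + (-y), and its negative is y + (-x).\<close>
  have "R (K #>\<^bsub>F\<^esub> r) \<and> R (K #>\<^bsub>F\<^esub> (- r))" using r(1)
  proof (induction r rule: free_Abelian_group_induct[consumes 1])
    case 1
    then show ?case using pure[of "\<zero>\<^bsub>M\<^esub>" "\<zero>\<^bsub>N\<^esub>"] by (simp add: zero coset_zero)
  next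
    case (2 x y)
    have cl: "K #>\<^bsub>F\<^esub> z \<in> carrier T" if "Poly_Mapping.keys z \<subseteq> carrier M \<times> carrier N" for z
      using that by (auto simp: T_simps RCOSETS_def)
    have "K #>\<^bsub>F\<^esub> (x - y) = (K #>\<^bsub>F\<^esub> x) \<oplus>\<^bsub>T\<^esub> (K #>\<^bsub>F\<^esub> (- y))"
      "K #>\<^bsub>F\<^esub> (- (x - y)) = (K #>\<^bsub>F\<^esub> y) \<oplus>\<^bsub>T\<^esub> (K #>\<^bsub>F\<^esub> (- x))"
      using 2 by (simp_all add: coset_add)
    then show ?case using 2 add cl by simp
  next
    case (3 z)
    then obtain m n where z: "z = (m, n)" "m \<in> carrier M" "n \<in> carrier N" by auto
    \<comment> \<open>The pure tensor (-m) \<otimes> n and the coset of \<open>- frag_of z\<close>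
      are both additive inverses of m \<otimes> n, hence equal.\<close>
    have "pt (\<ominus>\<^bsub>M\<^esub> m) n \<oplus>\<^bsub>T\<^esub> pt m n = \<zero>\<^bsub>T\<^esub>"
      using z additive_map_minus[OF balanced_map_left[OF pure_balanced] M.abelian_group_axioms abelian_T]
      by (simp add: T.l_neg pure_closed)
    moreover have "(K #>\<^bsub>F\<^esub> (- frag_of z)) \<oplus>\<^bsub>T\<^esub> pt m n = \<zero>\<^bsub>T\<^esub>"
      using z coset_add[of "- frag_of z" "frag_of z"] by (simp add: pure_tensor_def coset_zero)
    moreover have "K #>\<^bsub>F\<^esub> (- frag_of z) \<in> carrier T"
      using z by (auto simp: T_simps RCOSETS_def intro!: bexI[of _ "- frag_of z"])
    ultimately have "K #>\<^bsub>F\<^esub> (- frag_of z) = pt (\<ominus>\<^bsub>M\<^esub> m) n"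
      using z by (metis T.minus_equality pure_closed M.a_inv_closed)
    then show ?case using z pure[of "\<ominus>\<^bsub>M\<^esub> m" n] pure[of m n] by (simp add: pure_tensor_def)
  qed
  then show ?thesis using r by simp
qed

text \<open>The representative picked by \<open>SOME\<close> does not matter: the extension of
  \<open>h\<close> to formal sums kills the relators by biadditivity and balancedness, hence the
  subgroup they generate, and so is constant on cosets.\<close>

lemma tensor_lift_coset:
  assumes W: "abelian_group W" and h: "balanced_map A M N W h" and r: "r \<in> carrier F"
  shows "tensor_lift W h (K #>\<^bsub>F\<^esub> r) = frag_eval W (\<lambda>z. h (fst z) (snd z)) r"
proof -
  interpret W: abelian_group W by (rule W)
  let ?f = "\<lambda>z. h (fst z) (snd z)"
  have f: "?f \<in> carrier M \<times> carrier N \<rightarrow> carrier W"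
    using balanced_map_closed[OF h] by auto
  interpret g: group_hom F "add_monoid W" "frag_eval W ?f"
    using W.frag_eval_hom[OF f] by (simp add: group_hom_def group_hom_axioms_def W.add.is_group)
  have rel: "frag_eval W ?f z = \<zero>\<^bsub>W\<^esub>" if "z \<in> tensor_relators A M N" for z
    using that unfolding tensor_relators_def
  proof (elim UnE CollectE exE conjE)
    fix m m' n assume z: "z = frag_of (m \<oplus>\<^bsub>M\<^esub> m', n) - frag_of (m, n) - frag_of (m', n)"
      and *: "m \<in> carrier M" "m' \<in> carrier M" "n \<in> carrier N"
    show ?thesis unfolding z
      using * balanced_map_closed[OF h] additive_map_add[OF balanced_map_left[OF h], of n m m']
      by (simp add: W.frag_eval_diff[OF f] keys_diff_subset W.frag_eval_frag_of W.minus_eq W.a_ac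
          W.minus_add W.r_neg W.r_neg1 W.r_neg2)
  next
    fix m n n' assume z: "z = frag_of (m, n \<oplus>\<^bsub>N\<^esub> n') - frag_of (m, n) - frag_of (m, n')"
      and *: "m \<in> carrier M" "n \<in> carrier N" "n' \<in> carrier N"
    show ?thesis unfolding z
      using * balanced_map_closed[OF h] additive_map_add[OF balanced_map_right[OF h], of m n n']
      by (simp add: W.frag_eval_diff[OF f] keys_diff_subset W.frag_eval_frag_of W.minus_eq W.a_ac
          W.minus_add W.r_neg W.r_neg1 W.r_neg2)
  next
    fix m a n assume z: "z = frag_of (ract M m a, n) - frag_of (m, lact N a n)"
      and *: "m \<in> carrier M" "a \<in> carrier A" "n \<in> carrier N"
    show ?thesis unfolding z
      using * balanced_map_closed[OF h] balanced_map_balanced[OF h]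
      by (simp add: W.frag_eval_diff[OF f] keys_diff_subset W.frag_eval_frag_of W.minus_eq
          ract_closed lact_closed W.r_neg)
  qed
  have "K \<subseteq> kernel F (add_monoid W) (frag_eval W ?f)"
    unfolding tensor_kernel_def
    using subsetD[OF relators_closed] rel
    by (intro group.generate_subgroup_incl[OF group_free_Abelian_group _ g.subgroup_kernel] subsetI)
      (simp add: kernel_def)
  then have ker: "frag_eval W ?f s = \<zero>\<^bsub>W\<^esub>" "s \<in> carrier F" if "s \<in> K" for s
    using that by (auto simp: kernel_def)
  have "r \<in> K #>\<^bsub>F\<^esub> r"
    using r group.rcos_self[OF group_free_Abelian_group _ normal_imp_subgroup[OF kernel_normal]] by blast
  then have "(SOME s. s \<in> K #>\<^bsub>F\<^esub> r) \<in> K #>\<^bsub>F\<^esub> r" by (rule someI)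
  then obtain s where s: "s \<in> K" "(SOME s. s \<in> K #>\<^bsub>F\<^esub> r) = s \<otimes>\<^bsub>F\<^esub> r"
    unfolding r_coset_def by blast
  have "tensor_lift W h (K #>\<^bsub>F\<^esub> r) = frag_eval W ?f (s \<otimes>\<^bsub>F\<^esub> r)"
    by (simp only: tensor_lift_def Let_def s(2) frag_eval_def)
  also have "\<dots> = frag_eval W ?f s \<oplus>\<^bsub>W\<^esub> frag_eval W ?f r"
    using g.hom_mult[of s r] ker(2)[OF s(1)] r by simp
  also have "\<dots> = frag_eval W ?f r" using ker(1)[OF s(1)] g.hom_closed[OF r] by simp
  finally show ?thesis .
qed

lemma tensor_lift_pure:
  assumes "abelian_group W" "balanced_map A M N W h" "m \<in> carrier M" "n \<in> carrier N"
  shows "tensor_lift W h (pt m n) = h m n"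
  unfolding pure_tensor_def using assms balanced_map_closed[OF assms(2)]
  by (subst tensor_lift_coset) (auto simp: abelian_group.frag_eval_frag_of)

lemma tensor_lift_additive:
  assumes W: "abelian_group W" and h: "balanced_map A M N W h"
  shows "additive_map T W (tensor_lift W h)"
proof -
  interpret W: abelian_group W by (rule W)
  have f: "(\<lambda>z. h (fst z) (snd z)) \<in> carrier M \<times> carrier N \<rightarrow> carrier W"
    using balanced_map_closed[OF h] by auto
  note g = W.frag_eval_hom[OF f]
  show ?thesis
  proof (rule additive_mapI)
    fix t assume "t \<in> carrier T"
    then obtain r where r: "r \<in> carrier F" "t = K #>\<^bsub>F\<^esub> r" by (auto simp: T_simps RCOSETS_def)
    then show "tensor_lift W h t \<in> carrier W"
      using hom_in_carrier[OF g r(1)] by (simp only: tensor_lift_coset[OF W h r(1)]) simp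
  next
    fix t t' assume "t \<in> carrier T" "t' \<in> carrier T"
    then obtain r r' where r: "r \<in> carrier F" "t = K #>\<^bsub>F\<^esub> r" "r' \<in> carrier F" "t' = K #>\<^bsub>F\<^esub> r'"
      by (auto simp: T_simps RCOSETS_def)
    have rr: "r + r' \<in> carrier F" using r keys_add[of r r'] by auto
    show "tensor_lift W h (t \<oplus>\<^bsub>T\<^esub> t') = tensor_lift W h t \<oplus>\<^bsub>W\<^esub> tensor_lift W h t'"
      using hom_mult[OF g r(1) r(3)]
      by (simp only: r(2,4) coset_add[OF r(1,3)] tensor_lift_coset[OF W h] rr r(1,3)) simp
  qed
qed

text \<open>The way in which identities on tensor products are proved below: both sides are
  recognised as additive in one variable and compared on pure tensors.\<close>

lemma additive_maps_eq:
  assumes "additive_map T W f" "additive_map T W g"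
    and "\<And>m n. \<lbrakk>m \<in> carrier M; n \<in> carrier N\<rbrakk> \<Longrightarrow> f (pt m n) = g (pt m n)" and "t \<in> carrier T"
  shows "f t = g t"
  using assms(4) by (induction t rule: tensor_induct) (auto simp: assms(3) additive_map_add[OF assms(1)] additive_map_add[OF assms(2)])

text \<open>The terms are indexed by an initial segment of the naturals, since they later serve as
  rows and columns of matrices.\<close>

lemma tensor_expansion:
  assumes "t \<in> carrier T"
  shows "\<exists>(r::nat) m n. (\<forall>i<r. m i \<in> carrier M \<and> n i \<in> carrier N) \<and> t = (\<Oplus>\<^bsub>T\<^esub>i\<in>{..<r}. pt (m i) (n i))"
proof -
  interpret T: abelian_group T by (rule abelian_T)
  let ?E = "\<lambda>t. \<exists>(r::nat) m n. (\<forall>i<r. m i \<in> carrier M \<and> n i \<in> carrier N) \<and> t = (\<Oplus>\<^bsub>T\<^esub>i\<in>{..<r}. pt (m i) (n i))"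
  \<comment> \<open>Induction on \<open>t\<close> with an arbitrary expandable summand
    \<open>s\<close> in front: a sum \<open>u\<close> + \<open>v\<close> is appended in two stages,
    and two index ranges never have to be concatenated.\<close>
  have "\<forall>s\<in>carrier T. ?E s \<longrightarrow> ?E (s \<oplus>\<^bsub>T\<^esub> t)" using assms
  proof (induction t rule: tensor_induct)
    case (pure m' n')
    show ?case
    proof (intro ballI impI)
      fix s assume s: "s \<in> carrier T" "?E s"
      then obtain r :: nat and m n where e: "\<forall>i<r. m i \<in> carrier M \<and> n i \<in> carrier N"
        "s = (\<Oplus>\<^bsub>T\<^esub>i\<in>{..<r}. pt (m i) (n i))" by blast
      let ?m = "m(r := m')" and ?n = "n(r := n')"
      have "(\<Oplus>\<^bsub>T\<^esub>i\<in>{..<Suc r}. pt (?m i) (?n i)) = pt m' n' \<oplus>\<^bsub>T\<^esub> (\<Oplus>\<^bsub>T\<^esub>i\<in>{..<r}. pt (?m i) (?n i))"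
        unfolding lessThan_Suc using e(1) pure by (subst T.finsum_insert) (auto intro!: pure_closed)
      also have "(\<Oplus>\<^bsub>T\<^esub>i\<in>{..<r}. pt (?m i) (?n i)) = s"
        unfolding e(2) using e(1) by (intro T.finsum_cong') (auto intro!: pure_closed)
      finally have "s \<oplus>\<^bsub>T\<^esub> pt m' n' = (\<Oplus>\<^bsub>T\<^esub>i\<in>{..<Suc r}. pt (?m i) (?n i))"
        using s pure by (simp add: T.a_comm pure_closed)
      moreover have "\<forall>i<Suc r. ?m i \<in> carrier M \<and> ?n i \<in> carrier N" using e(1) pure by auto
      ultimately show "?E (s \<oplus>\<^bsub>T\<^esub> pt m' n')" by blast
    qed
  next
    case (add u v)
    show ?case
    proof (intro ballI impI)
      fix s assume s: "s \<in> carrier T" "?E s"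
      then have "?E ((s \<oplus>\<^bsub>T\<^esub> u) \<oplus>\<^bsub>T\<^esub> v)" using add by simp
      then show "?E (s \<oplus>\<^bsub>T\<^esub> (u \<oplus>\<^bsub>T\<^esub> v))" using s add by (simp add: T.a_assoc)
    qed
  qed
  moreover have "?E \<zero>\<^bsub>T\<^esub>" by (intro exI[of _ 0]) simp
  ultimately have "?E (\<zero>\<^bsub>T\<^esub> \<oplus>\<^bsub>T\<^esub> t)" by blast
  then show ?thesis using assms by simp
qed

end

section \<open>The tensor product of bimodules\<close>

context tensor_product
begin

lemma pure_add_left:
  "\<lbrakk>m \<in> carrier M; m' \<in> carrier M; n \<in> carrier N\<rbrakk> \<Longrightarrow> pt (m \<oplus>\<^bsub>M\<^esub> m') n = pt m n \<oplus>\<^bsub>T\<^esub> pt m' n"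
  using additive_map_add[OF balanced_map_left[OF pure_balanced]] .

lemma pure_add_right:
  "\<lbrakk>m \<in> carrier M; n \<in> carrier N; n' \<in> carrier N\<rbrakk> \<Longrightarrow> pt m (n \<oplus>\<^bsub>N\<^esub> n') = pt m n \<oplus>\<^bsub>T\<^esub> pt m n'"
  using additive_map_add[OF balanced_map_right[OF pure_balanced]] .

lemma pure_middle:
  "\<lbrakk>m \<in> carrier M; a \<in> carrier A; n \<in> carrier N\<rbrakk> \<Longrightarrow> pt (ract M m a) n = pt m (lact N a n)"
  using balanced_map_balanced[OF pure_balanced] .

text \<open>The map f \<otimes> g for endomorphisms compatible with the middle algebra. The three
  actions on a tensor product are the instances in which one factor is the identity; the codomain is
  the one that their definitions lift into.\<close>

lemma tensor_map_balanced:
  assumes f: "additive_map M M f" "\<And>m a. \<lbrakk>m \<in> carrier M; a \<in> carrier A\<rbrakk> \<Longrightarrow> f (ract M m a) = ract M (f m) a"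
    and g: "additive_map N N g" "\<And>a n. \<lbrakk>a \<in> carrier A; n \<in> carrier N\<rbrakk> \<Longrightarrow> g (lact N a n) = lact N a (g n)"
  shows "balanced_map A M N (tensor_additive A M N) (\<lambda>m n. pt (f m) (g n))"
  using additive_map_closed[OF f(1)] additive_map_closed[OF g(1)]
  by (intro balanced_mapI)
    (simp_all add: T_simps(4,5) pure_closed additive_map_add[OF f(1)] additive_map_add[OF g(1)]
      pure_add_left pure_add_right f(2) g(2) pure_middle)

end

locale bimodule_tensor = M: bimodule k A B M + N: bimodule k B C N
  for k :: "('k, 'e) ring_scheme" and A :: "('k, 'a, 'f) module_scheme"
    and B :: "('k, 'b, 'g) module_scheme" and C :: "('k, 'c, 'l) module_scheme"
    and M :: "('k, 'm, 'a, 'b, 'h) bimod_scheme" and N :: "('k, 'n, 'b, 'c, 'i) bimod_scheme"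

sublocale bimodule_tensor \<subseteq> tensor_product B M N
  by (intro tensor_product.intro tensor_product_axioms.intro M.M.abelian_group_axioms
      N.M.abelian_group_axioms M.ract_closed N.lact_closed)

context bimodule_tensor
begin

lemma smult_balanced:
  "c \<in> carrier k \<Longrightarrow> balanced_map B M N (tensor_additive B M N) (\<lambda>m n. pt (c \<odot>\<^bsub>M\<^esub> m) n)"
  by (rule tensor_map_balanced[where g = "\<lambda>n. n"])
    (auto intro: additive_mapI simp: M.smult_r_distr M.ract_smult_left)

lemma lact_balanced:
  "a \<in> carrier A \<Longrightarrow> balanced_map B M N (tensor_additive B M N) (\<lambda>m n. pt (lact M a m) n)"
  by (rule tensor_map_balanced[where g = "\<lambda>n. n"])
    (auto intro: additive_mapI simp: M.lact_closed M.lact_add_right M.lact_ract)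

lemma ract_balanced:
  "c \<in> carrier C \<Longrightarrow> balanced_map B M N (tensor_additive B M N) (\<lambda>m n. pt m (ract N n c))"
  by (rule tensor_map_balanced[where f = "\<lambda>m. m"])
    (auto intro: additive_mapI simp: N.ract_closed N.ract_add_left N.lact_ract)

lemma smult_pure:
  "\<lbrakk>c \<in> carrier k; m \<in> carrier M; n \<in> carrier N\<rbrakk> \<Longrightarrow> c \<odot>\<^bsub>T\<^esub> pt m n = pt (c \<odot>\<^bsub>M\<^esub> m) n"
  using tensor_lift_pure[OF abelian_additive smult_balanced] by (simp add: tensor_def Let_def)

lemma lact_pure:
  "\<lbrakk>a \<in> carrier A; m \<in> carrier M; n \<in> carrier N\<rbrakk> \<Longrightarrow> lact T a (pt m n) = pt (lact M a m) n"
  using tensor_lift_pure[OF abelian_additive lact_balanced] by (simp add: tensor_def Let_def)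

lemma ract_pure:
  "\<lbrakk>m \<in> carrier M; n \<in> carrier N; c \<in> carrier C\<rbrakk> \<Longrightarrow> ract T (pt m n) c = pt m (ract N n c)"
  using tensor_lift_pure[OF abelian_additive ract_balanced] by (simp add: tensor_def Let_def)

lemma smult_additive: "c \<in> carrier k \<Longrightarrow> additive_map T T (\<lambda>t. c \<odot>\<^bsub>T\<^esub> t)"
  using tensor_lift_additive[OF abelian_additive smult_balanced, unfolded additive_map_tensor_additive]
  by (simp add: tensor_def Let_def)

lemma lact_additive: "a \<in> carrier A \<Longrightarrow> additive_map T T (lact T a)"
  using tensor_lift_additive[OF abelian_additive lact_balanced, unfolded additive_map_tensor_additive]
  by (simp add: tensor_def Let_def)

lemma ract_additive: "c \<in> carrier C \<Longrightarrow> additive_map T T (\<lambda>t. ract T t c)"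
  using tensor_lift_additive[OF abelian_additive ract_balanced, unfolded additive_map_tensor_additive]
  by (simp add: tensor_def Let_def)

lemmas T_add = abelian_group.additive_map_sum[OF abelian_T]

lemma id_additive_T: "additive_map T T (\<lambda>t. t)"
  by (simp add: additive_map_def)

text \<open>On both sides the scalar c acts as the element c 1 of the middle algebra, and that
  element crosses the tensor sign.\<close>

lemma smult_pure_right:
  assumes "c \<in> carrier k" "m \<in> carrier M" "n \<in> carrier N"
  shows "pt (c \<odot>\<^bsub>M\<^esub> m) n = pt m (c \<odot>\<^bsub>N\<^esub> n)"
proof -
  have "c \<odot>\<^bsub>B\<^esub> \<one>\<^bsub>B\<^esub> \<in> carrier B" using assms by simp
  moreover have "ract M m (c \<odot>\<^bsub>B\<^esub> \<one>\<^bsub>B\<^esub>) = c \<odot>\<^bsub>M\<^esub> m" "lact N (c \<odot>\<^bsub>B\<^esub> \<one>\<^bsub>B\<^esub>) n = c \<odot>\<^bsub>N\<^esub> n"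
    using assms by (simp_all add: M.ract_smult_right M.ract_one N.lact_smult_left N.lact_one)
  ultimately show ?thesis using pure_middle[of m "c \<odot>\<^bsub>B\<^esub> \<one>\<^bsub>B\<^esub>" n] assms by simp
qed

text \<open>Each axiom either is additivity of a lifted action or equates two additive maps of
  \<open>t\<close>, and then it holds once it holds on pure tensors. The same is done for the two
  algebra actions in \<open>bimodule_T\<close>.\<close>

lemma module_T: "module k T"
proof (rule moduleI)
  show "cring k" by unfold_locales
  show "abelian_group T" by (rule abelian_T)
next
  fix a t assume *: "a \<in> carrier k" "t \<in> carrier T"
  then show "a \<odot>\<^bsub>T\<^esub> t \<in> carrier T" by (rule additive_map_closed[OF smult_additive])
next
  fix a t s assume *: "a \<in> carrier k" "t \<in> carrier T" "s \<in> carrier T"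
  then show "a \<odot>\<^bsub>T\<^esub> (t \<oplus>\<^bsub>T\<^esub> s) = a \<odot>\<^bsub>T\<^esub> t \<oplus>\<^bsub>T\<^esub> a \<odot>\<^bsub>T\<^esub> s"
    by (rule additive_map_add[OF smult_additive])
next
  fix a b t assume *: "a \<in> carrier k" "b \<in> carrier k" "t \<in> carrier T"
  show "(a \<oplus>\<^bsub>k\<^esub> b) \<odot>\<^bsub>T\<^esub> t = a \<odot>\<^bsub>T\<^esub> t \<oplus>\<^bsub>T\<^esub> b \<odot>\<^bsub>T\<^esub> t"
    by (rule additive_maps_eq[OF _ _ _ *(3)])
      (use * in \<open>auto intro!: T_add smult_additive simp: smult_pure M.smult_l_distr pure_add_left\<close>)
  show "(a \<otimes>\<^bsub>k\<^esub> b) \<odot>\<^bsub>T\<^esub> t = a \<odot>\<^bsub>T\<^esub> (b \<odot>\<^bsub>T\<^esub> t)"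
    by (rule additive_maps_eq[OF _ additive_map_compose[OF smult_additive smult_additive] _ *(3)])
      (use * in \<open>auto intro!: smult_additive simp: smult_pure M.smult_assoc1\<close>)
next
  fix t assume *: "t \<in> carrier T"
  show "\<one>\<^bsub>k\<^esub> \<odot>\<^bsub>T\<^esub> t = t"
    by (rule additive_maps_eq[OF smult_additive id_additive_T _ *]) (auto simp: smult_pure)
qed

theorem bimodule_T: "bimodule k A C T"
proof (intro bimodule.intro bimodule_axioms.intro)
  show "field k" "k_algebra k A" "k_algebra k C" by unfold_locales
  show "module k T" by (rule module_T)
next
  fix a t assume "a \<in> carrier A" "t \<in> carrier T"
  then show "lact T a t \<in> carrier T" by (rule additive_map_closed[OF lact_additive])
next
  fix a t s assume "a \<in> carrier A" "t \<in> carrier T" "s \<in> carrier T"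
  then show "lact T a (t \<oplus>\<^bsub>T\<^esub> s) = lact T a t \<oplus>\<^bsub>T\<^esub> lact T a s"
    by (rule additive_map_add[OF lact_additive])
next
  fix a b t assume *: "a \<in> carrier A" "b \<in> carrier A" "t \<in> carrier T"
  show "lact T (a \<oplus>\<^bsub>A\<^esub> b) t = lact T a t \<oplus>\<^bsub>T\<^esub> lact T b t"
    by (rule additive_maps_eq[OF _ _ _ *(3)])
      (use * in \<open>auto intro!: T_add lact_additive simp: lact_pure M.lact_add_left M.lact_closed pure_add_left\<close>)
  show "lact T (a \<otimes>\<^bsub>A\<^esub> b) t = lact T a (lact T b t)"
    by (rule additive_maps_eq[OF _ additive_map_compose[OF lact_additive lact_additive] _ *(3)])
      (use * in \<open>auto intro!: lact_additive simp: lact_pure M.lact_mult M.lact_closed\<close>)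
next
  fix c a t assume *: "c \<in> carrier k" "a \<in> carrier A" "t \<in> carrier T"
  show "lact T (c \<odot>\<^bsub>A\<^esub> a) t = c \<odot>\<^bsub>T\<^esub> lact T a t"
    by (rule additive_maps_eq[OF _ additive_map_compose[OF lact_additive smult_additive] _ *(3)])
      (use * in \<open>auto intro!: lact_additive simp: lact_pure smult_pure M.lact_smult_left M.lact_closed\<close>)
  show "lact T a (c \<odot>\<^bsub>T\<^esub> t) = c \<odot>\<^bsub>T\<^esub> lact T a t"
    by (rule additive_maps_eq[OF additive_map_compose[OF smult_additive lact_additive]
          additive_map_compose[OF lact_additive smult_additive] _ *(3)])
      (use * in \<open>auto simp: lact_pure smult_pure M.lact_smult_right M.lact_closed\<close>)
next
  fix t assume *: "t \<in> carrier T"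
  show "lact T \<one>\<^bsub>A\<^esub> t = t"
    by (rule additive_maps_eq[OF lact_additive id_additive_T _ *]) (auto simp: lact_pure M.lact_one)
  show "ract T t \<one>\<^bsub>C\<^esub> = t"
    by (rule additive_maps_eq[OF ract_additive id_additive_T _ *]) (auto simp: ract_pure N.ract_one)
next
  fix t b assume "t \<in> carrier T" "b \<in> carrier C"
  then show "ract T t b \<in> carrier T" using additive_map_closed[OF ract_additive] by blast
next
  fix t s b assume "t \<in> carrier T" "s \<in> carrier T" "b \<in> carrier C"
  then show "ract T (t \<oplus>\<^bsub>T\<^esub> s) b = ract T t b \<oplus>\<^bsub>T\<^esub> ract T s b"
    using additive_map_add[OF ract_additive] by blast
next
  fix t a b assume *: "t \<in> carrier T" "a \<in> carrier C" "b \<in> carrier C"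
  show "ract T t (a \<oplus>\<^bsub>C\<^esub> b) = ract T t a \<oplus>\<^bsub>T\<^esub> ract T t b"
    by (rule additive_maps_eq[OF _ _ _ *(1)])
      (use * in \<open>auto intro!: T_add ract_additive simp: ract_pure N.ract_add_right N.ract_closed pure_add_right\<close>)
  show "ract T t (a \<otimes>\<^bsub>C\<^esub> b) = ract T (ract T t a) b"
    by (rule additive_maps_eq[OF _ additive_map_compose[OF ract_additive ract_additive] _ *(1)])
      (use * in \<open>auto intro!: ract_additive simp: ract_pure N.ract_mult N.ract_closed\<close>)
next
  fix c t b assume *: "c \<in> carrier k" "t \<in> carrier T" "b \<in> carrier C"
  show "ract T (c \<odot>\<^bsub>T\<^esub> t) b = c \<odot>\<^bsub>T\<^esub> ract T t b"
    by (rule additive_maps_eq[OF additive_map_compose[OF smult_additive ract_additive]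
          additive_map_compose[OF ract_additive smult_additive] _ *(2)])
      (use * in \<open>auto simp: ract_pure smult_pure N.ract_closed\<close>)
  show "ract T t (c \<odot>\<^bsub>C\<^esub> b) = c \<odot>\<^bsub>T\<^esub> ract T t b"
    by (rule additive_maps_eq[OF _ additive_map_compose[OF ract_additive smult_additive] _ *(2)])
      (use * in \<open>auto intro!: ract_additive simp: ract_pure smult_pure smult_pure_right N.ract_smult_right N.ract_closed\<close>)
next
  fix a t b assume *: "a \<in> carrier A" "t \<in> carrier T" "b \<in> carrier C"
  show "ract T (lact T a t) b = lact T a (ract T t b)"
    by (rule additive_maps_eq[OF additive_map_compose[OF lact_additive ract_additive]
          additive_map_compose[OF ract_additive lact_additive] _ *(2)])
      (use * in \<open>auto simp: ract_pure lact_pure N.ract_closed M.lact_closed\<close>)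
qed

end

section \<open>Morita contexts\<close>

lemma regular_bimod_simps [simp]:
  "carrier (regular_bimod A) = carrier A" "add (regular_bimod A) = add A"
  "zero (regular_bimod A) = zero A" "smult (regular_bimod A) = smult A"
  "lact (regular_bimod A) = monoid.mult A" "ract (regular_bimod A) = monoid.mult A"
  by (simp_all add: regular_bimod_def module.defs bimod.defs)

lemma scalar_bimod_simps [simp]:
  "carrier (scalar_bimod M) = carrier M" "add (scalar_bimod M) = add M"
  "zero (scalar_bimod M) = zero M" "smult (scalar_bimod M) = smult M"
  "lact (scalar_bimod M) = smult M" "ract (scalar_bimod M) m c = smult M c m"
  by (simp_all add: scalar_bimod_def module.defs bimod.defs)

lemma abelian_group_cong:
  assumes "abelian_group G" "carrier H = carrier G" "add H = add G" "zero H = zero G"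
  shows "abelian_group H"
proof -
  interpret G: abelian_group G by fact
  show ?thesis
  proof (rule abelian_groupI)
    fix x assume x: "x \<in> carrier H"
    show "\<exists>y\<in>carrier H. y \<oplus>\<^bsub>H\<^esub> x = \<zero>\<^bsub>H\<^esub>"
      using G.l_neg[of x] G.a_inv_closed[of x] x assms(2-4) by auto
  qed (use assms(2-4) G.a_assoc G.a_comm in simp_all)
qed

text \<open>Scalars cross the tensor sign over B, so (m, n) \<mapsto> m \<otimes> n is balanced over
  \<open>k\<close> as well and descends from the tensor product over \<open>k\<close>.\<close>

lemma (in bimodule_tensor) tensor_proj_pure:
  assumes "m \<in> carrier M" "n \<in> carrier N"
  shows "tensor_proj B M N (pure_tensor k (scalar_bimod M) (scalar_bimod N) m n) = pt m n"
proof -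
  interpret S: tensor_product k "scalar_bimod M" "scalar_bimod N"
    by (intro tensor_product.intro tensor_product_axioms.intro
        abelian_group_cong[OF M.M.abelian_group_axioms] abelian_group_cong[OF N.M.abelian_group_axioms]) simp_all
  have "balanced_map k (scalar_bimod M) (scalar_bimod N) (tensor_additive B M N) pt"
    by (rule balanced_mapI)
      (auto simp: T_simps(4,5) pure_closed pure_add_left pure_add_right smult_pure_right)
  then show ?thesis
    using assms S.tensor_lift_pure[OF abelian_additive] by (simp add: tensor_proj_def)
qed

text \<open>One half of the invertibility data. \<open>morita_context\<close> contains it twice, for
  \<phi> on Q \<otimes> P and for \<psi> on P \<otimes> Q, so each fact below has a version over A
  and one over B.\<close>

locale pairing_iso = bimodule_tensor k A B A M N
  for k :: "('k, 'e) ring_scheme" and A :: "('k, 'a) module" and B :: "('k, 'b) module"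
    and M :: "('k, 'm, 'a, 'b) bimod" and N :: "('k, 'n, 'b, 'a) bimod" +
  fixes \<theta> :: "('m, 'n) tensor \<Rightarrow> 'a"
  assumes iso: "bimod_iso k A A (tensor B M N) (regular_bimod A) \<theta>"
begin

definition pair :: "'m \<Rightarrow> 'n \<Rightarrow> 'a" where "pair m n = \<theta> (pt m n)"

lemma iso_additive: "additive_map T A \<theta>"
  and iso_lact: "\<lbrakk>a \<in> carrier A; t \<in> carrier T\<rbrakk> \<Longrightarrow> \<theta> (lact T a t) = a \<otimes>\<^bsub>A\<^esub> \<theta> t"
  and iso_ract: "\<lbrakk>a \<in> carrier A; t \<in> carrier T\<rbrakk> \<Longrightarrow> \<theta> (ract T t a) = \<theta> t \<otimes>\<^bsub>A\<^esub> a"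
  and iso_bij: "bij_betw \<theta> (carrier T) (carrier A)"
  using iso by (auto simp: bimod_iso_def bimod_hom_def linear_map_def additive_map_def)

lemma iso_inj: "\<lbrakk>s \<in> carrier T; t \<in> carrier T; \<theta> s = \<theta> t\<rbrakk> \<Longrightarrow> s = t"
  using iso_bij by (auto simp: bij_betw_def inj_on_def)

lemma ex_iso_unit: "\<exists>t\<in>carrier T. \<theta> t = \<one>\<^bsub>A\<^esub>"
  using bij_betw_imp_surj_on[OF iso_bij] M.L.one_closed by (metis imageE)

lemma pair_balanced: "balanced_map B M N A pair"
  unfolding pair_def
  by (rule balanced_mapI)
    (simp_all add: pure_closed additive_map_closed[OF iso_additive] additive_map_add[OF iso_additive, symmetric]
      pure_add_left pure_add_right pure_middle)

lemmas pair_closed = balanced_map_closed[OF pair_balanced]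
lemmas pair_add_left = additive_map_add[OF balanced_map_left[OF pair_balanced]]
lemmas pair_add_right = additive_map_add[OF balanced_map_right[OF pair_balanced]]

lemma pair_lact:
  "\<lbrakk>a \<in> carrier A; m \<in> carrier M; n \<in> carrier N\<rbrakk> \<Longrightarrow> pair (lact M a m) n = a \<otimes>\<^bsub>A\<^esub> pair m n"
  using iso_lact[of a "pt m n"] by (simp add: pair_def pure_closed lact_pure)

lemma pair_ract:
  "\<lbrakk>a \<in> carrier A; m \<in> carrier M; n \<in> carrier N\<rbrakk> \<Longrightarrow> pair m (ract N n a) = pair m n \<otimes>\<^bsub>A\<^esub> a"
  using iso_ract[of a "pt m n"] by (simp add: pair_def pure_closed ract_pure)

text \<open>Expand the preimage of 1 under \<theta> into pure tensors and apply \<theta>.\<close>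

lemma unit_expansion:
  "\<exists>(r::nat) m n. (\<forall>i<r. m i \<in> carrier M \<and> n i \<in> carrier N) \<and>
     (\<Oplus>\<^bsub>A\<^esub>i\<in>{..<r}. pair (m i) (n i)) = \<one>\<^bsub>A\<^esub>"
proof -
  obtain t where t: "t \<in> carrier T" "\<theta> t = \<one>\<^bsub>A\<^esub>" using ex_iso_unit by blast
  obtain r :: nat and m n where e: "\<forall>i<r. m i \<in> carrier M \<and> n i \<in> carrier N"
      "t = (\<Oplus>\<^bsub>T\<^esub>i\<in>{..<r}. pt (m i) (n i))"
    using tensor_expansion[OF t(1)] by blast
  have "\<theta> t = (\<Oplus>\<^bsub>A\<^esub>i\<in>{..<r}. pair (m i) (n i))"
    unfolding e(2) pair_def
    by (rule additive_map_finsum[OF iso_additive abelian_T M.L.abelian_group_axioms])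
      (use e(1) in \<open>auto simp: pure_closed\<close>)
  then show ?thesis using e(1) t(2) by (intro exI[of _ r] exI[of _ m] exI[of _ n]) simp
qed

end

locale morita_context =
  P: bimodule k B A P + Q: bimodule k A B Q
  for k :: "('k, 'e) ring_scheme" and A :: "('k, 'a) module" and B :: "('k, 'b) module"
    and P :: "('k, 'p, 'b, 'a) bimod" and Q :: "('k, 'q, 'a, 'b) bimod" +
  fixes \<phi> :: "('q, 'p) tensor \<Rightarrow> 'a" and \<psi> :: "('p, 'q) tensor \<Rightarrow> 'b"
  assumes \<phi>_iso: "bimod_iso k A A (tensor B Q P) (regular_bimod A) \<phi>"
    and \<psi>_iso: "bimod_iso k B B (tensor A P Q) (regular_bimod B) \<psi>"
begin

sublocale PQ: pairing_iso k B A P Q \<psi> by unfold_locales (rule \<psi>_iso)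
sublocale QP: pairing_iso k A B Q P \<phi> by unfold_locales (rule \<phi>_iso)

text \<open>Injectivity of \<phi> turns equal pairings into y \<otimes> x = y' \<otimes> x for all
  x. Applying q \<otimes> x \<mapsto> q \<psi>(x, z) gives y b = y' b for every value b = \<psi>(x,
  z), and finitely many such values sum to 1 in B.\<close>

lemma pair_nondegenerate:
  assumes y: "y \<in> carrier Q" "y' \<in> carrier Q" and eq: "\<And>x. x \<in> carrier P \<Longrightarrow> QP.pair y x = QP.pair y' x"
  shows "y = y'"
proof -
  obtain r :: nat and p q where e: "\<forall>i<r. p i \<in> carrier P \<and> q i \<in> carrier Q"
      "(\<Oplus>\<^bsub>B\<^esub>i\<in>{..<r}. PQ.pair (p i) (q i)) = \<one>\<^bsub>B\<^esub>"
    using PQ.unit_expansion by blast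
  have pt: "QP.pt y x = QP.pt y' x" if "x \<in> carrier P" for x
    using eq[OF that] y that by (intro QP.iso_inj QP.pure_closed) (simp_all add: QP.pair_def)
  have act: "ract Q y (PQ.pair x z) = ract Q y' (PQ.pair x z)" if xz: "x \<in> carrier P" "z \<in> carrier Q" for x z
  proof -
    let ?h = "\<lambda>y x. ract Q y (PQ.pair x z)"
    have "balanced_map B Q P Q ?h"
      by (rule balanced_mapI)
        (use xz in \<open>auto simp: Q.ract_closed PQ.pair_closed Q.ract_add_left Q.ract_add_right PQ.pair_add_left
            PQ.pair_lact Q.ract_mult\<close>)
    from QP.tensor_lift_pure[OF Q.M.abelian_group_axioms this] show ?thesis
      using y xz pt by metis
  qed
  have "y = (\<Oplus>\<^bsub>Q\<^esub>i\<in>{..<r}. ract Q y (PQ.pair (p i) (q i)))" if "y \<in> carrier Q" for y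
  proof -
    have "additive_map B Q (ract Q y)"
      using that by (auto intro: additive_mapI simp: Q.ract_closed Q.ract_add_right)
    from additive_map_finsum[OF this P.L.abelian_group_axioms Q.M.abelian_group_axioms,
        of "{..<r}" "\<lambda>i. PQ.pair (p i) (q i)"]
    show ?thesis using e that by (simp add: PQ.pair_closed Q.ract_one)
  qed
  note expand = this
  have "(\<Oplus>\<^bsub>Q\<^esub>i\<in>{..<r}. ract Q y (PQ.pair (p i) (q i))) = (\<Oplus>\<^bsub>Q\<^esub>i\<in>{..<r}. ract Q y' (PQ.pair (p i) (q i)))"
    using e(1) y by (intro Q.M.finsum_cong') (auto simp: act PQ.pair_closed Q.ract_closed)
  then show ?thesis using expand[OF y(1)] expand[OF y(2)] by simp
qed

text \<open>The isomorphism \<open>\<psi>\<close> need not be compatible with \<open>\<phi>\<close>; the expansion of the unit of \<open>B\<close> is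
  therefore corrected by the automorphism of \<open>P\<close> that measures the failure of associativity.\<close>

theorem dual_basis:
  "\<exists>(r::nat) p q. (\<forall>i<r. p i \<in> carrier P \<and> q i \<in> carrier Q) \<and>
     (\<forall>x\<in>carrier P. (\<Oplus>\<^bsub>P\<^esub>i\<in>{..<r}. ract P (p i) (QP.pair (q i) x)) = x) \<and>
     (\<forall>y\<in>carrier Q. (\<Oplus>\<^bsub>Q\<^esub>i\<in>{..<r}. lact Q (QP.pair y (p i)) (q i)) = y)"
proof -
  obtain r :: nat and p q where e: "\<And>i. i < r \<Longrightarrow> p i \<in> carrier P" "\<And>i. i < r \<Longrightarrow> q i \<in> carrier Q"
      "(\<Oplus>\<^bsub>B\<^esub>i\<in>{..<r}. PQ.pair (p i) (q i)) = \<one>\<^bsub>B\<^esub>"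
    using PQ.unit_expansion by blast
  obtain u where u: "u \<in> carrier QP.T" "\<phi> u = \<one>\<^bsub>A\<^esub>"
    using QP.ex_iso_unit by blast
  \<comment> \<open>If \<phi> and \<psi> were compatible, this map would send t to p \<phi>(t), and
    its value at u would be p because \<phi>(u) = 1. In general p \<mapsto> \<Theta>(p, u) is the
    correction.\<close>
  define \<Theta> where "\<Theta> p = tensor_lift P (\<lambda>q' p'. lact P (PQ.pair p q') p')" for p
  have bal: "balanced_map B Q P P (\<lambda>q' p'. lact P (PQ.pair p q') p')" if "p \<in> carrier P" for p
    by (rule balanced_mapI)
      (use that in \<open>auto simp: PQ.pair_closed P.lact_closed P.lact_add_left P.lact_add_right PQ.pair_add_right
          PQ.pair_ract P.lact_mult\<close>)
  note \<Theta>_pure = QP.tensor_lift_pure[OF P.M.abelian_group_axioms bal, folded \<Theta>_def]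
  note \<Theta>_additive = QP.tensor_lift_additive[OF P.M.abelian_group_axioms bal, folded \<Theta>_def]
  have \<Theta>_ract: "ract P (\<Theta> p t) a = \<Theta> p (ract QP.T t a)"
    if "p \<in> carrier P" "a \<in> carrier A" "t \<in> carrier QP.T" for p t a
  proof (rule QP.additive_maps_eq[OF additive_map_compose[OF \<Theta>_additive]
        additive_map_compose[OF QP.ract_additive \<Theta>_additive] _ that(3)])
    show "additive_map P P (\<lambda>x. ract P x a)"
      using that by (auto intro: additive_mapI simp: P.ract_closed P.ract_add_left)
  qed (use that in \<open>auto simp: \<Theta>_pure QP.ract_pure P.ract_closed P.lact_ract PQ.pair_closed\<close>)
  define p' where "p' i = \<Theta> (p i) u" for i
  have p': "p' i \<in> carrier P" if "i < r" for i
    using that e u by (simp add: p'_def additive_map_closed[OF \<Theta>_additive])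
  have left: "(\<Oplus>\<^bsub>P\<^esub>i\<in>{..<r}. ract P (p' i) (QP.pair (q i) x)) = x" if x: "x \<in> carrier P" for x
  proof -
    \<comment> \<open>The elements u \<phi>(q_i, x) and q_i \<otimes> x have the same image
      \<phi>(q_i, x), hence coincide. So p'_i \<phi>(q_i, x) = \<Theta>(p_i, q_i \<otimes> x) =
      \<psi>(p_i, q_i) x.\<close>
    have "ract P (p' i) (QP.pair (q i) x) = lact P (PQ.pair (p i) (q i)) x" if i: "i < r" for i
    proof -
      have "ract QP.T u (QP.pair (q i) x) = QP.pt (q i) x"
        using i x e u QP.pair_closed[of "q i" x] additive_map_closed[OF QP.ract_additive, of "QP.pair (q i) x" u]
        by (intro QP.iso_inj) (auto simp: QP.pure_closed QP.iso_ract QP.pair_def)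
      then show ?thesis
        using i x e u QP.pair_closed[of "q i" x] by (simp add: p'_def \<Theta>_ract \<Theta>_pure)
    qed
    then have "(\<Oplus>\<^bsub>P\<^esub>i\<in>{..<r}. ract P (p' i) (QP.pair (q i) x)) = (\<Oplus>\<^bsub>P\<^esub>i\<in>{..<r}. lact P (PQ.pair (p i) (q i)) x)"
      using x e by (intro P.M.finsum_cong') (auto simp: P.lact_closed PQ.pair_closed)
    also have "\<dots> = lact P (\<Oplus>\<^bsub>B\<^esub>i\<in>{..<r}. PQ.pair (p i) (q i)) x"
      using x e
      by (intro additive_map_finsum[symmetric, OF _ P.L.abelian_group_axioms P.M.abelian_group_axioms])
        (auto intro: additive_mapI simp: P.lact_closed P.lact_add_left PQ.pair_closed)
    finally show ?thesis using x by (simp add: e(3) P.lact_one)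
  qed
  \<comment> \<open>Follows from the first identity by testing against every x: \<phi>(\<Sum>
    \<phi>(y, p'_i) q_i, x) = \<phi>(y, \<Sum> p'_i \<phi>(q_i, x)) = \<phi>(y, x).\<close>
  have right: "(\<Oplus>\<^bsub>Q\<^esub>i\<in>{..<r}. lact Q (QP.pair y (p' i)) (q i)) = y" if y: "y \<in> carrier Q" for y
  proof (rule pair_nondegenerate)
    have cl: "lact Q (QP.pair y (p' i)) (q i) \<in> carrier Q" if "i < r" for i
      using y e p' that by (simp add: Q.lact_closed QP.pair_closed)
    then show "(\<Oplus>\<^bsub>Q\<^esub>i\<in>{..<r}. lact Q (QP.pair y (p' i)) (q i)) \<in> carrier Q"
      by (auto intro!: Q.M.finsum_closed)
    fix x assume x: "x \<in> carrier P"
    have "QP.pair (\<Oplus>\<^bsub>Q\<^esub>i\<in>{..<r}. lact Q (QP.pair y (p' i)) (q i)) x =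
        (\<Oplus>\<^bsub>A\<^esub>i\<in>{..<r}. QP.pair (lact Q (QP.pair y (p' i)) (q i)) x)"
      using cl by (intro additive_map_finsum[OF balanced_map_left[OF QP.pair_balanced x]
            Q.M.abelian_group_axioms P.R.abelian_group_axioms]) auto
    also have "\<dots> = (\<Oplus>\<^bsub>A\<^esub>i\<in>{..<r}. QP.pair y (ract P (p' i) (QP.pair (q i) x)))"
      using x y p' e by (intro P.R.finsum_cong') (auto simp: QP.pair_closed QP.pair_lact QP.pair_ract P.ract_closed)
    also have "\<dots> = QP.pair y (\<Oplus>\<^bsub>P\<^esub>i\<in>{..<r}. ract P (p' i) (QP.pair (q i) x))"
      using x p' e by (intro additive_map_finsum[symmetric, OF balanced_map_right[OF QP.pair_balanced y]
            P.M.abelian_group_axioms P.R.abelian_group_axioms]) (auto simp: P.ract_closed QP.pair_closed)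
    finally show "QP.pair (\<Oplus>\<^bsub>Q\<^esub>i\<in>{..<r}. lact Q (QP.pair y (p' i)) (q i)) x = QP.pair y x"
      using left[OF x] by simp
  qed (rule y)
  show ?thesis using p' e(2) left right by (intro exI[of _ r] exI[of _ p'] exI[of _ q]) simp
qed

end

section \<open>Pulling back modules along matrix functors\<close>

lemma linear_map_additive: "linear_map k V W f \<Longrightarrow> additive_map V W f"
  by (auto simp: linear_map_def additive_map_def)

lemma vect_cat_simps [simp]:
  "V \<in> cat_obj (vect_cat U k) \<longleftrightarrow> module k V"
  "f \<in> carrier (cat_hom (vect_cat U k) V W) \<longleftrightarrow> f \<in> extensional (carrier V) \<and> linear_map k V W f"
  "add (cat_hom (vect_cat U k) V W) = (\<lambda>f g. \<lambda>v\<in>carrier V. f v \<oplus>\<^bsub>W\<^esub> g v)"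
  "smult (cat_hom (vect_cat U k) V W) = (\<lambda>c f. \<lambda>v\<in>carrier V. c \<odot>\<^bsub>W\<^esub> f v)"
  "cat_comp (vect_cat U k) V W X g f = compose (carrier V) g f"
  "cat_id (vect_cat U k) V = (\<lambda>v\<in>carrier V. v)"
  by (simp_all add: vect_cat_def)

lemma linear_mapI:
  assumes "\<And>v. v \<in> carrier V \<Longrightarrow> f v \<in> carrier W"
    and "\<And>v v'. \<lbrakk>v \<in> carrier V; v' \<in> carrier V\<rbrakk> \<Longrightarrow> f (v \<oplus>\<^bsub>V\<^esub> v') = f v \<oplus>\<^bsub>W\<^esub> f v'"
    and "\<And>c v. \<lbrakk>c \<in> carrier k; v \<in> carrier V\<rbrakk> \<Longrightarrow> f (c \<odot>\<^bsub>V\<^esub> v) = c \<odot>\<^bsub>W\<^esub> f v"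
  shows "linear_map k V W f"
  using assms by (auto simp: linear_map_def)

lemma linear_mapD:
  assumes "linear_map k V W f"
  shows "v \<in> carrier V \<Longrightarrow> f v \<in> carrier W"
    and "\<lbrakk>v \<in> carrier V; v' \<in> carrier V\<rbrakk> \<Longrightarrow> f (v \<oplus>\<^bsub>V\<^esub> v') = f v \<oplus>\<^bsub>W\<^esub> f v'"
    and "\<lbrakk>c \<in> carrier k; v \<in> carrier V\<rbrakk> \<Longrightarrow> f (c \<odot>\<^bsub>V\<^esub> v) = c \<odot>\<^bsub>W\<^esub> f v"
  using assms by (auto simp: linear_map_def)

lemma linear_map_compose:
  "\<lbrakk>linear_map k U V f; linear_map k V W g\<rbrakk> \<Longrightarrow> linear_map k U W (\<lambda>u. g (f u))"
  by (rule linear_mapI) (simp_all add: linear_mapD)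

lemma linear_map_finsum:
  assumes "module k W" "finite I" "\<And>i. i \<in> I \<Longrightarrow> linear_map k V W (f i)"
  shows "linear_map k V W (\<lambda>v. \<Oplus>\<^bsub>W\<^esub>i\<in>I. f i v)"
proof -
  interpret W: module k W by fact
  note lin = linear_mapD[OF assms(3)]
  have add: "additive_map V W (\<lambda>v. \<Oplus>\<^bsub>W\<^esub>i\<in>I. f i v)"
    by (rule W.additive_map_sum_family[OF linear_map_additive[OF assms(3)]])
  show ?thesis
  proof (rule linear_mapI)
    fix c v assume c: "c \<in> carrier k" and v: "v \<in> carrier V"
    have "(\<Oplus>\<^bsub>W\<^esub>i\<in>I. f i (c \<odot>\<^bsub>V\<^esub> v)) = (\<Oplus>\<^bsub>W\<^esub>i\<in>I. c \<odot>\<^bsub>W\<^esub> f i v)"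
      using c v by (intro W.finsum_cong') (auto simp: lin)
    also have "\<dots> = c \<odot>\<^bsub>W\<^esub> (\<Oplus>\<^bsub>W\<^esub>i\<in>I. f i v)"
      using c v assms(2) by (intro W.finsum_smult_ldistr[symmetric]) (auto simp: lin)
    finally show "(\<Oplus>\<^bsub>W\<^esub>i\<in>I. f i (c \<odot>\<^bsub>V\<^esub> v)) = c \<odot>\<^bsub>W\<^esub> (\<Oplus>\<^bsub>W\<^esub>i\<in>I. f i v)" .
  qed (use additive_map_closed[OF add] additive_map_add[OF add] in auto)
qed

section \<open>Modules as linear functors to vector spaces\<close>

locale left_module = k_category k D
  for k :: "('k, 'e) ring_scheme" and D :: "('k, 'o, 'n) kcat" +
  fixes N :: "('o, 'n, ('k, 'u) module, 'u \<Rightarrow> 'u) kfun"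
  assumes is_functor: "k_functor k D (vect_cat TYPE('u) k) N"
begin

lemma obj_module: "x \<in> cat_obj D \<Longrightarrow> module k (fun_obj N x)"
  using is_functor by (auto simp: k_functor_def)

lemma obj_abelian: "x \<in> cat_obj D \<Longrightarrow> abelian_group (fun_obj N x)"
  using obj_module by (auto simp: module_def)

lemma fun_map_linear:
  "\<lbrakk>x \<in> cat_obj D; y \<in> cat_obj D\<rbrakk> \<Longrightarrow>
   linear_map k (cat_hom D x y) (cat_hom (vect_cat TYPE('u) k) (fun_obj N x) (fun_obj N y)) (fun_map N x y)"
  using is_functor by (auto simp: k_functor_def)

lemma act_linear:
  "\<lbrakk>x \<in> cat_obj D; y \<in> cat_obj D; u \<in> carrier (cat_hom D x y)\<rbrakk> \<Longrightarrow>
   linear_map k (fun_obj N x) (fun_obj N y) (fun_map N x y u)"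
  using linear_mapD(1)[OF fun_map_linear] by simp

lemmas act_closed = linear_mapD(1)[OF act_linear]
lemmas act_add = linear_mapD(2)[OF act_linear]
lemmas act_smult = linear_mapD(3)[OF act_linear]

lemma act_linear_left:
  assumes "x \<in> cat_obj D" "y \<in> cat_obj D" "v \<in> carrier (fun_obj N x)"
  shows "linear_map k (cat_hom D x y) (fun_obj N y) (\<lambda>u. fun_map N x y u v)"
proof -
  show ?thesis
    by (rule linear_mapI) (use assms in \<open>auto simp: act_closed linear_mapD[OF fun_map_linear]\<close>)
qed

lemma act_id: "\<lbrakk>x \<in> cat_obj D; v \<in> carrier (fun_obj N x)\<rbrakk> \<Longrightarrow> fun_map N x x (cat_id D x) v = v"
  using is_functor by (auto simp: k_functor_def)

lemma act_comp:
  assumes "x \<in> cat_obj D" "y \<in> cat_obj D" "z \<in> cat_obj D"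
    "f \<in> carrier (cat_hom D x y)" "g \<in> carrier (cat_hom D y z)" "v \<in> carrier (fun_obj N x)"
  shows "fun_map N x z (cat_comp D x y z g f) v = fun_map N y z g (fun_map N x y f v)"
proof -
  have "fun_map N x z (cat_comp D x y z g f) = compose (carrier (fun_obj N x)) (fun_map N y z g) (fun_map N x y f)"
    using is_functor assms(1-5) by (simp add: k_functor_def)
  then show ?thesis using assms(6) by (simp add: compose_eq)
qed

end

text \<open>Morphisms of \<open>vect_cat\<close> are extensional functions, so each functor law may
  be tested on elements of a carrier. The rule leaves element equations and linearity in each
  variable.\<close>

lemma k_functor_vectI:
  assumes "\<And>x. x \<in> cat_obj D \<Longrightarrow> module k (fun_obj N x)"
    and ext: "\<And>x y u. \<lbrakk>x \<in> cat_obj D; y \<in> cat_obj D; u \<in> carrier (cat_hom D x y)\<rbrakk> \<Longrightarrow>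
      fun_map N x y u \<in> extensional (carrier (fun_obj N x))"
    and lin: "\<And>x y u. \<lbrakk>x \<in> cat_obj D; y \<in> cat_obj D; u \<in> carrier (cat_hom D x y)\<rbrakk> \<Longrightarrow>
      linear_map k (fun_obj N x) (fun_obj N y) (fun_map N x y u)"
    and lin': "\<And>x y v. \<lbrakk>x \<in> cat_obj D; y \<in> cat_obj D; v \<in> carrier (fun_obj N x)\<rbrakk> \<Longrightarrow>
      linear_map k (cat_hom D x y) (fun_obj N y) (\<lambda>u. fun_map N x y u v)"
    and id: "\<And>x v. \<lbrakk>x \<in> cat_obj D; v \<in> carrier (fun_obj N x)\<rbrakk> \<Longrightarrow> fun_map N x x (cat_id D x) v = v"
    and comp: "\<And>x y z f g v. \<lbrakk>x \<in> cat_obj D; y \<in> cat_obj D; z \<in> cat_obj D; f \<in> carrier (cat_hom D x y);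
      g \<in> carrier (cat_hom D y z); v \<in> carrier (fun_obj N x)\<rbrakk> \<Longrightarrow>
      fun_map N x z (cat_comp D x y z g f) v = fun_map N y z g (fun_map N x y f v)"
    and D: "k_category k D"
  shows "k_functor k D (vect_cat TYPE('u) k) (N :: ('o, 'n, ('k, 'u) module, 'u \<Rightarrow> 'u) kfun)"
  unfolding k_functor_def
proof (intro conjI ballI)
  interpret D: k_category k D by (rule D)
  show "fun_obj N \<in> cat_obj D \<rightarrow> cat_obj (vect_cat TYPE('u) k)" using assms(1) by auto
  fix x assume x: "x \<in> cat_obj D"
  show "fun_map N x x (cat_id D x) = cat_id (vect_cat TYPE('u) k) (fun_obj N x)"
    by (rule extensionalityI[of _ "carrier (fun_obj N x)"]) (use x in \<open>auto simp: id intro!: ext D.id_closed\<close>)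
  fix y assume y: "y \<in> cat_obj D"
  interpret m: module k "cat_hom D x y" by (rule D.hom_module[OF x y])
  show "linear_map k (cat_hom D x y) (cat_hom (vect_cat TYPE('u) k) (fun_obj N x) (fun_obj N y)) (fun_map N x y)"
  proof (rule linear_mapI)
    fix u assume u: "u \<in> carrier (cat_hom D x y)"
    then show "fun_map N x y u \<in> carrier (cat_hom (vect_cat TYPE('u) k) (fun_obj N x) (fun_obj N y))"
      using x y lin ext by simp
    fix u' assume u': "u' \<in> carrier (cat_hom D x y)"
    show "fun_map N x y (u \<oplus>\<^bsub>cat_hom D x y\<^esub> u') =
        fun_map N x y u \<oplus>\<^bsub>cat_hom (vect_cat TYPE('u) k) (fun_obj N x) (fun_obj N y)\<^esub> fun_map N x y u'"
      by (rule extensionalityI[of _ "carrier (fun_obj N x)"])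
        (use x y u u' in \<open>auto intro!: ext linear_mapD[OF lin']\<close>)
  next
    fix c u assume *: "c \<in> carrier k" "u \<in> carrier (cat_hom D x y)"
    show "fun_map N x y (c \<odot>\<^bsub>cat_hom D x y\<^esub> u) =
        c \<odot>\<^bsub>cat_hom (vect_cat TYPE('u) k) (fun_obj N x) (fun_obj N y)\<^esub> fun_map N x y u"
      by (rule extensionalityI[of _ "carrier (fun_obj N x)"])
        (use x y * in \<open>auto intro!: ext linear_mapD[OF lin']\<close>)
  qed
  fix z f g assume *: "z \<in> cat_obj D" "f \<in> carrier (cat_hom D x y)" "g \<in> carrier (cat_hom D y z)"
  show "fun_map N x z (cat_comp D x y z g f) =
      cat_comp (vect_cat TYPE('u) k) (fun_obj N x) (fun_obj N y) (fun_obj N z) (fun_map N y z g) (fun_map N x y f)"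
    by (rule extensionalityI[of _ "carrier (fun_obj N x)"])
      (use x y * in \<open>auto simp: comp compose_eq intro!: ext D.comp_closed\<close>)
qed

text \<open>The two composites of a naturality square are formed by \<open>compose\<close>, which
  fixes their values outside the carrier; their equality is thus an equation on elements.\<close>

lemma nat_trans_vect_iff:
  assumes "k_category k D" "k_functor k D (vect_cat TYPE('u) k) N" "k_functor k D (vect_cat TYPE('u) k) N'"
  shows "\<eta> \<in> nat_trans D (vect_cat TYPE('u) k) N N' \<longleftrightarrow>
    \<eta> \<in> extensional (cat_obj D) \<and>
    (\<forall>x\<in>cat_obj D. \<eta> x \<in> extensional (carrier (fun_obj N x)) \<and> linear_map k (fun_obj N x) (fun_obj N' x) (\<eta> x)) \<and>
    (\<forall>x\<in>cat_obj D. \<forall>y\<in>cat_obj D. \<forall>u\<in>carrier (cat_hom D x y). \<forall>v\<in>carrier (fun_obj N x).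
       \<eta> y (fun_map N x y u v) = fun_map N' x y u (\<eta> x v))"
proof -
  interpret N: left_module k D N using assms by (simp add: left_module_def left_module_axioms_def)
  interpret N': left_module k D N' using assms by (simp add: left_module_def left_module_axioms_def)
  have "(compose (carrier (fun_obj N x)) (\<eta> y) (fun_map N x y u) =
      compose (carrier (fun_obj N x)) (fun_map N' x y u) (\<eta> x)) \<longleftrightarrow>
    (\<forall>v\<in>carrier (fun_obj N x). \<eta> y (fun_map N x y u v) = fun_map N' x y u (\<eta> x v))" for x y u
    by (auto simp: compose_def restrict_def fun_eq_iff)
  then show ?thesis by (auto simp: nat_trans_def PiE_iff)
qed

lemma left_modules_simps [simp]:
  "N \<in> cat_obj (left_modules U k D) \<longleftrightarrow> k_functor k D (vect_cat U k) N"
  "carrier (cat_hom (left_modules U k D) N N') = nat_trans D (vect_cat U k) N N'"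
  "add (cat_hom (left_modules U k D) N N') = (\<lambda>\<eta> \<theta>. \<lambda>x\<in>cat_obj D. \<lambda>v\<in>carrier (fun_obj N x).
     \<eta> x v \<oplus>\<^bsub>fun_obj N' x\<^esub> \<theta> x v)"
  "smult (cat_hom (left_modules U k D) N N') = (\<lambda>c \<eta>. \<lambda>x\<in>cat_obj D. \<lambda>v\<in>carrier (fun_obj N x).
     c \<odot>\<^bsub>fun_obj N' x\<^esub> \<eta> x v)"
  "cat_comp (left_modules U k D) N N' N'' \<theta> \<eta> = (\<lambda>x\<in>cat_obj D. compose (carrier (fun_obj N x)) (\<theta> x) (\<eta> x))"
  "cat_id (left_modules U k D) N = (\<lambda>x\<in>cat_obj D. \<lambda>v\<in>carrier (fun_obj N x). v)"
  by (simp_all add: left_modules_def functor_cat_def)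

section \<open>Finite tuples as single elements of the universe\<close>

locale tuple_coding =
  fixes enc :: "nat \<Rightarrow> (nat \<Rightarrow> 'u) \<Rightarrow> 'u" and dec :: "nat \<Rightarrow> 'u \<Rightarrow> 'u"
  assumes dec_enc: "i < n \<Longrightarrow> dec i (enc n w) = w i"
    and enc_cong: "(\<And>i. i < n \<Longrightarrow> w i = w' i) \<Longrightarrow> enc n w = enc n w'"

text \<open>An infinite set is in bijection with its square. A tuple is coded by nested pairs, and
  \<open>dec i\<close> takes i second components and then a first one, which makes decoding
  independent of the length.\<close>

lemma ex_tuple_coding:
  assumes "infinite (UNIV :: 'u set)"
  shows "\<exists>enc dec. tuple_coding (enc :: nat \<Rightarrow> (nat \<Rightarrow> 'u) \<Rightarrow> 'u) dec"
proof -
  have "|(UNIV :: 'u set) \<times> (UNIV :: 'u set)| =o |UNIV :: 'u set|"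
    using assms by (rule card_of_Times_same_infinite)
  then obtain g :: "'u \<times> 'u \<Rightarrow> 'u" where "bij_betw g (UNIV \<times> UNIV) UNIV"
    unfolding card_of_ordIso[symmetric] by blast
  then have g: "inj g" by (simp add: bij_betw_def)
  \<comment> \<open>The empty tuple is coded by \<open>undefined\<close>: no entry is read from it,
    and a fixed value keeps \<open>enc_cong\<close> true at length 0.\<close>
  define enc :: "nat \<Rightarrow> (nat \<Rightarrow> 'u) \<Rightarrow> 'u" where
    "enc = rec_nat (\<lambda>w. undefined) (\<lambda>n e w. g (w 0, e (\<lambda>i. w (Suc i))))"
  define dec :: "nat \<Rightarrow> 'u \<Rightarrow> 'u" where
    "dec = rec_nat (\<lambda>u. fst (inv_into UNIV g u)) (\<lambda>i e u. e (snd (inv_into UNIV g u)))"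
  have dec_enc: "dec i (enc n w) = w i" if "i < n" for i n w
    using that
  proof (induction n arbitrary: i w)
    case (Suc n)
    then show ?case by (cases i) (simp_all add: enc_def dec_def g)
  qed simp
  have enc_cong: "enc n w = enc n w'" if "\<And>i. i < n \<Longrightarrow> w i = w' i" for n w w'
    using that
  proof (induction n arbitrary: w w')
    case (Suc n)
    have "enc n (\<lambda>i. w (Suc i)) = enc n (\<lambda>i. w' (Suc i))" by (rule Suc.IH) (simp add: Suc.prems)
    then show ?case using Suc.prems[of 0] by (simp add: enc_def)
  qed (simp add: enc_def)
  show ?thesis by (intro exI[of _ enc] exI[of _ dec] tuple_coding.intro dec_enc enc_cong)
qed

text \<open>In \<open>d x y f i j\<close> the row i belongs to the target and the column j to the
  source, so composition becomes matrix multiplication. The identity may go to any idempotent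
  matrix; for f \<mapsto> (p_i \<otimes> f \<otimes> q_j) it is in general not the unit
  matrix.\<close>

locale matrix_functor = tuple_coding enc dec + C: k_category k C + D: k_category k D
  for enc :: "nat \<Rightarrow> (nat \<Rightarrow> 'u) \<Rightarrow> 'u" and dec :: "nat \<Rightarrow> 'u \<Rightarrow> 'u"
    and k :: "('k, 'e) ring_scheme" and C :: "('k, 'o, 'm) kcat" and D :: "('k, 'o, 'n) kcat" +
  fixes dim :: "'o \<Rightarrow> nat" and d :: "'o \<Rightarrow> 'o \<Rightarrow> 'm \<Rightarrow> nat \<Rightarrow> nat \<Rightarrow> 'n"
  assumes obj_eq: "cat_obj D = cat_obj C"
    and entry_linear: "\<lbrakk>x \<in> cat_obj C; y \<in> cat_obj C; i < dim y; j < dim x\<rbrakk> \<Longrightarrow>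
      linear_map k (cat_hom C x y) (cat_hom D x y) (\<lambda>f. d x y f i j)"
    and entry_comp: "\<lbrakk>x \<in> cat_obj C; y \<in> cat_obj C; z \<in> cat_obj C; f \<in> carrier (cat_hom C x y);
      g \<in> carrier (cat_hom C y z); i < dim z; l < dim x\<rbrakk> \<Longrightarrow>
      d x z (cat_comp C x y z g f) i l =
      (\<Oplus>\<^bsub>cat_hom D x z\<^esub>j\<in>{..<dim y}. cat_comp D x y z (d y z g i j) (d x y f j l))"
begin

lemmas entry_closed = linear_mapD(1)[OF entry_linear]

definition matrix_act ::
  "('o, 'n, ('k, 'u) module, 'u \<Rightarrow> 'u) kfun \<Rightarrow> 'o \<Rightarrow> 'o \<Rightarrow> 'm \<Rightarrow> (nat \<Rightarrow> 'u) \<Rightarrow> nat \<Rightarrow> 'u" where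
  "matrix_act N x y f w i = (\<Oplus>\<^bsub>fun_obj N y\<^esub>j\<in>{..<dim x}. fun_map N x y (d x y f i j) (w j))"

text \<open>The matrix of an identity is only idempotent, hence the restriction to the tuples that it fixes.\<close>

definition pull_obj :: "('o, 'n, ('k, 'u) module, 'u \<Rightarrow> 'u) kfun \<Rightarrow> 'o \<Rightarrow> ('k, 'u) module" where
  "pull_obj N x =
     \<lparr>carrier = {w. w = enc (dim x) (\<lambda>i. dec i w) \<and>
        (\<forall>i<dim x. dec i w \<in> carrier (fun_obj N x) \<and>
           matrix_act N x x (cat_id C x) (\<lambda>j. dec j w) i = dec i w)},
      monoid.mult = undefined, one = undefined,
      zero = enc (dim x) (\<lambda>i. \<zero>\<^bsub>fun_obj N x\<^esub>),
      add = (\<lambda>w w'. enc (dim x) (\<lambda>i. dec i w \<oplus>\<^bsub>fun_obj N x\<^esub> dec i w')),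
      smult = (\<lambda>c w. enc (dim x) (\<lambda>i. c \<odot>\<^bsub>fun_obj N x\<^esub> dec i w))\<rparr>"

definition pull ::
  "('o, 'n, ('k, 'u) module, 'u \<Rightarrow> 'u) kfun \<Rightarrow> ('o, 'm, ('k, 'u) module, 'u \<Rightarrow> 'u) kfun" where
  "pull N = \<lparr>fun_obj = pull_obj N,
     fun_map = (\<lambda>x y f. \<lambda>w\<in>carrier (pull_obj N x). enc (dim y) (matrix_act N x y f (\<lambda>j. dec j w)))\<rparr>"

definition pull_functor ::
  "(('o, 'n, ('k, 'u) module, 'u \<Rightarrow> 'u) kfun, 'o \<Rightarrow> 'u \<Rightarrow> 'u,
    ('o, 'm, ('k, 'u) module, 'u \<Rightarrow> 'u) kfun, 'o \<Rightarrow> 'u \<Rightarrow> 'u) kfun" where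
  "pull_functor = \<lparr>fun_obj = pull,
     fun_map = (\<lambda>N N' \<eta>. \<lambda>x\<in>cat_obj C. \<lambda>w\<in>carrier (pull_obj N x). enc (dim x) (\<lambda>i. \<eta> x (dec i w)))\<rparr>"

lemma pull_simps [simp]:
  "fun_obj (pull N) x = pull_obj N x"
  "fun_map (pull N) x y f =
     (\<lambda>w\<in>carrier (pull_obj N x). enc (dim y) (matrix_act N x y f (\<lambda>j. dec j w)))"
  by (simp_all add: pull_def)

lemma pull_obj_simps:
  "zero (pull_obj N x) = enc (dim x) (\<lambda>i. \<zero>\<^bsub>fun_obj N x\<^esub>)"
  "w \<oplus>\<^bsub>pull_obj N x\<^esub> w' = enc (dim x) (\<lambda>i. dec i w \<oplus>\<^bsub>fun_obj N x\<^esub> dec i w')"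
  "c \<odot>\<^bsub>pull_obj N x\<^esub> w = enc (dim x) (\<lambda>i. c \<odot>\<^bsub>fun_obj N x\<^esub> dec i w)"
  by (simp_all add: pull_obj_def)

lemma dec_pull_ops:
  assumes "i < dim x"
  shows "dec i \<zero>\<^bsub>pull_obj N x\<^esub> = \<zero>\<^bsub>fun_obj N x\<^esub>"
    "dec i (w \<oplus>\<^bsub>pull_obj N x\<^esub> w') = dec i w \<oplus>\<^bsub>fun_obj N x\<^esub> dec i w'"
    "dec i (c \<odot>\<^bsub>pull_obj N x\<^esub> w) = c \<odot>\<^bsub>fun_obj N x\<^esub> dec i w"
  using assms by (simp_all add: pull_obj_simps dec_enc)

lemma pull_obj_dec:
  assumes "w \<in> carrier (pull_obj N x)" "i < dim x"
  shows "dec i w \<in> carrier (fun_obj N x)" "matrix_act N x x (cat_id C x) (\<lambda>j. dec j w) i = dec i w"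
  using assms by (auto simp: pull_obj_def)

text \<open>The first clause of the carrier admits only codes in normal form, so an element is
  determined by its entries. Equations in a pulled back space thereby become equations in
  \<open>fun_obj N x\<close>.\<close>

lemma pull_obj_eqI:
  assumes "w \<in> carrier (pull_obj N x)" "w' \<in> carrier (pull_obj N x)"
    and "\<And>i. i < dim x \<Longrightarrow> dec i w = dec i w'"
  shows "w = w'"
proof -
  have e: "w = enc (dim x) (\<lambda>i. dec i w)" "w' = enc (dim x) (\<lambda>i. dec i w')"
    using assms(1,2) by (simp_all add: pull_obj_def)
  have "enc (dim x) (\<lambda>i. dec i w) = enc (dim x) (\<lambda>i. dec i w')"
    by (rule enc_cong[OF assms(3)])
  then show ?thesis by (subst e(1), subst e(2))
qed

end

section \<open>The pull-back of a single module\<close>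

locale pulled_module = matrix_functor enc dec k C D dim d + N: left_module k D N
  for enc :: "nat \<Rightarrow> (nat \<Rightarrow> 'u) \<Rightarrow> 'u" and dec :: "nat \<Rightarrow> 'u \<Rightarrow> 'u"
    and k :: "('k, 'e) ring_scheme" and C :: "('k, 'o, 'm) kcat" and D :: "('k, 'o, 'n) kcat"
    and dim d and N :: "('o, 'n, ('k, 'u) module, 'u \<Rightarrow> 'u) kfun"
begin

abbreviation "V \<equiv> fun_obj N"
abbreviation "W \<equiv> pull_obj N"
abbreviation "mact \<equiv> matrix_act N"

lemma entry_act_closed:
  "\<lbrakk>x \<in> cat_obj C; y \<in> cat_obj C; f \<in> carrier (cat_hom C x y); i < dim y; j < dim x;
    v \<in> carrier (V x)\<rbrakk> \<Longrightarrow> fun_map N x y (d x y f i j) v \<in> carrier (V y)"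
  by (rule N.act_closed) (simp_all add: obj_eq entry_closed)

lemma matrix_act_closed:
  assumes "x \<in> cat_obj C" "y \<in> cat_obj C" "f \<in> carrier (cat_hom C x y)" "i < dim y"
    and "\<And>j. j < dim x \<Longrightarrow> w j \<in> carrier (V x)"
  shows "mact x y f w i \<in> carrier (V y)"
proof -
  interpret V: abelian_group "V y" using N.obj_abelian assms(2) obj_eq by simp
  show ?thesis unfolding matrix_act_def by (rule V.finsum_closed) (use assms in \<open>auto intro: entry_act_closed\<close>)
qed

lemma matrix_act_cong:
  assumes "x \<in> cat_obj C" "y \<in> cat_obj C" "f \<in> carrier (cat_hom C x y)" "i < dim y"
    and "\<And>j. j < dim x \<Longrightarrow> w j \<in> carrier (V x)" and "\<And>j. j < dim x \<Longrightarrow> w' j = w j"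
  shows "mact x y f w' i = mact x y f w i"
proof -
  interpret V: abelian_group "V y" using N.obj_abelian assms(2) obj_eq by simp
  show ?thesis unfolding matrix_act_def
    by (rule V.finsum_cong') (use assms in \<open>auto intro: entry_act_closed\<close>)
qed

lemma matrix_act_add:
  assumes "x \<in> cat_obj C" "y \<in> cat_obj C" "f \<in> carrier (cat_hom C x y)" "i < dim y"
    and "\<And>j. j < dim x \<Longrightarrow> w j \<in> carrier (V x)" "\<And>j. j < dim x \<Longrightarrow> w' j \<in> carrier (V x)"
  shows "mact x y f (\<lambda>j. w j \<oplus>\<^bsub>V x\<^esub> w' j) i =
    mact x y f w i \<oplus>\<^bsub>V y\<^esub> mact x y f w' i"
proof -
  interpret V: abelian_group "V y" using N.obj_abelian assms(2) obj_eq by simp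
  have "mact x y f (\<lambda>j. w j \<oplus>\<^bsub>V x\<^esub> w' j) i =
    (\<Oplus>\<^bsub>V y\<^esub>j\<in>{..<dim x}. fun_map N x y (d x y f i j) (w j) \<oplus>\<^bsub>V y\<^esub> fun_map N x y (d x y f i j) (w' j))"
    unfolding matrix_act_def
    by (rule V.finsum_cong') (use assms in \<open>auto simp: entry_act_closed obj_eq entry_closed N.act_add\<close>)
  also have "\<dots> = mact x y f w i \<oplus>\<^bsub>V y\<^esub> mact x y f w' i"
    unfolding matrix_act_def by (rule V.finsum_addf) (use assms in \<open>auto intro: entry_act_closed\<close>)
  finally show ?thesis .
qed

lemma matrix_act_smult:
  assumes "x \<in> cat_obj C" "y \<in> cat_obj C" "f \<in> carrier (cat_hom C x y)" "i < dim y" "c \<in> carrier k"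
    and "\<And>j. j < dim x \<Longrightarrow> w j \<in> carrier (V x)"
  shows "mact x y f (\<lambda>j. c \<odot>\<^bsub>V x\<^esub> w j) i = c \<odot>\<^bsub>V y\<^esub> mact x y f w i"
proof -
  interpret V: module k "V y" using N.obj_module assms(2) obj_eq by simp
  show ?thesis
    unfolding matrix_act_def
    by (subst V.finsum_smult_ldistr)
      (use assms in \<open>auto simp: entry_act_closed obj_eq entry_closed N.act_smult intro!: V.finsum_cong'\<close>)
qed

lemma matrix_act_linear_left:
  assumes "x \<in> cat_obj C" "y \<in> cat_obj C" "i < dim y" "\<And>j. j < dim x \<Longrightarrow> w j \<in> carrier (V x)"
  shows "linear_map k (cat_hom C x y) (V y) (\<lambda>f. mact x y f w i)"
proof -
  have "linear_map k (cat_hom C x y) (V y) (\<lambda>f. fun_map N x y (d x y f i j) (w j))"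
    if "j < dim x" for j
    by (rule linear_map_compose[OF entry_linear N.act_linear_left]) (use assms that obj_eq in auto)
  then show ?thesis
    unfolding matrix_act_def using assms(2) obj_eq by (intro linear_map_finsum N.obj_module) auto
qed

text \<open>An entry of the composite is a sum over j inside a sum over l. After the interchange the
  sum over l is the action of the first matrix, and additivity moves the second matrix outside
  it.\<close>

lemma matrix_act_comp:
  assumes obj: "x \<in> cat_obj C" "y \<in> cat_obj C" "z \<in> cat_obj C"
    and fg: "f \<in> carrier (cat_hom C x y)" "g \<in> carrier (cat_hom C y z)" and i: "i < dim z"
    and w: "\<And>j. j < dim x \<Longrightarrow> w j \<in> carrier (V x)"
  shows "mact x z (cat_comp C x y z g f) w i = mact y z g (mact x y f w) i"
proof -
  interpret V: module k "V z" using N.obj_module obj obj_eq by simp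
  note objD = obj[folded obj_eq]
  have ab: "abelian_group (cat_hom D x z)" using D.hom_module[OF objD(1,3)] by (simp add: module_def)
  have cl: "fun_map N y z (d y z g i j) (fun_map N x y (d x y f j l) (w l)) \<in> carrier (V z)"
    if "j < dim y" "l < dim x" for j l
    using that i obj fg w by (intro entry_act_closed) auto
  have "mact x z (cat_comp C x y z g f) w i =
      (\<Oplus>\<^bsub>V z\<^esub>l\<in>{..<dim x}. \<Oplus>\<^bsub>V z\<^esub>j\<in>{..<dim y}.
         fun_map N y z (d y z g i j) (fun_map N x y (d x y f j l) (w l)))"
    unfolding matrix_act_def
  proof (rule V.finsum_cong')
    fix l assume "l \<in> {..<dim x}"
    then have l: "l < dim x" by simp
    have "fun_map N x z (d x z (cat_comp C x y z g f) i l) (w l) =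
        fun_map N x z (\<Oplus>\<^bsub>cat_hom D x z\<^esub>j\<in>{..<dim y}. cat_comp D x y z (d y z g i j) (d x y f j l)) (w l)"
      by (simp add: entry_comp obj fg i l)
    also have "\<dots> = (\<Oplus>\<^bsub>V z\<^esub>j\<in>{..<dim y}. fun_map N x z (cat_comp D x y z (d y z g i j) (d x y f j l)) (w l))"
      by (rule additive_map_finsum[OF linear_map_additive[OF N.act_linear_left[OF objD(1,3) w[OF l]]]
            ab V.M.abelian_group_axioms])
        (use obj objD fg i l in \<open>auto intro!: D.comp_closed entry_closed\<close>)
    also have "\<dots> = (\<Oplus>\<^bsub>V z\<^esub>j\<in>{..<dim y}. fun_map N y z (d y z g i j) (fun_map N x y (d x y f j l) (w l)))"
      by (rule V.finsum_cong')
        (use obj objD fg i l w cl in \<open>auto intro!: N.act_comp entry_closed\<close>)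
    finally show "fun_map N x z (d x z (cat_comp C x y z g f) i l) (w l) = \<dots>" .
  qed (use cl in \<open>auto intro!: V.finsum_closed\<close>)
  also have "\<dots> = (\<Oplus>\<^bsub>V z\<^esub>j\<in>{..<dim y}. \<Oplus>\<^bsub>V z\<^esub>l\<in>{..<dim x}.
         fun_map N y z (d y z g i j) (fun_map N x y (d x y f j l) (w l)))"
    by (rule V.finsum_swap) (use cl in auto)
  also have "\<dots> = mact y z g (mact x y f w) i"
    unfolding matrix_act_def
  proof (rule V.finsum_cong')
    show "(\<lambda>j. fun_map N y z (d y z g i j) (\<Oplus>\<^bsub>V y\<^esub>l\<in>{..<dim x}. fun_map N x y (d x y f j l) (w l)))
        \<in> {..<dim y} \<rightarrow> carrier (V z)"
      using matrix_act_closed[OF obj(1,2) fg(1) _ w] i obj fg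
      by (auto simp: matrix_act_def intro!: entry_act_closed)
    fix j assume j: "j \<in> {..<dim y}"
    show "(\<Oplus>\<^bsub>V z\<^esub>l\<in>{..<dim x}. fun_map N y z (d y z g i j) (fun_map N x y (d x y f j l) (w l))) =
      fun_map N y z (d y z g i j) (\<Oplus>\<^bsub>V y\<^esub>l\<in>{..<dim x}. fun_map N x y (d x y f j l) (w l))"
      by (rule additive_map_finsum[symmetric, OF linear_map_additive[OF N.act_linear[OF objD(2,3)]]
            N.obj_abelian[OF objD(2)] V.M.abelian_group_axioms])
        (use obj fg i j w in \<open>auto intro!: entry_closed entry_act_closed\<close>)
  qed simp
  finally show ?thesis .
qed

lemma pull_obj_enc:
  assumes x: "x \<in> cat_obj C" and w: "\<And>i. i < dim x \<Longrightarrow> w i \<in> carrier (V x)"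
    and fixed: "\<And>i. i < dim x \<Longrightarrow> mact x x (cat_id C x) w i = w i"
  shows "enc (dim x) w \<in> carrier (W x)"
proof -
  have "mact x x (cat_id C x) (\<lambda>j. dec j (enc (dim x) w)) i = w i" if "i < dim x" for i
  proof -
    have "mact x x (cat_id C x) (\<lambda>j. dec j (enc (dim x) w)) i = mact x x (cat_id C x) w i"
      by (rule matrix_act_cong[OF x x C.id_closed[OF x] that w]) (simp_all add: dec_enc)
    with fixed[OF that] show ?thesis by simp
  qed
  moreover have "enc (dim x) w = enc (dim x) (\<lambda>i. dec i (enc (dim x) w))"
    by (rule enc_cong) (simp add: dec_enc)
  ultimately show ?thesis using w by (simp add: pull_obj_def dec_enc)
qed

text \<open>The values are fixed by the idempotent of y because 1 f = f, whatever tuple they come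
  from. This is the source of elements of a pulled back space.\<close>

lemma enc_matrix_act_closed:
  assumes "x \<in> cat_obj C" "y \<in> cat_obj C" "f \<in> carrier (cat_hom C x y)"
    and "\<And>j. j < dim x \<Longrightarrow> w j \<in> carrier (V x)"
  shows "enc (dim y) (mact x y f w) \<in> carrier (W y)"
proof (rule pull_obj_enc[OF assms(2)])
  fix i assume i: "i < dim y"
  show "mact x y f w i \<in> carrier (V y)" using matrix_act_closed assms i by auto
  show "mact y y (cat_id C y) (mact x y f w) i = mact x y f w i"
    using matrix_act_comp[OF assms(1,2,2,3) C.id_closed[OF assms(2)] i assms(4)] assms
    by (simp add: C.comp_id_left)
qed

lemma pull_map_dec:
  assumes "w \<in> carrier (W x)" "i < dim y"
  shows "dec i (fun_map (pull N) x y f w) = mact x y f (\<lambda>j. dec j w) i"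
  using assms by (simp add: dec_enc)

lemma pull_map_closed:
  assumes "x \<in> cat_obj C" "y \<in> cat_obj C" "f \<in> carrier (cat_hom C x y)" "w \<in> carrier (W x)"
  shows "fun_map (pull N) x y f w \<in> carrier (W y)"
  using assms enc_matrix_act_closed[OF assms(1-3), of "\<lambda>j. dec j w"] by (simp add: pull_obj_dec)

lemma pull_module:
  assumes x: "x \<in> cat_obj C"
  shows "module k (W x)"
proof -
  interpret V: module k "V x" using N.obj_module x obj_eq by simp
  have add: "w \<oplus>\<^bsub>W x\<^esub> w' \<in> carrier (W x)"
    if "w \<in> carrier (W x)" "w' \<in> carrier (W x)" for w w'
    unfolding pull_obj_simps using that x
    by (intro pull_obj_enc) (auto simp: pull_obj_dec matrix_act_add C.id_closed)
  have smult: "c \<odot>\<^bsub>W x\<^esub> w \<in> carrier (W x)"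
    if "c \<in> carrier k" "w \<in> carrier (W x)" for c w
    unfolding pull_obj_simps using that x
    by (intro pull_obj_enc) (auto simp: pull_obj_dec matrix_act_smult C.id_closed)
  have zero: "\<zero>\<^bsub>W x\<^esub> \<in> carrier (W x)"
    unfolding pull_obj_simps
  proof (rule pull_obj_enc[OF x])
    fix i assume i: "i < dim x"
    \<comment> \<open>The zero tuple is its own multiple by 0, and scalars commute with the matrix
      action.\<close>
    show "mact x x (cat_id C x) (\<lambda>i. \<zero>\<^bsub>V x\<^esub>) i = \<zero>\<^bsub>V x\<^esub>"
      using matrix_act_smult[OF x x C.id_closed[OF x] i C.zero_closed, of "\<lambda>i. \<zero>\<^bsub>V x\<^esub>"]
        matrix_act_closed[OF x x C.id_closed[OF x] i, of "\<lambda>i. \<zero>\<^bsub>V x\<^esub>"] by simp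
  qed simp
  note decs = pull_obj_dec(1) dec_pull_ops add smult zero
  show ?thesis
  proof (rule moduleI)
    show "cring k" by unfold_locales
    show "abelian_group (W x)"
    proof (rule abelian_groupI)
      fix w assume w: "w \<in> carrier (W x)"
      \<comment> \<open>Negatives are obtained as multiples by -1, since scalar multiplication is
        already known to preserve the carrier.\<close>
      have neg: "\<ominus>\<^bsub>k\<^esub> \<one>\<^bsub>k\<^esub> \<odot>\<^bsub>V x\<^esub> v \<oplus>\<^bsub>V x\<^esub> v = \<zero>\<^bsub>V x\<^esub>"
        if "v \<in> carrier (V x)" for v
        using that by (simp add: V.smult_l_minus V.M.l_neg)
      have "(\<ominus>\<^bsub>k\<^esub> \<one>\<^bsub>k\<^esub>) \<odot>\<^bsub>W x\<^esub> w \<oplus>\<^bsub>W x\<^esub> w = \<zero>\<^bsub>W x\<^esub>"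
        by (rule pull_obj_eqI[of _ N x]) (use w neg in \<open>auto simp: decs\<close>)
      then show "\<exists>w'\<in>carrier (W x). w' \<oplus>\<^bsub>W x\<^esub> w = \<zero>\<^bsub>W x\<^esub>"
        using smult[OF _ w, of "\<ominus>\<^bsub>k\<^esub> \<one>\<^bsub>k\<^esub>"] by auto
    next
      fix w w' w'' assume *: "w \<in> carrier (W x)" "w' \<in> carrier (W x)" "w'' \<in> carrier (W x)"
      show "w \<oplus>\<^bsub>W x\<^esub> w' \<oplus>\<^bsub>W x\<^esub> w'' = w \<oplus>\<^bsub>W x\<^esub> (w' \<oplus>\<^bsub>W x\<^esub> w'')"
        by (rule pull_obj_eqI[of _ N x]) (use * in \<open>auto simp: decs V.M.a_assoc\<close>)
    next
      fix w w' assume *: "w \<in> carrier (W x)" "w' \<in> carrier (W x)"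
      show "w \<oplus>\<^bsub>W x\<^esub> w' = w' \<oplus>\<^bsub>W x\<^esub> w"
        by (rule pull_obj_eqI[of _ N x]) (use * in \<open>auto simp: decs V.M.a_comm\<close>)
    next
      fix w assume *: "w \<in> carrier (W x)"
      show "\<zero>\<^bsub>W x\<^esub> \<oplus>\<^bsub>W x\<^esub> w = w"
        by (rule pull_obj_eqI[of _ N x]) (use * in \<open>auto simp: decs\<close>)
    qed (use add zero in auto)
  next
    fix a b w assume *: "a \<in> carrier k" "b \<in> carrier k" "w \<in> carrier (W x)"
    show "(a \<oplus>\<^bsub>k\<^esub> b) \<odot>\<^bsub>W x\<^esub> w = a \<odot>\<^bsub>W x\<^esub> w \<oplus>\<^bsub>W x\<^esub> b \<odot>\<^bsub>W x\<^esub> w"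
      by (rule pull_obj_eqI[of _ N x]) (use * in \<open>auto simp: decs V.smult_l_distr\<close>)
    show "(a \<otimes>\<^bsub>k\<^esub> b) \<odot>\<^bsub>W x\<^esub> w = a \<odot>\<^bsub>W x\<^esub> (b \<odot>\<^bsub>W x\<^esub> w)"
      by (rule pull_obj_eqI[of _ N x]) (use * in \<open>auto simp: decs V.smult_assoc1\<close>)
  next
    fix a w w' assume *: "a \<in> carrier k" "w \<in> carrier (W x)" "w' \<in> carrier (W x)"
    show "a \<odot>\<^bsub>W x\<^esub> (w \<oplus>\<^bsub>W x\<^esub> w') = a \<odot>\<^bsub>W x\<^esub> w \<oplus>\<^bsub>W x\<^esub> a \<odot>\<^bsub>W x\<^esub> w'"
      by (rule pull_obj_eqI[of _ N x]) (use * in \<open>auto simp: decs V.smult_r_distr\<close>)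
  next
    fix w assume *: "w \<in> carrier (W x)"
    show "\<one>\<^bsub>k\<^esub> \<odot>\<^bsub>W x\<^esub> w = w"
      by (rule pull_obj_eqI[of _ N x]) (use * in \<open>auto simp: decs\<close>)
  qed (use smult in auto)
qed

lemma dec_linear:
  "\<lbrakk>x \<in> cat_obj C; i < dim x\<rbrakk> \<Longrightarrow> linear_map k (W x) (V x) (dec i)"
  by (rule linear_mapI) (auto simp: pull_obj_dec pull_obj_simps dec_enc)

text \<open>Everything is read off from the entries. The identity acts trivially precisely because
  only tuples fixed by its matrix were kept.\<close>

lemma pull_is_functor: "k_functor k C (vect_cat TYPE('u) k) (pull N)"
proof (rule k_functor_vectI)
  show "k_category k C" by unfold_locales
  fix x assume x: "x \<in> cat_obj C"
  then show "module k (fun_obj (pull N) x)" by (simp add: pull_module)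
  interpret W: module k "W x" by (rule pull_module[OF x])
  fix w assume "w \<in> carrier (fun_obj (pull N) x)"
  then have w: "w \<in> carrier (W x)" by simp
  show "fun_map (pull N) x x (cat_id C x) w = w"
    by (rule pull_obj_eqI[of _ N x])
      (use w x in \<open>simp_all add: pull_map_closed C.id_closed pull_map_dec pull_obj_dec del: pull_simps\<close>)
  fix y assume y: "y \<in> cat_obj C"
  interpret W': module k "W y" by (rule pull_module[OF y])
  interpret H: module k "cat_hom C x y" by (rule C.hom_module[OF x y])
  have dec_w: "\<And>j. j < dim x \<Longrightarrow> dec j w \<in> carrier (V x)" using w pull_obj_dec by blast
  note lin = matrix_act_linear_left[OF x y _ dec_w]
  show "linear_map k (cat_hom C x y) (fun_obj (pull N) y) (\<lambda>u. fun_map (pull N) x y u w)"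
  proof (rule linear_mapI, simp_all only: pull_simps(1))
    fix f assume f: "f \<in> carrier (cat_hom C x y)"
    show "fun_map (pull N) x y f w \<in> carrier (W y)" by (rule pull_map_closed[OF x y f w])
    fix g assume g: "g \<in> carrier (cat_hom C x y)"
    show "fun_map (pull N) x y (f \<oplus>\<^bsub>cat_hom C x y\<^esub> g) w =
        fun_map (pull N) x y f w \<oplus>\<^bsub>W y\<^esub> fun_map (pull N) x y g w"
      by (rule pull_obj_eqI[of _ N y])
        (use f g w x y in \<open>simp_all add: pull_map_closed dec_pull_ops pull_map_dec linear_mapD[OF lin] del: pull_simps\<close>)
  next
    fix c f assume f: "c \<in> carrier k" "f \<in> carrier (cat_hom C x y)"
    show "fun_map (pull N) x y (c \<odot>\<^bsub>cat_hom C x y\<^esub> f) w = c \<odot>\<^bsub>W y\<^esub> fun_map (pull N) x y f w"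
      by (rule pull_obj_eqI[of _ N y])
        (use f w x y in \<open>simp_all add: pull_map_closed dec_pull_ops pull_map_dec linear_mapD[OF lin] del: pull_simps\<close>)
  qed
  fix z f g assume z: "z \<in> cat_obj C" and fg: "f \<in> carrier (cat_hom C x y)" "g \<in> carrier (cat_hom C y z)"
  show "fun_map (pull N) x z (cat_comp C x y z g f) w = fun_map (pull N) y z g (fun_map (pull N) x y f w)"
  proof (rule pull_obj_eqI[of _ N z])
    fix i assume i: "i < dim z"
    have "dec i (fun_map (pull N) y z g (fun_map (pull N) x y f w)) =
        mact y z g (\<lambda>j. dec j (fun_map (pull N) x y f w)) i"
      using i pull_map_closed[OF x y fg(1) w] by (simp add: pull_map_dec del: pull_simps)
    also have "\<dots> = mact y z g (mact x y f (\<lambda>j. dec j w)) i"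
      using w dec_w matrix_act_closed[OF x y fg(1)]
      by (intro matrix_act_cong y z fg i) (auto simp: pull_map_dec simp del: pull_simps)
    also have "\<dots> = dec i (fun_map (pull N) x z (cat_comp C x y z g f) w)"
      using w i by (simp add: pull_map_dec matrix_act_comp[OF x y z fg i dec_w] del: pull_simps)
    finally show "dec i (fun_map (pull N) x z (cat_comp C x y z g f) w) =
        dec i (fun_map (pull N) y z g (fun_map (pull N) x y f w))" by simp
  qed (use x y z fg w in \<open>auto intro!: pull_map_closed C.comp_closed simp del: pull_simps\<close>)
next
  fix x y f assume x: "x \<in> cat_obj C" and y: "y \<in> cat_obj C" and f: "f \<in> carrier (cat_hom C x y)"
  show "fun_map (pull N) x y f \<in> extensional (carrier (fun_obj (pull N) x))" by simp
  interpret W: module k "W x" by (rule pull_module[OF x])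
  interpret W': module k "W y" by (rule pull_module[OF y])
  interpret V: module k "V x" using N.obj_module x obj_eq by simp
  have "linear_map k (W x) (W y) (fun_map (pull N) x y f)"
  proof (rule linear_mapI)
    fix w assume w: "w \<in> carrier (W x)"
    show "fun_map (pull N) x y f w \<in> carrier (W y)" by (rule pull_map_closed[OF x y f w])
    fix w' assume w': "w' \<in> carrier (W x)"
    show "fun_map (pull N) x y f (w \<oplus>\<^bsub>W x\<^esub> w') =
        fun_map (pull N) x y f w \<oplus>\<^bsub>W y\<^esub> fun_map (pull N) x y f w'"
    proof (rule pull_obj_eqI[of _ N y])
      fix i assume i: "i < dim y"
      have "dec i (fun_map (pull N) x y f (w \<oplus>\<^bsub>W x\<^esub> w')) =
          mact x y f (\<lambda>j. dec j w \<oplus>\<^bsub>V x\<^esub> dec j w') i"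
        unfolding pull_map_dec[OF W.a_closed[OF w w'] i]
        by (rule matrix_act_cong[OF x y f i]) (use w w' in \<open>auto simp: pull_obj_dec dec_pull_ops\<close>)
      then show "dec i (fun_map (pull N) x y f (w \<oplus>\<^bsub>W x\<^esub> w')) =
        dec i (fun_map (pull N) x y f w \<oplus>\<^bsub>W y\<^esub> fun_map (pull N) x y f w')"
        using w w' i by (simp add: dec_pull_ops pull_map_dec matrix_act_add[OF x y f i] pull_obj_dec del: pull_simps)
    qed (use x y f w w' in \<open>auto intro!: pull_map_closed simp del: pull_simps\<close>)
  next
    fix c w assume w: "c \<in> carrier k" "w \<in> carrier (W x)"
    show "fun_map (pull N) x y f (c \<odot>\<^bsub>W x\<^esub> w) = c \<odot>\<^bsub>W y\<^esub> fun_map (pull N) x y f w"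
    proof (rule pull_obj_eqI[of _ N y])
      fix i assume i: "i < dim y"
      have "dec i (fun_map (pull N) x y f (c \<odot>\<^bsub>W x\<^esub> w)) =
          mact x y f (\<lambda>j. c \<odot>\<^bsub>V x\<^esub> dec j w) i"
        unfolding pull_map_dec[OF W.smult_closed[OF w] i]
        by (rule matrix_act_cong[OF x y f i]) (use w in \<open>auto simp: pull_obj_dec dec_pull_ops\<close>)
      then show "dec i (fun_map (pull N) x y f (c \<odot>\<^bsub>W x\<^esub> w)) =
        dec i (c \<odot>\<^bsub>W y\<^esub> fun_map (pull N) x y f w)"
        using w i by (simp add: dec_pull_ops pull_map_dec matrix_act_smult[OF x y f i] pull_obj_dec del: pull_simps)
    qed (use x y f w in \<open>auto intro!: pull_map_closed simp del: pull_simps\<close>)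
  qed
  then show "linear_map k (fun_obj (pull N) x) (fun_obj (pull N) y) (fun_map (pull N) x y f)" by simp
qed

end

lemma nat_trans_linear:
  "\<lbrakk>\<eta> \<in> nat_trans D (vect_cat U k) N N'; x \<in> cat_obj D\<rbrakk> \<Longrightarrow>
   linear_map k (fun_obj N x) (fun_obj N' x) (\<eta> x)"
  by (auto simp: nat_trans_def PiE_iff)

text \<open>Pointwise inverses suffice: linearity and naturality of \<iota> follow from those of
  \<eta> on applying \<eta>, which is injective by \<open>left\<close>.\<close>

lemma left_modules_isoI:
  fixes N N' :: "('o, 'n, ('k, 'u) module, 'u \<Rightarrow> 'u) kfun"
  assumes D: "k_category k D"
    and N: "k_functor k D (vect_cat TYPE('u) k) N" and N': "k_functor k D (vect_cat TYPE('u) k) N'"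
    and \<eta>: "\<eta> \<in> nat_trans D (vect_cat TYPE('u) k) N N'"
    and closed: "\<And>x v. \<lbrakk>x \<in> cat_obj D; v \<in> carrier (fun_obj N' x)\<rbrakk> \<Longrightarrow> \<iota> x v \<in> carrier (fun_obj N x)"
    and right: "\<And>x v. \<lbrakk>x \<in> cat_obj D; v \<in> carrier (fun_obj N' x)\<rbrakk> \<Longrightarrow> \<eta> x (\<iota> x v) = v"
    and left: "\<And>x w. \<lbrakk>x \<in> cat_obj D; w \<in> carrier (fun_obj N x)\<rbrakk> \<Longrightarrow> \<iota> x (\<eta> x w) = w"
  shows "cat_iso (left_modules TYPE('u) k D) N N' \<eta>"
proof -
  interpret N: left_module k D N using D N by (simp add: left_module_def left_module_axioms_def)
  interpret N': left_module k D N' using D N' by (simp add: left_module_def left_module_axioms_def)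
  note \<eta>_facts = \<eta>[unfolded nat_trans_vect_iff[OF D N N']]
  have lin: "linear_map k (fun_obj N x) (fun_obj N' x) (\<eta> x)" if "x \<in> cat_obj D" for x
    using \<eta>_facts that by blast
  have nat: "\<eta> y (fun_map N x y u v) = fun_map N' x y u (\<eta> x v)"
    if "x \<in> cat_obj D" "y \<in> cat_obj D" "u \<in> carrier (cat_hom D x y)" "v \<in> carrier (fun_obj N x)" for x y u v
    using \<eta>_facts that by blast
  have eqI: "w = w'" if "x \<in> cat_obj D" "w \<in> carrier (fun_obj N x)" "w' \<in> carrier (fun_obj N x)" "\<eta> x w = \<eta> x w'" for x w w'
    using left that by metis
  define \<iota>' where "\<iota>' = (\<lambda>x\<in>cat_obj D. \<lambda>v\<in>carrier (fun_obj N' x). \<iota> x v)"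
  have "\<iota>' \<in> nat_trans D (vect_cat TYPE('u) k) N' N"
    unfolding nat_trans_vect_iff[OF D N' N]
  proof (intro conjI ballI)
    fix x assume x: "x \<in> cat_obj D"
    interpret V: module k "fun_obj N x" by (rule N.obj_module[OF x])
    interpret V': module k "fun_obj N' x" by (rule N'.obj_module[OF x])
    show "\<iota>' x \<in> extensional (carrier (fun_obj N' x))" using x by (simp add: \<iota>'_def)
    show "linear_map k (fun_obj N' x) (fun_obj N x) (\<iota>' x)"
    proof (rule linear_mapI)
      fix v assume v: "v \<in> carrier (fun_obj N' x)"
      then show "\<iota>' x v \<in> carrier (fun_obj N x)" using x closed by (simp add: \<iota>'_def)
      fix v' assume v': "v' \<in> carrier (fun_obj N' x)"
      have "\<iota> x (v \<oplus>\<^bsub>fun_obj N' x\<^esub> v') = \<iota> x v \<oplus>\<^bsub>fun_obj N x\<^esub> \<iota> x v'"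
        by (rule eqI[OF x]) (use x v v' in \<open>simp_all add: closed right linear_mapD[OF lin]\<close>)
      then show "\<iota>' x (v \<oplus>\<^bsub>fun_obj N' x\<^esub> v') = \<iota>' x v \<oplus>\<^bsub>fun_obj N x\<^esub> \<iota>' x v'"
        using x v v' by (simp add: \<iota>'_def)
    next
      fix c v assume c: "c \<in> carrier k" and v: "v \<in> carrier (fun_obj N' x)"
      have "\<iota> x (c \<odot>\<^bsub>fun_obj N' x\<^esub> v) = c \<odot>\<^bsub>fun_obj N x\<^esub> \<iota> x v"
        by (rule eqI[OF x]) (use x c v in \<open>simp_all add: closed right linear_mapD[OF lin]\<close>)
      then show "\<iota>' x (c \<odot>\<^bsub>fun_obj N' x\<^esub> v) = c \<odot>\<^bsub>fun_obj N x\<^esub> \<iota>' x v"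
        using x c v by (simp add: \<iota>'_def)
    qed
    fix y u v assume y: "y \<in> cat_obj D" and u: "u \<in> carrier (cat_hom D x y)" and v: "v \<in> carrier (fun_obj N' x)"
    have "\<iota> y (fun_map N' x y u v) = fun_map N x y u (\<iota> x v)"
      by (rule eqI[OF y])
        (use x y u v in \<open>simp_all add: closed right nat N.act_closed N'.act_closed\<close>)
    then show "\<iota>' y (fun_map N' x y u v) = fun_map N x y u (\<iota>' x v)"
      using x y u v by (simp add: \<iota>'_def N'.act_closed)
  qed (simp add: \<iota>'_def)
  moreover have "(\<lambda>x\<in>cat_obj D. compose (carrier (fun_obj N x)) (\<iota>' x) (\<eta> x)) =
      (\<lambda>x\<in>cat_obj D. \<lambda>v\<in>carrier (fun_obj N x). v)"
    by (intro restrict_ext) (auto simp: compose_def \<iota>'_def left linear_mapD[OF lin] intro!: restrict_ext)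
  moreover have "(\<lambda>x\<in>cat_obj D. compose (carrier (fun_obj N' x)) (\<eta> x) (\<iota>' x)) =
      (\<lambda>x\<in>cat_obj D. \<lambda>v\<in>carrier (fun_obj N' x). v)"
    by (intro restrict_ext) (auto simp: compose_def \<iota>'_def right intro!: restrict_ext)
  ultimately show ?thesis using \<eta> unfolding cat_iso_def by (simp, blast)
qed

section \<open>Functoriality of the pull-back\<close>

context matrix_functor
begin

lemma enc_dec: "w \<in> carrier (pull_obj N x) \<Longrightarrow> enc (dim x) (\<lambda>i. dec i w) = w"
  by (simp add: pull_obj_def)

lemma pulled_module_axiom:
  "k_functor k D (vect_cat TYPE('u) k) N \<Longrightarrow> pulled_module enc dec k C D dim d N"
  by (intro pulled_module.intro matrix_functor_axioms left_module.intro left_module_axioms.intro)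
    unfold_locales

lemma pull_functor_simps [simp]:
  "fun_obj pull_functor N = pull N"
  "fun_map pull_functor N N' \<eta> =
     (\<lambda>x\<in>cat_obj C. \<lambda>w\<in>carrier (pull_obj N x). enc (dim x) (\<lambda>i. \<eta> x (dec i w)))"
  by (simp_all add: pull_functor_def)

text \<open>A natural \<eta> commutes with every matrix entry and with finite sums, hence with the
  whole matrix action. In particular it sends tuples fixed by the idempotent to fixed
  tuples.\<close>

lemma pull_trans:
  fixes N N' :: "('o, 'n, ('k, 'u) module, 'u \<Rightarrow> 'u) kfun"
  assumes N: "k_functor k D (vect_cat TYPE('u) k) N" and N': "k_functor k D (vect_cat TYPE('u) k) N'"
    and \<eta>: "\<eta> \<in> nat_trans D (vect_cat TYPE('u) k) N N'"
  shows "fun_map pull_functor N N' \<eta> \<in> nat_trans C (vect_cat TYPE('u) k) (pull N) (pull N')"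
proof -
  interpret P: pulled_module enc dec k C D dim d N by (rule pulled_module_axiom[OF N])
  interpret P': pulled_module enc dec k C D dim d N' by (rule pulled_module_axiom[OF N'])
  note \<eta>_facts = \<eta>[unfolded nat_trans_vect_iff[OF D.k_category_axioms N N'] obj_eq]
  have lin: "linear_map k (fun_obj N x) (fun_obj N' x) (\<eta> x)" if "x \<in> cat_obj C" for x
    using \<eta>_facts that by blast
  have nat: "\<eta> y (fun_map N x y u v) = fun_map N' x y u (\<eta> x v)"
    if "x \<in> cat_obj C" "y \<in> cat_obj C" "u \<in> carrier (cat_hom D x y)" "v \<in> carrier (fun_obj N x)" for x y u v
    using \<eta>_facts that by blast
  have act: "matrix_act N' x y f (\<lambda>j. \<eta> x (w j)) i = \<eta> y (matrix_act N x y f w i)"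
    if "x \<in> cat_obj C" "y \<in> cat_obj C" "f \<in> carrier (cat_hom C x y)" "i < dim y"
      "\<And>j. j < dim x \<Longrightarrow> w j \<in> carrier (fun_obj N x)" for x y f w i
  proof -
    interpret V: abelian_group "fun_obj N' y" using P'.N.obj_abelian that obj_eq by simp
    have "\<eta> y (matrix_act N x y f w i) = (\<Oplus>\<^bsub>fun_obj N' y\<^esub>j\<in>{..<dim x}. \<eta> y (fun_map N x y (d x y f i j) (w j)))"
      unfolding matrix_act_def
      by (rule additive_map_finsum[OF linear_map_additive[OF lin]])
        (use that P.N.obj_abelian P'.N.obj_abelian obj_eq in \<open>auto intro: P.entry_act_closed\<close>)
    also have "\<dots> = matrix_act N' x y f (\<lambda>j. \<eta> x (w j)) i"
      unfolding matrix_act_def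
      by (rule V.finsum_cong')
        (use that in \<open>auto simp: nat entry_closed linear_mapD[OF lin] intro!: P'.entry_act_closed\<close>)
    finally show ?thesis by simp
  qed
  let ?\<tau> = "\<lambda>x w. enc (dim x) (\<lambda>i. \<eta> x (dec i w))"
  have cl: "?\<tau> x w \<in> carrier (pull_obj N' x)" if x: "x \<in> cat_obj C" and w: "w \<in> carrier (pull_obj N x)" for x w
  proof (rule P'.pull_obj_enc[OF x])
    fix i assume i: "i < dim x"
    show "\<eta> x (dec i w) \<in> carrier (fun_obj N' x)" using i x w by (simp add: linear_mapD[OF lin] pull_obj_dec)
    show "matrix_act N' x x (cat_id C x) (\<lambda>i. \<eta> x (dec i w)) i = \<eta> x (dec i w)"
      using i x w by (simp add: act C.id_closed pull_obj_dec)
  qed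
  show ?thesis
    unfolding nat_trans_vect_iff[OF C.k_category_axioms P.pull_is_functor P'.pull_is_functor]
  proof (intro conjI ballI)
    fix x assume x: "x \<in> cat_obj C"
    interpret W: module k "pull_obj N x" by (rule P.pull_module[OF x])
    interpret W': module k "pull_obj N' x" by (rule P'.pull_module[OF x])
    have "linear_map k (pull_obj N x) (pull_obj N' x) (fun_map pull_functor N N' \<eta> x)"
    proof (rule linear_mapI)
      fix w assume w: "w \<in> carrier (pull_obj N x)"
      show "fun_map pull_functor N N' \<eta> x w \<in> carrier (pull_obj N' x)" using x w cl by simp
      fix w' assume w': "w' \<in> carrier (pull_obj N x)"
      have "?\<tau> x (w \<oplus>\<^bsub>pull_obj N x\<^esub> w') = ?\<tau> x w \<oplus>\<^bsub>pull_obj N' x\<^esub> ?\<tau> x w'"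
        by (rule pull_obj_eqI[of _ N' x])
          (use x w w' in \<open>simp_all add: cl dec_enc dec_pull_ops linear_mapD[OF lin] pull_obj_dec\<close>)
      then show "fun_map pull_functor N N' \<eta> x (w \<oplus>\<^bsub>pull_obj N x\<^esub> w') =
          fun_map pull_functor N N' \<eta> x w \<oplus>\<^bsub>pull_obj N' x\<^esub> fun_map pull_functor N N' \<eta> x w'"
        using x w w' by simp
    next
      fix c w assume w: "c \<in> carrier k" "w \<in> carrier (pull_obj N x)"
      have "?\<tau> x (c \<odot>\<^bsub>pull_obj N x\<^esub> w) = c \<odot>\<^bsub>pull_obj N' x\<^esub> ?\<tau> x w"
        by (rule pull_obj_eqI[of _ N' x])
          (use x w in \<open>simp_all add: cl dec_enc dec_pull_ops linear_mapD[OF lin] pull_obj_dec\<close>)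
      then show "fun_map pull_functor N N' \<eta> x (c \<odot>\<^bsub>pull_obj N x\<^esub> w) =
          c \<odot>\<^bsub>pull_obj N' x\<^esub> fun_map pull_functor N N' \<eta> x w"
        using x w by simp
    qed
    then show "linear_map k (fun_obj (pull N) x) (fun_obj (pull N') x) (fun_map pull_functor N N' \<eta> x)" by simp
    fix y f w assume y: "y \<in> cat_obj C" and f: "f \<in> carrier (cat_hom C x y)"
      and "w \<in> carrier (fun_obj (pull N) x)"
    then have w: "w \<in> carrier (pull_obj N x)" by simp
    have "?\<tau> y (fun_map (pull N) x y f w) = fun_map (pull N') x y f (?\<tau> x w)"
    proof (rule pull_obj_eqI[of _ N' y])
      fix i assume i: "i < dim y"
      have "dec i (fun_map (pull N') x y f (?\<tau> x w)) = matrix_act N' x y f (\<lambda>j. dec j (?\<tau> x w)) i"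
        by (rule P'.pull_map_dec[OF cl[OF x w] i])
      also have "\<dots> = matrix_act N' x y f (\<lambda>j. \<eta> x (dec j w)) i"
        by (rule P'.matrix_act_cong[OF x y f i])
          (use x w in \<open>auto simp: dec_enc linear_mapD[OF lin] pull_obj_dec\<close>)
      also have "\<dots> = \<eta> y (matrix_act N x y f (\<lambda>j. dec j w) i)"
        using x y f i w by (intro act) (auto simp: pull_obj_dec)
      finally show "dec i (?\<tau> y (fun_map (pull N) x y f w)) = dec i (fun_map (pull N') x y f (?\<tau> x w))"
        using i w by (simp add: dec_enc P.pull_map_dec del: pull_simps)
    qed (use x y f w in \<open>simp_all add: cl P.pull_map_closed P'.pull_map_closed del: pull_simps\<close>)
    then show "fun_map pull_functor N N' \<eta> y (fun_map (pull N) x y f w) =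
        fun_map (pull N') x y f (fun_map pull_functor N N' \<eta> x w)"
      using x y f w by (simp add: P.pull_map_closed del: pull_simps(2))
  qed simp_all
qed

lemma pull_functor_is_functor:
  "k_functor k (left_modules TYPE('u) k D) (left_modules TYPE('u) k C) pull_functor"
  unfolding k_functor_def
proof (intro conjI ballI)
  show "fun_obj pull_functor \<in> cat_obj (left_modules TYPE('u) k D) \<rightarrow> cat_obj (left_modules TYPE('u) k C)"
    using pulled_module.pull_is_functor[OF pulled_module_axiom] by auto
  fix N assume "N \<in> cat_obj (left_modules TYPE('u) k D)"
  then have N: "k_functor k D (vect_cat TYPE('u) k) N" by simp
  interpret P: pulled_module enc dec k C D dim d N by (rule pulled_module_axiom[OF N])
  show "fun_map pull_functor N N (cat_id (left_modules TYPE('u) k D) N) =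
      cat_id (left_modules TYPE('u) k C) (fun_obj pull_functor N)"
  proof -
    have "enc (dim x) (\<lambda>i. (\<lambda>x\<in>cat_obj C. \<lambda>v\<in>carrier (fun_obj N x). v) x (dec i w)) = w"
      if "x \<in> cat_obj C" "w \<in> carrier (pull_obj N x)" for x w
    proof -
      have "enc (dim x) (\<lambda>i. (\<lambda>x\<in>cat_obj C. \<lambda>v\<in>carrier (fun_obj N x). v) x (dec i w)) = enc (dim x) (\<lambda>i. dec i w)"
        by (rule enc_cong) (use that in \<open>simp add: pull_obj_dec\<close>)
      then show ?thesis using that by (simp add: enc_dec)
    qed
    then show ?thesis by (auto simp: obj_eq intro!: restrict_ext)
  qed
  fix N' assume "N' \<in> cat_obj (left_modules TYPE('u) k D)"
  then have N': "k_functor k D (vect_cat TYPE('u) k) N'" by simp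
  show "linear_map k (cat_hom (left_modules TYPE('u) k D) N N')
      (cat_hom (left_modules TYPE('u) k C) (fun_obj pull_functor N) (fun_obj pull_functor N'))
      (fun_map pull_functor N N')"
  proof (rule linear_mapI)
    fix \<eta> assume "\<eta> \<in> carrier (cat_hom (left_modules TYPE('u) k D) N N')"
    then show "fun_map pull_functor N N' \<eta> \<in>
        carrier (cat_hom (left_modules TYPE('u) k C) (fun_obj pull_functor N) (fun_obj pull_functor N'))"
      using pull_trans[OF N N'] by (simp del: pull_functor_simps(2))
  qed (auto simp: obj_eq pull_obj_simps dec_enc pull_obj_dec intro!: restrict_ext enc_cong)
  fix N'' \<eta> \<theta> assume "N'' \<in> cat_obj (left_modules TYPE('u) k D)"
    and \<eta>: "\<eta> \<in> carrier (cat_hom (left_modules TYPE('u) k D) N N')"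
    and \<theta>: "\<theta> \<in> carrier (cat_hom (left_modules TYPE('u) k D) N' N'')"
  have "fun_map pull_functor N N' \<eta> x w \<in> carrier (pull_obj N' x)"
    if "x \<in> cat_obj C" "w \<in> carrier (pull_obj N x)" for x w
    using linear_mapD(1)[OF nat_trans_linear[OF pull_trans[OF N N'] that(1)], of \<eta> w] \<eta> that
    by (simp del: pull_functor_simps(2))
  then show "fun_map pull_functor N N'' (cat_comp (left_modules TYPE('u) k D) N N' N'' \<theta> \<eta>) =
      cat_comp (left_modules TYPE('u) k C) (fun_obj pull_functor N) (fun_obj pull_functor N') (fun_obj pull_functor N'')
        (fun_map pull_functor N' N'' \<theta>) (fun_map pull_functor N N' \<eta>)"
    by (auto simp: obj_eq compose_def dec_enc pull_obj_dec intro!: restrict_ext enc_cong)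
qed

end

section \<open>Inverse matrix functors\<close>

text \<open>Going from C to D and back yields matrices over C indexed by pairs (i, a). The
  conditions say that this composite is f \<mapsto> s f t for a column s and a row t with t s = 1,
  so s t is the idempotent of the identity. Only one of the two composites is described; the other
  is a second instance with the roles of C and D exchanged.\<close>

locale inverse_matrix_functors =
  F: matrix_functor enc dec k C D n d + G: matrix_functor enc dec k D C m c
  for enc :: "nat \<Rightarrow> (nat \<Rightarrow> 'u) \<Rightarrow> 'u" and dec :: "nat \<Rightarrow> 'u \<Rightarrow> 'u"
    and k :: "('k, 'e) ring_scheme" and C :: "('k, 'o, 'm) kcat" and D :: "('k, 'o, 'n) kcat"
    and n d m c +
  fixes s t :: "'o \<Rightarrow> nat \<Rightarrow> nat \<Rightarrow> 'm"
  assumes s_closed: "\<lbrakk>x \<in> cat_obj C; i < n x; a < m x\<rbrakk> \<Longrightarrow> s x i a \<in> carrier (cat_hom C x x)"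
    and t_closed: "\<lbrakk>x \<in> cat_obj C; i < n x; a < m x\<rbrakk> \<Longrightarrow> t x i a \<in> carrier (cat_hom C x x)"
    and conjugate: "\<lbrakk>x \<in> cat_obj C; y \<in> cat_obj C; f \<in> carrier (cat_hom C x y);
        i < n y; j < n x; a < m y; b < m x\<rbrakk> \<Longrightarrow>
      c x y (d x y f i j) a b = cat_comp C x y y (s y i a) (cat_comp C x x y f (t x j b))"
    and unit: "x \<in> cat_obj C \<Longrightarrow>
      (\<Oplus>\<^bsub>cat_hom C x x\<^esub>i\<in>{..<n x}. \<Oplus>\<^bsub>cat_hom C x x\<^esub>a\<in>{..<m x}. cat_comp C x x x (t x i a) (s x i a)) = cat_id C x"

section \<open>The double pull-back of a module\<close>

locale pulled_twice = inverse_matrix_functors enc dec k C D n d m c s t + M: left_module k C M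
  for enc :: "nat \<Rightarrow> (nat \<Rightarrow> 'u) \<Rightarrow> 'u" and dec :: "nat \<Rightarrow> 'u \<Rightarrow> 'u"
    and k :: "('k, 'e) ring_scheme" and C :: "('k, 'o, 'm) kcat" and D :: "('k, 'o, 'n) kcat"
    and n d m c s t and M :: "('o, 'm, ('k, 'u) module, 'u \<Rightarrow> 'u) kfun"
begin

sublocale GM: pulled_module enc dec k D C m c M
  by (rule G.pulled_module_axiom[OF M.is_functor])

sublocale FGM: pulled_module enc dec k C D n d "G.pull M"
  by (rule F.pulled_module_axiom[OF GM.pull_is_functor])

abbreviation "V \<equiv> fun_obj M"
abbreviation "act \<equiv> fun_map M"
abbreviation "FGV \<equiv> F.pull_obj (G.pull M)"

text \<open>Multiplication by the row t. \<open>counit\<close> does this to a doubly coded tuple,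
  and \<open>expand\<close> is multiplication by the column s. They are inverse to each other
  because t s = 1 and because s t acts trivially on the tuples that are kept. The argument is a
  function of the indices, so that uncoded families can be contracted too.\<close>

definition contract :: "'o \<Rightarrow> (nat \<Rightarrow> nat \<Rightarrow> 'u) \<Rightarrow> 'u" where
  "contract x r = (\<Oplus>\<^bsub>V x\<^esub>i\<in>{..<n x}. \<Oplus>\<^bsub>V x\<^esub>a\<in>{..<m x}. act x x (t x i a) (r i a))"

definition counit :: "'o \<Rightarrow> 'u \<Rightarrow> 'u" where
  "counit x w = contract x (\<lambda>i a. dec a (dec i w))"

definition expand :: "'o \<Rightarrow> 'u \<Rightarrow> 'u" where
  "expand x v = enc (n x) (\<lambda>i. enc (m x) (\<lambda>a. act x x (s x i a) v))"

lemma contract_closed: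
  assumes "x \<in> cat_obj C" "\<And>i a. \<lbrakk>i < n x; a < m x\<rbrakk> \<Longrightarrow> r i a \<in> carrier (V x)"
  shows "contract x r \<in> carrier (V x)"
proof -
  interpret V: abelian_group "V x" by (rule M.obj_abelian[OF assms(1)])
  show ?thesis unfolding contract_def
    by (intro V.finsum_closed Pi_I) (use assms in \<open>auto intro!: V.finsum_closed M.act_closed t_closed\<close>)
qed

lemma contract_cong:
  assumes "x \<in> cat_obj C" "\<And>i a. \<lbrakk>i < n x; a < m x\<rbrakk> \<Longrightarrow> r i a \<in> carrier (V x)"
    and "\<And>i a. \<lbrakk>i < n x; a < m x\<rbrakk> \<Longrightarrow> r' i a = r i a"
  shows "contract x r' = contract x r"
proof -
  interpret V: abelian_group "V x" by (rule M.obj_abelian[OF assms(1)])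
  show ?thesis unfolding contract_def
    by (intro V.finsum_cong' refl Pi_I)
      (use assms in \<open>auto intro!: V.finsum_closed M.act_closed t_closed\<close>)
qed

text \<open>Applied twice: with g = s f to compute the double action, and with g a component of a
  module morphism for the naturality of the counit.\<close>

lemma contract_map:
  assumes "x \<in> cat_obj C" "\<And>i a. \<lbrakk>i < n x; a < m x\<rbrakk> \<Longrightarrow> r i a \<in> carrier (V x)"
    and g: "additive_map (V x) W g" and W: "abelian_group W"
  shows "(\<Oplus>\<^bsub>W\<^esub>i\<in>{..<n x}. \<Oplus>\<^bsub>W\<^esub>a\<in>{..<m x}. g (act x x (t x i a) (r i a))) = g (contract x r)"
proof -
  interpret V: abelian_group "V x" by (rule M.obj_abelian[OF assms(1)])
  interpret W: abelian_group W by (rule W)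
  have cl: "act x x (t x i a) (r i a) \<in> carrier (V x)" if "i < n x" "a < m x" for i a
    using that assms by (auto intro!: M.act_closed t_closed)
  have inner: "(\<Oplus>\<^bsub>V x\<^esub>a\<in>{..<m x}. act x x (t x i a) (r i a)) \<in> carrier (V x)"
    if "i < n x" for i using that cl by (auto intro!: V.finsum_closed)
  have "g (contract x r) = (\<Oplus>\<^bsub>W\<^esub>i\<in>{..<n x}. g (\<Oplus>\<^bsub>V x\<^esub>a\<in>{..<m x}. act x x (t x i a) (r i a)))"
    unfolding contract_def
    by (rule additive_map_finsum[OF g V.abelian_group_axioms W]) (use inner in auto)
  also have "\<dots> = (\<Oplus>\<^bsub>W\<^esub>i\<in>{..<n x}. \<Oplus>\<^bsub>W\<^esub>a\<in>{..<m x}. g (act x x (t x i a) (r i a)))"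
  proof (rule W.finsum_cong')
    fix i assume "i \<in> {..<n x}"
    then show "g (\<Oplus>\<^bsub>V x\<^esub>a\<in>{..<m x}. act x x (t x i a) (r i a)) =
        (\<Oplus>\<^bsub>W\<^esub>a\<in>{..<m x}. g (act x x (t x i a) (r i a)))"
      by (intro additive_map_finsum[OF g V.abelian_group_axioms W]) (use cl in auto)
  qed (use cl in \<open>auto intro!: W.finsum_closed additive_map_closed[OF g]\<close>)
  finally show ?thesis by simp
qed

text \<open>The relation t s = 1, carried to the module by linearity of the action in the acting
  morphism.\<close>

lemma contract_act_s:
  assumes x: "x \<in> cat_obj C" and v: "v \<in> carrier (V x)"
  shows "contract x (\<lambda>i a. act x x (s x i a) v) = v"
proof -
  interpret V: abelian_group "V x" by (rule M.obj_abelian[OF x])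
  have ab: "abelian_group (cat_hom C x x)" using F.C.hom_module[OF x x] by (simp add: module_def)
  interpret H: abelian_group "cat_hom C x x" by (rule ab)
  note act = linear_map_additive[OF M.act_linear_left[OF x x v]]
  have ts: "cat_comp C x x x (t x i a) (s x i a) \<in> carrier (cat_hom C x x)" if "i < n x" "a < m x" for i a
    using that x by (simp add: F.C.comp_closed s_closed t_closed)
  have "v = act x x (cat_id C x) v" using M.act_id[OF x v] by simp
  also have "\<dots> = (\<Oplus>\<^bsub>V x\<^esub>i\<in>{..<n x}. act x x (\<Oplus>\<^bsub>cat_hom C x x\<^esub>a\<in>{..<m x}. cat_comp C x x x (t x i a) (s x i a)) v)"
    unfolding unit[OF x, symmetric]
    by (rule additive_map_finsum[OF act ab V.abelian_group_axioms]) (use ts in \<open>auto intro!: H.finsum_closed\<close>)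
  also have "\<dots> = contract x (\<lambda>i a. act x x (s x i a) v)"
    unfolding contract_def
  proof (rule V.finsum_cong')
    fix i assume i: "i \<in> {..<n x}"
    have "act x x (\<Oplus>\<^bsub>cat_hom C x x\<^esub>a\<in>{..<m x}. cat_comp C x x x (t x i a) (s x i a)) v =
        (\<Oplus>\<^bsub>V x\<^esub>a\<in>{..<m x}. act x x (cat_comp C x x x (t x i a) (s x i a)) v)"
      by (rule additive_map_finsum[OF act ab V.abelian_group_axioms]) (use ts i in auto)
    also have "\<dots> = (\<Oplus>\<^bsub>V x\<^esub>a\<in>{..<m x}. act x x (t x i a) (act x x (s x i a) v))"
      by (rule V.finsum_cong')
        (use i x v in \<open>auto intro!: M.act_comp M.act_closed s_closed t_closed\<close>)
    finally show "act x x (\<Oplus>\<^bsub>cat_hom C x x\<^esub>a\<in>{..<m x}. cat_comp C x x x (t x i a) (s x i a)) v = \<dots>" .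
  qed (use x v in \<open>auto intro!: V.finsum_closed M.act_closed s_closed t_closed\<close>)
  finally show ?thesis by simp
qed

text \<open>The entries of the composite matrix factor as s_ia f t_jb, so the sums over j and b can
  be moved inside: contract with t, apply f, multiply by s_ia.\<close>

lemma double_matrix_act:
  assumes x: "x \<in> cat_obj C" and y: "y \<in> cat_obj C" and f: "f \<in> carrier (cat_hom C x y)"
    and i: "i < n y" and a: "a < m y"
    and r: "\<And>j b. \<lbrakk>j < n x; b < m x\<rbrakk> \<Longrightarrow> r j b \<in> carrier (V x)"
  shows "(\<Oplus>\<^bsub>V y\<^esub>j\<in>{..<n x}. G.matrix_act M x y (d x y f i j) (r j) a) =
    act y y (s y i a) (act x y f (contract x r))"
proof -
  interpret V: abelian_group "V y" by (rule M.obj_abelian[OF y])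
  let ?g = "\<lambda>v. act y y (s y i a) (act x y f v)"
  have g: "additive_map (V x) (V y) ?g"
    by (rule additive_map_compose[OF linear_map_additive[OF M.act_linear] linear_map_additive[OF M.act_linear]])
      (use x y f i a in \<open>auto intro: s_closed\<close>)
  have "(\<Oplus>\<^bsub>V y\<^esub>j\<in>{..<n x}. G.matrix_act M x y (d x y f i j) (r j) a) =
      (\<Oplus>\<^bsub>V y\<^esub>j\<in>{..<n x}. \<Oplus>\<^bsub>V y\<^esub>b\<in>{..<m x}. ?g (act x x (t x j b) (r j b)))"
    unfolding G.matrix_act_def
  proof (intro V.finsum_cong' refl Pi_I)
    fix j b assume "j \<in> {..<n x}" "b \<in> {..<m x}"
    then have jb: "j < n x" "b < m x" by auto
    show "act x y (c x y (d x y f i j) a b) (r j b) = ?g (act x x (t x j b) (r j b))"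
      using x y f i a jb r
      by (simp add: conjugate M.act_comp[of x y y] M.act_comp[of x x y] F.C.comp_closed s_closed t_closed)
  next
    fix j b assume "j \<in> {..<n x}" "b \<in> {..<m x}"
    then show "?g (act x x (t x j b) (r j b)) \<in> carrier (V y)"
      by (intro additive_map_closed[OF g] M.act_closed t_closed r x) auto
  next
    fix j assume "j \<in> {..<n x}"
    then show "(\<Oplus>\<^bsub>V y\<^esub>b\<in>{..<m x}. ?g (act x x (t x j b) (r j b))) \<in> carrier (V y)"
      by (intro V.finsum_closed Pi_I additive_map_closed[OF g] M.act_closed t_closed r x) auto
  qed
  also have "\<dots> = ?g (contract x r)"
    by (rule contract_map[OF x r g V.abelian_group_axioms])
  finally show ?thesis .
qed

text \<open>The preceding computation for coded inner tuples: decoding an entry is linear and passes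
  through the outer sum.\<close>

lemma dec_matrix_act:
  assumes x: "x \<in> cat_obj C" and y: "y \<in> cat_obj C" and f: "f \<in> carrier (cat_hom C x y)"
    and i: "i < n y" and a: "a < m y" and u: "\<And>j. j < n x \<Longrightarrow> u j \<in> carrier (G.pull_obj M x)"
  shows "dec a (F.matrix_act (G.pull M) x y f u i) =
    act y y (s y i a) (act x y f (contract x (\<lambda>j b. dec b (u j))))"
proof -
  interpret V: abelian_group "V y" by (rule M.obj_abelian[OF y])
  note xD = x[folded F.obj_eq] and yD = y[folded F.obj_eq]
  have ab: "abelian_group (G.pull_obj M y)" using GM.pull_module[OF yD] by (simp add: module_def)
  have d_cl: "d x y f i j \<in> carrier (cat_hom D x y)" if "j < n x" for j
    using that x y f i by (simp add: F.entry_closed)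
  have "dec a (F.matrix_act (G.pull M) x y f u i) =
      (\<Oplus>\<^bsub>V y\<^esub>j\<in>{..<n x}. dec a (fun_map (G.pull M) x y (d x y f i j) (u j)))"
    unfolding F.matrix_act_def G.pull_simps(1)
    by (rule additive_map_finsum[OF linear_map_additive[OF GM.dec_linear[OF yD a]] ab V.abelian_group_axioms])
      (use xD yD d_cl u in \<open>auto intro!: GM.pull_map_closed simp del: G.pull_simps\<close>)
  also have "\<dots> = (\<Oplus>\<^bsub>V y\<^esub>j\<in>{..<n x}. G.matrix_act M x y (d x y f i j) (\<lambda>b. dec b (u j)) a)"
    by (rule V.finsum_cong')
      (use xD yD a u d_cl in \<open>auto simp: GM.pull_map_dec G.pull_obj_dec intro!: GM.matrix_act_closed simp del: G.pull_simps\<close>)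
  also have "\<dots> = act y y (s y i a) (act x y f (contract x (\<lambda>j b. dec b (u j))))"
    by (rule double_matrix_act[OF x y f i a]) (use u G.pull_obj_dec in blast)
  finally show ?thesis .
qed

lemma double_dec_closed:
  "\<lbrakk>w \<in> carrier (FGV x); i < n x; a < m x\<rbrakk> \<Longrightarrow> dec a (dec i w) \<in> carrier (V x)"
  using F.pull_obj_dec(1)[of w "G.pull M" x i] G.pull_obj_dec(1) by simp

lemma counit_closed:
  "\<lbrakk>x \<in> cat_obj C; w \<in> carrier (FGV x)\<rbrakk> \<Longrightarrow> counit x w \<in> carrier (V x)"
  unfolding counit_def by (rule contract_closed) (auto intro: double_dec_closed)

lemma double_dec_pull_map:
  assumes "x \<in> cat_obj C" "y \<in> cat_obj C" "f \<in> carrier (cat_hom C x y)" "i < n y" "a < m y"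
    and w: "w \<in> carrier (FGV x)"
  shows "dec a (dec i (fun_map (F.pull (G.pull M)) x y f w)) =
    act y y (s y i a) (act x y f (counit x w))"
  unfolding counit_def FGM.pull_map_dec[OF w assms(4)]
  by (rule dec_matrix_act[OF assms(1-5)]) (use F.pull_obj_dec(1)[OF w] in simp)

text \<open>The identity of x acts trivially on the double pull-back, while by the formula for the
  action it acts as w \<mapsto> s (t w). Hence w is recovered from its counit.\<close>

lemma double_dec:
  assumes x: "x \<in> cat_obj C" and i: "i < n x" and a: "a < m x" and w: "w \<in> carrier (FGV x)"
  shows "dec a (dec i w) = act x x (s x i a) (counit x w)"
proof -
  have "fun_map (F.pull (G.pull M)) x x (cat_id C x) w = w"
    using left_module.act_id[OF left_module.intro[OF F.C.k_category_axioms
          left_module_axioms.intro[OF FGM.pull_is_functor]] x] w by simp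
  then show ?thesis
    using double_dec_pull_map[OF x x F.C.id_closed[OF x] i a w] counit_closed[OF x w] M.act_id[OF x] by simp
qed

text \<open>The entries of f w are s_ia (f (counit w)), and contracting them leaves f (counit w) by
  t s = 1.\<close>

lemma counit_natural:
  assumes x: "x \<in> cat_obj C" and y: "y \<in> cat_obj C" and f: "f \<in> carrier (cat_hom C x y)"
    and w: "w \<in> carrier (FGV x)"
  shows "counit y (fun_map (F.pull (G.pull M)) x y f w) = act x y f (counit x w)"
proof -
  have cl: "act x y f (counit x w) \<in> carrier (V y)"
    by (rule M.act_closed[OF x y f counit_closed[OF x w]])
  have "counit y (fun_map (F.pull (G.pull M)) x y f w) =
      contract y (\<lambda>i a. act y y (s y i a) (act x y f (counit x w)))"
    unfolding counit_def[of y]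
    by (rule contract_cong[OF y])
      (use y cl in \<open>auto simp: double_dec_pull_map[OF x y f _ _ w] intro!: M.act_closed s_closed simp del: F.pull_simps\<close>)
  then show ?thesis using contract_act_s[OF y cl] by simp
qed

lemma counit_linear:
  assumes x: "x \<in> cat_obj C"
  shows "linear_map k (FGV x) (V x) (counit x)"
proof -
  have "linear_map k (FGV x) (V x) (\<lambda>w. act x x (t x i a) (dec a (dec i w)))"
    if i: "i < n x" and a: "a < m x" for i a
    by (rule linear_map_compose[OF linear_map_compose[OF FGM.dec_linear[OF x i, unfolded G.pull_simps(1)]
            GM.dec_linear[OF x[folded F.obj_eq] a]] M.act_linear[OF x x t_closed[OF x i a]]])
  then show ?thesis
    unfolding counit_def contract_def
    by (intro linear_map_finsum M.obj_module x) auto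
qed

text \<open>The delicate membership. The hypotheses evaluate c only on entries of d, so it cannot be
  tested directly that the inner tuple (s_ia v)_a is fixed by the matrix that c assigns to an
  identity of D. Instead it is exhibited as a sum of values of the matrix action of c, each of which
  is fixed.\<close>

lemma expand_inner_closed:
  assumes x: "x \<in> cat_obj C" and v: "v \<in> carrier (V x)" and i: "i < n x"
  shows "enc (m x) (\<lambda>a. act x x (s x i a) v) \<in> carrier (G.pull_obj M x)"
proof -
  note xD = x[folded F.obj_eq]
  let ?sv = "\<lambda>j b. act x x (s x j b) v"
  have sv: "?sv j b \<in> carrier (V x)" if "j < n x" "b < m x" for j b
    using x v that by (auto intro!: M.act_closed s_closed)
  interpret V: abelian_group "V x" by (rule M.obj_abelian[OF x])
  interpret W: module k "G.pull_obj M x" by (rule GM.pull_module[OF xD])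
  let ?e = "\<lambda>j. enc (m x) (G.matrix_act M x x (d x x (cat_id C x) i j) (?sv j))"
  have d_cl: "d x x (cat_id C x) i j \<in> carrier (cat_hom D x x)" if "j < n x" for j
    using that x i by (simp add: F.entry_closed F.C.id_closed)
  have e: "?e j \<in> carrier (G.pull_obj M x)" if "j < n x" for j
    using that by (intro GM.enc_matrix_act_closed xD d_cl sv)
  \<comment> \<open>By \<open>double_matrix_act\<close> for the identity of x, entry a of this sum
    is s_ia (t (s v)) = s_ia v.\<close>
  define u where "u = (\<Oplus>\<^bsub>G.pull_obj M x\<^esub>j\<in>{..<n x}. ?e j)"
  have u: "u \<in> carrier (G.pull_obj M x)"
    unfolding u_def by (rule W.finsum_closed) (use e in auto)
  have "dec a u = ?sv i a" if a: "a < m x" for a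
  proof -
    have "dec a u = (\<Oplus>\<^bsub>V x\<^esub>j\<in>{..<n x}. dec a (?e j))"
      unfolding u_def
      by (rule additive_map_finsum[OF linear_map_additive[OF GM.dec_linear[OF xD a]]
            W.M.abelian_group_axioms V.abelian_group_axioms]) (use e in auto)
    also have "\<dots> = (\<Oplus>\<^bsub>V x\<^esub>j\<in>{..<n x}. G.matrix_act M x x (d x x (cat_id C x) i j) (?sv j) a)"
      by (rule V.finsum_cong')
        (use a xD d_cl sv in \<open>auto simp: F.dec_enc intro!: GM.matrix_act_closed\<close>)
    also have "\<dots> = act x x (s x i a) (act x x (cat_id C x) (contract x ?sv))"
      by (rule double_matrix_act[OF x x F.C.id_closed[OF x] i a sv])
    finally show ?thesis using contract_act_s[OF x v] M.act_id[OF x v] by simp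
  qed
  then have "enc (m x) (\<lambda>a. ?sv i a) = enc (m x) (\<lambda>a. dec a u)"
    by (intro F.enc_cong) simp
  then show ?thesis using u G.enc_dec[OF u] by simp
qed

text \<open>The outer fixedness: the matrix of the identity sends s v to s (t (s v)) = s v.\<close>

lemma expand_closed:
  assumes x: "x \<in> cat_obj C" and v: "v \<in> carrier (V x)"
  shows "expand x v \<in> carrier (FGV x)"
  unfolding expand_def
proof (rule FGM.pull_obj_enc[OF x])
  let ?u = "\<lambda>i. enc (m x) (\<lambda>a. act x x (s x i a) v)"
  fix i assume i: "i < n x"
  show "?u i \<in> carrier (fun_obj (G.pull M) x)"
    using expand_inner_closed[OF x v i] by simp
  show "F.matrix_act (G.pull M) x x (cat_id C x) ?u i = ?u i"
  proof (rule G.pull_obj_eqI[of _ M x])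
    show "F.matrix_act (G.pull M) x x (cat_id C x) ?u i \<in> carrier (G.pull_obj M x)"
      using FGM.matrix_act_closed[OF x x F.C.id_closed[OF x] i, of ?u] expand_inner_closed[OF x v] by simp
    show "?u i \<in> carrier (G.pull_obj M x)" by (rule expand_inner_closed[OF x v i])
    fix a assume a: "a < m x"
    have "contract x (\<lambda>j b. dec b (?u j)) = contract x (\<lambda>i a. act x x (s x i a) v)"
      by (rule contract_cong[OF x]) (use x v in \<open>auto simp: F.dec_enc intro!: M.act_closed s_closed\<close>)
    then have "dec a (F.matrix_act (G.pull M) x x (cat_id C x) ?u i) = act x x (s x i a) v"
      using dec_matrix_act[OF x x F.C.id_closed[OF x] i a, of ?u] expand_inner_closed[OF x v]
        contract_act_s[OF x v] M.act_id[OF x v] by simp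
    then show "dec a (F.matrix_act (G.pull M) x x (cat_id C x) ?u i) = dec a (?u i)"
      using a by (simp add: F.dec_enc)
  qed
qed

lemma counit_expand:
  assumes x: "x \<in> cat_obj C" and v: "v \<in> carrier (V x)"
  shows "counit x (expand x v) = v"
proof -
  have "counit x (expand x v) = contract x (\<lambda>i a. act x x (s x i a) v)"
    unfolding counit_def expand_def
    by (rule contract_cong[OF x]) (use x v in \<open>auto simp: F.dec_enc intro!: M.act_closed s_closed\<close>)
  then show ?thesis using contract_act_s[OF x v] by simp
qed

lemma expand_counit:
  assumes x: "x \<in> cat_obj C" and w: "w \<in> carrier (FGV x)"
  shows "expand x (counit x w) = w"
proof (rule F.pull_obj_eqI[of _ "G.pull M" x])
  show e: "expand x (counit x w) \<in> carrier (FGV x)"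
    by (rule expand_closed[OF x counit_closed[OF x w]])
  fix i assume i: "i < n x"
  show "dec i (expand x (counit x w)) = dec i w"
  proof (rule G.pull_obj_eqI[of _ M x])
    show "dec i (expand x (counit x w)) \<in> carrier (G.pull_obj M x)" "dec i w \<in> carrier (G.pull_obj M x)"
      using F.pull_obj_dec(1)[OF e i] F.pull_obj_dec(1)[OF w i] by simp_all
    fix a assume a: "a < m x"
    show "dec a (dec i (expand x (counit x w))) = dec a (dec i w)"
      unfolding double_dec[OF x i a w] using i a by (simp add: expand_def F.dec_enc)
  qed
qed (rule w)

definition counit_trans :: "'o \<Rightarrow> 'u \<Rightarrow> 'u" where
  "counit_trans = (\<lambda>x\<in>cat_obj C. \<lambda>w\<in>carrier (FGV x). counit x w)"

lemma counit_trans_natural: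
  "counit_trans \<in> nat_trans C (vect_cat TYPE('u) k) (F.pull (G.pull M)) M"
  unfolding nat_trans_vect_iff[OF F.C.k_category_axioms FGM.pull_is_functor M.is_functor]
proof (intro conjI ballI)
  fix x assume x: "x \<in> cat_obj C"
  interpret W: module k "FGV x" by (rule FGM.pull_module[OF x])
  show "linear_map k (fun_obj (F.pull (G.pull M)) x) (V x) (counit_trans x)"
    unfolding F.pull_simps(1)
    by (rule linear_mapI) (use x in \<open>simp_all add: counit_trans_def linear_mapD[OF counit_linear]\<close>)
  fix y f w assume "y \<in> cat_obj C" "f \<in> carrier (cat_hom C x y)" "w \<in> carrier (fun_obj (F.pull (G.pull M)) x)"
  then show "counit_trans y (fun_map (F.pull (G.pull M)) x y f w) = act x y f (counit_trans x w)"
    using x by (simp add: counit_trans_def counit_natural FGM.pull_map_closed del: F.pull_simps(2))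
qed (simp_all add: counit_trans_def)

lemma counit_trans_iso:
  "cat_iso (left_modules TYPE('u) k C) (F.pull (G.pull M)) M counit_trans"
  by (rule left_modules_isoI[OF F.C.k_category_axioms FGM.pull_is_functor M.is_functor counit_trans_natural,
        where \<iota> = expand])
    (simp_all add: counit_trans_def expand_closed counit_expand expand_counit)

end

context inverse_matrix_functors
begin

lemma pulled_twice_axiom:
  "k_functor k C (vect_cat TYPE('u) k) M \<Longrightarrow> pulled_twice enc dec k C D n d m c s t M"
  by (intro pulled_twice.intro inverse_matrix_functors_axioms left_module.intro left_module_axioms.intro)
    unfold_locales

theorem pull_twice_isomorphic_id:
  "naturally_isomorphic (left_modules TYPE('u) k C) (left_modules TYPE('u) k C)
     (comp_functor F.pull_functor G.pull_functor) id_functor"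
proof -
  let ?L = "left_modules TYPE('u) k C"
  let ?\<epsilon> = "\<lambda>M\<in>cat_obj ?L. pulled_twice.counit_trans enc dec C D n d m c t M"
  have "?\<epsilon> \<in> nat_trans ?L ?L (comp_functor F.pull_functor G.pull_functor) id_functor"
    unfolding nat_trans_def
  proof (intro CollectI conjI ballI PiE_I)
    fix M assume "M \<in> cat_obj ?L"
    then have M: "k_functor k C (vect_cat TYPE('u) k) M" by simp
    interpret M: pulled_twice enc dec k C D n d m c s t M by (rule pulled_twice_axiom[OF M])
    show "?\<epsilon> M \<in> carrier (cat_hom ?L (fun_obj (comp_functor F.pull_functor G.pull_functor) M) (fun_obj id_functor M))"
      using M M.counit_trans_natural by (simp add: comp_functor_def id_functor_def)
    fix M' \<theta> assume "M' \<in> cat_obj ?L"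
    then have M': "k_functor k C (vect_cat TYPE('u) k) M'" by simp
    interpret M': pulled_twice enc dec k C D n d m c s t M' by (rule pulled_twice_axiom[OF M'])
    assume "\<theta> \<in> carrier (cat_hom ?L M M')"
    then have \<theta>: "\<theta> \<in> nat_trans C (vect_cat TYPE('u) k) M M'" by simp
    note lin = nat_trans_linear[OF \<theta>]
    have nat: "\<theta> y (fun_map M x y u v) = fun_map M' x y u (\<theta> x v)"
      if "x \<in> cat_obj C" "y \<in> cat_obj C" "u \<in> carrier (cat_hom C x y)" "v \<in> carrier (fun_obj M x)" for x y u v
      using \<theta>[unfolded nat_trans_vect_iff[OF F.C.k_category_axioms M M']] that by blast
    let ?\<theta>' = "fun_map (comp_functor F.pull_functor G.pull_functor) M M' \<theta>"
    have \<theta>': "?\<theta>' \<in> nat_trans C (vect_cat TYPE('u) k) (F.pull (G.pull M)) (F.pull (G.pull M'))"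
      using F.pull_trans[OF M.GM.pull_is_functor M'.GM.pull_is_functor G.pull_trans[OF M M' \<theta>]]
      by (simp add: comp_functor_def del: F.pull_functor_simps(2) G.pull_functor_simps(2))
    \<comment> \<open>Naturality in the module: \<theta> is additive and commutes with the action of
      each t_ia, hence with the contraction.\<close>
    have key: "M'.counit x (?\<theta>' x w) = \<theta> x (M.counit x w)"
      if x: "x \<in> cat_obj C" and w: "w \<in> carrier (F.pull_obj (G.pull M) x)" for x w
    proof -
      interpret V': abelian_group "fun_obj M' x" by (rule M'.M.obj_abelian[OF x])
      note cl = M.double_dec_closed[OF w]
      have dd: "dec a (dec i (?\<theta>' x w)) = \<theta> x (dec a (dec i w))" if "i < n x" "a < m x" for i a
        using that x w F.pull_obj_dec(1)[OF w] by (simp add: comp_functor_def F.dec_enc F.obj_eq)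
      have "\<theta> x (M.counit x w) =
          (\<Oplus>\<^bsub>fun_obj M' x\<^esub>i\<in>{..<n x}. \<Oplus>\<^bsub>fun_obj M' x\<^esub>a\<in>{..<m x}. \<theta> x (fun_map M x x (t x i a) (dec a (dec i w))))"
        unfolding M.counit_def
        by (rule M.contract_map[symmetric, OF x cl linear_map_additive[OF lin[OF x]] V'.abelian_group_axioms])
      also have "\<dots> = M'.contract x (\<lambda>i a. \<theta> x (dec a (dec i w)))"
        unfolding M'.contract_def
        by (intro V'.finsum_cong' refl Pi_I V'.finsum_closed)
          (use x cl in \<open>auto simp: nat t_closed intro!: M'.M.act_closed t_closed linear_mapD(1)[OF lin]\<close>)
      also have "\<dots> = M'.counit x (?\<theta>' x w)"
        unfolding M'.counit_def
        by (rule M'.contract_cong[symmetric, OF x]) (use x cl dd in \<open>auto intro!: linear_mapD(1)[OF lin]\<close>)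
      finally show ?thesis by simp
    qed
    have "compose (carrier (F.pull_obj (G.pull M) x)) (M'.counit_trans x) (?\<theta>' x) =
        compose (carrier (F.pull_obj (G.pull M) x)) (\<theta> x) (M.counit_trans x)" if x: "x \<in> cat_obj C" for x
      unfolding compose_def
      by (rule restrict_ext)
        (use x linear_mapD(1)[OF nat_trans_linear[OF \<theta>' x]] in
          \<open>auto simp: M.counit_trans_def M'.counit_trans_def key\<close>)
    then show "cat_comp ?L (fun_obj (comp_functor F.pull_functor G.pull_functor) M)
        (fun_obj (comp_functor F.pull_functor G.pull_functor) M') (fun_obj id_functor M') (?\<epsilon> M') ?\<theta>' =
      cat_comp ?L (fun_obj (comp_functor F.pull_functor G.pull_functor) M) (fun_obj id_functor M)
        (fun_obj id_functor M') (fun_map id_functor M M' \<theta>) (?\<epsilon> M)"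
      using M M' by (simp add: comp_functor_def id_functor_def cong: restrict_cong
          del: F.pull_functor_simps(2) G.pull_functor_simps(2))
  qed simp
  moreover have "\<forall>M\<in>cat_obj ?L. cat_iso ?L (fun_obj (comp_functor F.pull_functor G.pull_functor) M) (fun_obj id_functor M) (?\<epsilon> M)"
    using pulled_twice.counit_trans_iso[OF pulled_twice_axiom]
    by (simp add: comp_functor_def id_functor_def)
  ultimately show ?thesis unfolding naturally_isomorphic_def by blast
qed

end

text \<open>Pulling back along \<open>c\<close> takes modules over C to modules over D, and along
  \<open>d\<close> it goes the other way. Each hypothesis supplies one of the two natural
  isomorphisms.\<close>

theorem morita_equivalent_of_matrix_functors:
  fixes enc :: "nat \<Rightarrow> (nat \<Rightarrow> 'u) \<Rightarrow> 'u"
  assumes "inverse_matrix_functors enc dec k C D n d m c s t"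
    and "inverse_matrix_functors enc dec k D C m c n d s' t'"
  shows "morita_equivalent TYPE('u) k C D"
proof -
  interpret CD: inverse_matrix_functors enc dec k C D n d m c s t by fact
  interpret DC: inverse_matrix_functors enc dec k D C m c n d s' t' by fact
  show ?thesis
    unfolding morita_equivalent_def k_equivalent_def
    using CD.G.pull_functor_is_functor CD.F.pull_functor_is_functor
      CD.pull_twice_isomorphic_id DC.pull_twice_isomorphic_id by blast
qed

section \<open>The category built from a family of Morita contexts\<close>

lemma hom_bimod_simps [simp]:
  "carrier (hom_bimod C x y) = carrier (cat_hom C x y)" "add (hom_bimod C x y) = add (cat_hom C x y)"
  "zero (hom_bimod C x y) = zero (cat_hom C x y)" "smult (hom_bimod C x y) = smult (cat_hom C x y)"
  "lact (hom_bimod C x y) = cat_comp C x y y" "ract (hom_bimod C x y) = cat_comp C x x y"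
  by (simp_all add: hom_bimod_def module.defs bimod.defs)

lemma end_algebra_simps [simp]:
  "carrier (end_algebra C x) = carrier (cat_hom C x x)" "add (end_algebra C x) = add (cat_hom C x x)"
  "zero (end_algebra C x) = zero (cat_hom C x x)" "smult (end_algebra C x) = smult (cat_hom C x x)"
  "monoid.mult (end_algebra C x) = cat_comp C x x x" "one (end_algebra C x) = cat_id C x"
  by (simp_all add: end_algebra_def)

lemma module_truncate_simps [simp]:
  "carrier (module.truncate M) = carrier M" "add (module.truncate M) = add M"
  "zero (module.truncate M) = zero M" "smult (module.truncate M) = smult M"
  by (simp_all add: module.defs)

lemma module_cong:
  assumes "module k M" "carrier N = carrier M" "add N = add M" "zero N = zero M" "smult N = smult M"
  shows "module k N"
proof -
  interpret M: module k M by fact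
  have "abelian_group N" using M.M.abelian_group_axioms assms(2-4) by (rule abelian_group_cong)
  then show ?thesis
    using assms(2-5) M.smult_l_distr M.smult_r_distr M.smult_assoc1
    by (intro moduleI M.R.cring_axioms) simp_all
qed

context k_category
begin

lemmas comp_add_left = linear_mapD(2)[OF comp_linear_left]
lemmas comp_add_right = linear_mapD(2)[OF comp_linear_right]
lemmas comp_smult_left = linear_mapD(3)[OF comp_linear_left]
lemmas comp_smult_right = linear_mapD(3)[OF comp_linear_right]

lemma hom_abelian: "\<lbrakk>x \<in> cat_obj C; y \<in> cat_obj C\<rbrakk> \<Longrightarrow> abelian_group (cat_hom C x y)"
  using hom_module by (auto simp: module_def)

lemma hom_add_closed:
  "\<lbrakk>x \<in> cat_obj C; y \<in> cat_obj C; f \<in> carrier (cat_hom C x y); g \<in> carrier (cat_hom C x y)\<rbrakk> \<Longrightarrow>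
   f \<oplus>\<^bsub>cat_hom C x y\<^esub> g \<in> carrier (cat_hom C x y)"
  by (rule abelian_monoid.a_closed[OF abelian_group.axioms(1)[OF hom_abelian]])

lemma hom_smult_closed:
  "\<lbrakk>x \<in> cat_obj C; y \<in> cat_obj C; c \<in> carrier k; f \<in> carrier (cat_hom C x y)\<rbrakk> \<Longrightarrow>
   c \<odot>\<^bsub>cat_hom C x y\<^esub> f \<in> carrier (cat_hom C x y)"
  by (rule module.smult_closed[OF hom_module])

text \<open>The actions are composition on the two sides. That the endomorphism algebras are
  \<open>k_algebra\<close> enters as a hypothesis; in use it is extracted from the bimodules P_x and
  P_y.\<close>

lemma hom_bimodule:
  assumes "x \<in> cat_obj C" "y \<in> cat_obj C" "k_algebra k (end_algebra C x)" "k_algebra k (end_algebra C y)"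
  shows "bimodule k (end_algebra C y) (end_algebra C x) (hom_bimod C x y)"
proof (intro bimodule.intro bimodule_axioms.intro)
  show "module k (hom_bimod C x y)" by (rule module_cong[OF hom_module[OF assms(1,2)]]) simp_all
qed (use assms(1,2) in \<open>simp_all add: assms(3,4) field_axioms comp_closed comp_add_left comp_add_right
    comp_smult_left comp_smult_right comp_id_left comp_id_right comp_assoc\<close>)

end

text \<open>\<open>psi\<close> is an arbitrary family of witnesses for P_x \<otimes> Q_x \<cong>
  B_x; the composition of D is built from \<open>vphi\<close>.\<close>

locale morita_family = C: k_category k C
  for k :: "'k ring" and C :: "('k, 'o, 'm) kcat" +
  fixes B :: "'o \<Rightarrow> ('k, 'b) module" and P :: "'o \<Rightarrow> ('k, 'p, 'b, 'm) bimod"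
    and Q :: "'o \<Rightarrow> ('k, 'q, 'm, 'b) bimod"
    and vphi :: "'o \<Rightarrow> ('q, 'p) tensor \<Rightarrow> 'm" and psi :: "'o \<Rightarrow> ('p, 'q) tensor \<Rightarrow> 'b"
  assumes context_at: "x \<in> cat_obj C \<Longrightarrow> morita_context k (end_algebra C x) (B x) (P x) (Q x) (vphi x) (psi x)"
begin

abbreviation Ob where "Ob \<equiv> cat_obj C"
abbreviation A where "A \<equiv> end_algebra C"
abbreviation homC where "homC \<equiv> cat_hom C"
abbreviation cmp where "cmp \<equiv> cat_comp C"
abbreviation hom where "hom x y \<equiv> carrier (homC x y)"
abbreviation T where "T x y \<equiv> tensor (A y) (P y) (hom_bimod C x y)"
abbreviation H where "H x y \<equiv> morita_hom C P Q x y"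
abbreviation tt where "tt \<equiv> triple_tensor C P Q"
abbreviation dc where "dc \<equiv> morita_comp k C B P Q vphi"
abbreviation D where "D \<equiv> morita_cat k C B P Q vphi"
abbreviation homD where "homD \<equiv> cat_hom D"

text \<open>The pairing \<phi>_x(q, p), kept in the form with the tensor product over
  \<open>k\<close> in which \<open>morita_comp\<close> contains it. \<open>pr_pair\<close>
  identifies it with the pairing over B_x, from which its rules come.\<close>

definition pr :: "'o \<Rightarrow> 'q \<Rightarrow> 'p \<Rightarrow> 'm" where
  "pr x q p = pairing B P Q vphi x (pure_tensor k (scalar_bimod (Q x)) (scalar_bimod (P x)) q p)"

lemma P_bimodule: "x \<in> Ob \<Longrightarrow> bimodule k (B x) (A x) (P x)"
  using context_at by (auto simp: morita_context_def)

lemma Q_bimodule: "x \<in> Ob \<Longrightarrow> bimodule k (A x) (B x) (Q x)"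
  using context_at by (auto simp: morita_context_def)

lemma P_closed:
  assumes "x \<in> Ob"
  shows "\<lbrakk>p \<in> carrier (P x); p' \<in> carrier (P x)\<rbrakk> \<Longrightarrow> p \<oplus>\<^bsub>P x\<^esub> p' \<in> carrier (P x)"
    and "\<lbrakk>p \<in> carrier (P x); a \<in> hom x x\<rbrakk> \<Longrightarrow> ract (P x) p a \<in> carrier (P x)"
    and "abelian_group (P x)"
proof -
  interpret bimodule k "B x" "A x" "P x" by (rule P_bimodule[OF assms])
  show "\<lbrakk>p \<in> carrier (P x); p' \<in> carrier (P x)\<rbrakk> \<Longrightarrow> p \<oplus>\<^bsub>P x\<^esub> p' \<in> carrier (P x)" by simp
  show "\<lbrakk>p \<in> carrier (P x); a \<in> hom x x\<rbrakk> \<Longrightarrow> ract (P x) p a \<in> carrier (P x)" using ract_closed by simp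
  show "abelian_group (P x)" by (rule M.abelian_group_axioms)
qed

lemma Q_closed:
  assumes "x \<in> Ob"
  shows "\<lbrakk>q \<in> carrier (Q x); q' \<in> carrier (Q x)\<rbrakk> \<Longrightarrow> q \<oplus>\<^bsub>Q x\<^esub> q' \<in> carrier (Q x)"
    and "\<lbrakk>a \<in> hom x x; q \<in> carrier (Q x)\<rbrakk> \<Longrightarrow> lact (Q x) a q \<in> carrier (Q x)"
    and "abelian_group (Q x)"
proof -
  interpret bimodule k "A x" "B x" "Q x" by (rule Q_bimodule[OF assms])
  show "\<lbrakk>q \<in> carrier (Q x); q' \<in> carrier (Q x)\<rbrakk> \<Longrightarrow> q \<oplus>\<^bsub>Q x\<^esub> q' \<in> carrier (Q x)" by simp
  show "\<lbrakk>a \<in> hom x x; q \<in> carrier (Q x)\<rbrakk> \<Longrightarrow> lact (Q x) a q \<in> carrier (Q x)" using lact_closed by simp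
  show "abelian_group (Q x)" by (rule M.abelian_group_axioms)
qed

lemma pr_pair:
  assumes "x \<in> Ob" "q \<in> carrier (Q x)" "p \<in> carrier (P x)"
  shows "pr x q p = pairing_iso.pair (B x) (Q x) (P x) (vphi x) q p"
proof -
  interpret morita_context k "A x" "B x" "P x" "Q x" "vphi x" "psi x" by (rule context_at[OF assms(1)])
  show ?thesis using QP.tensor_proj_pure[OF assms(2,3)] by (simp add: pr_def pairing_def QP.pair_def)
qed

lemma pr_rules:
  assumes x: "x \<in> Ob" and q: "q \<in> carrier (Q x)" and p: "p \<in> carrier (P x)"
  shows pr_closed: "pr x q p \<in> hom x x"
    and pr_add_left: "q' \<in> carrier (Q x) \<Longrightarrow> pr x (q \<oplus>\<^bsub>Q x\<^esub> q') p = pr x q p \<oplus>\<^bsub>homC x x\<^esub> pr x q' p"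
    and pr_add_right: "p' \<in> carrier (P x) \<Longrightarrow> pr x q (p \<oplus>\<^bsub>P x\<^esub> p') = pr x q p \<oplus>\<^bsub>homC x x\<^esub> pr x q p'"
    and pr_lact: "a \<in> hom x x \<Longrightarrow> pr x (lact (Q x) a q) p = cmp x x x a (pr x q p)"
    and pr_ract: "a \<in> hom x x \<Longrightarrow> pr x q (ract (P x) p a) = cmp x x x (pr x q p) a"
proof -
  interpret morita_context k "A x" "B x" "P x" "Q x" "vphi x" "psi x" by (rule context_at[OF x])
  note eq = pr_pair[OF x]
  show "pr x q p \<in> hom x x" using QP.pair_closed[OF q p] by (simp add: eq p q)
  show "q' \<in> carrier (Q x) \<Longrightarrow> pr x (q \<oplus>\<^bsub>Q x\<^esub> q') p = pr x q p \<oplus>\<^bsub>homC x x\<^esub> pr x q' p"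
    using QP.pair_add_left[of p q q'] by (simp add: eq p q)
  show "p' \<in> carrier (P x) \<Longrightarrow> pr x q (p \<oplus>\<^bsub>P x\<^esub> p') = pr x q p \<oplus>\<^bsub>homC x x\<^esub> pr x q p'"
    using QP.pair_add_right[of q p p'] by (simp add: eq p q)
  show "a \<in> hom x x \<Longrightarrow> pr x (lact (Q x) a q) p = cmp x x x a (pr x q p)"
    using QP.pair_lact[of a q p] by (simp add: eq p q Q_closed[OF x])
  show "a \<in> hom x x \<Longrightarrow> pr x q (ract (P x) p a) = cmp x x x (pr x q p) a"
    using QP.pair_ract[of a q p] by (simp add: eq p q P_closed[OF x])
qed

lemma T_tensor:
  assumes "x \<in> Ob" "y \<in> Ob"
  shows "bimodule_tensor k (B y) (A y) (A x) (P y) (hom_bimod C x y)"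
  using P_bimodule[OF assms(2)] P_bimodule[OF assms(1)] C.hom_bimodule[OF assms]
  by (simp add: bimodule_tensor_def bimodule_def)

lemma H_tensor:
  assumes "x \<in> Ob" "y \<in> Ob"
  shows "bimodule_tensor k (B y) (A x) (B x) (T x y) (Q x)"
  using bimodule_tensor.bimodule_T[OF T_tensor[OF assms]] Q_bimodule[OF assms(1)]
  by (simp add: bimodule_tensor_def)

lemma H_module: "\<lbrakk>x \<in> Ob; y \<in> Ob\<rbrakk> \<Longrightarrow> module k (H x y)"
  unfolding morita_hom_def by (rule bimodule_tensor.module_T[OF H_tensor])

lemma H_abelian: "\<lbrakk>x \<in> Ob; y \<in> Ob\<rbrakk> \<Longrightarrow> abelian_group (H x y)"
  using H_module by (auto simp: module_def)

text \<open>The defining relations of P_y \<otimes> Hom(x, y) \<otimes> Q_x. Scalars are put into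
  the middle factor, where the linearity of composition in C can use them.\<close>

lemma tt_rules:
  assumes x: "x \<in> Ob" and y: "y \<in> Ob"
    and p: "p \<in> carrier (P y)" and f: "f \<in> hom x y" and q: "q \<in> carrier (Q x)"
  shows tt_closed: "tt x y p f q \<in> carrier (H x y)"
    and tt_add_left: "p' \<in> carrier (P y) \<Longrightarrow> tt x y (p \<oplus>\<^bsub>P y\<^esub> p') f q = tt x y p f q \<oplus>\<^bsub>H x y\<^esub> tt x y p' f q"
    and tt_add_middle: "f' \<in> hom x y \<Longrightarrow>
      tt x y p (f \<oplus>\<^bsub>homC x y\<^esub> f') q = tt x y p f q \<oplus>\<^bsub>H x y\<^esub> tt x y p f' q"
    and tt_add_right: "q' \<in> carrier (Q x) \<Longrightarrow> tt x y p f (q \<oplus>\<^bsub>Q x\<^esub> q') = tt x y p f q \<oplus>\<^bsub>H x y\<^esub> tt x y p f q'"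
    and tt_left: "a \<in> hom y y \<Longrightarrow> tt x y (ract (P y) p a) f q = tt x y p (cmp x y y a f) q"
    and tt_right: "a \<in> hom x x \<Longrightarrow> tt x y p (cmp x x y f a) q = tt x y p f (lact (Q x) a q)"
    and tt_smult: "c \<in> carrier k \<Longrightarrow> c \<odot>\<^bsub>H x y\<^esub> tt x y p f q = tt x y p (c \<odot>\<^bsub>homC x y\<^esub> f) q"
proof -
  interpret T: bimodule_tensor k "B y" "A y" "A x" "P y" "hom_bimod C x y"
    by (rule T_tensor[OF x y])
  interpret H: bimodule_tensor k "B y" "A x" "B x" "T x y" "Q x"
    by (rule H_tensor[OF x y])
  have f': "f \<in> carrier (hom_bimod C x y)" using f by simp
  note cl = T.pure_closed[OF p f']
  note defs = triple_tensor_def morita_hom_def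
  show "tt x y p f q \<in> carrier (H x y)"
    unfolding defs by (rule H.pure_closed[OF cl q])
  show "p' \<in> carrier (P y) \<Longrightarrow> tt x y (p \<oplus>\<^bsub>P y\<^esub> p') f q = tt x y p f q \<oplus>\<^bsub>H x y\<^esub> tt x y p' f q"
    unfolding defs by (simp add: T.pure_add_left H.pure_add_left T.pure_closed p f q)
  show "f' \<in> hom x y \<Longrightarrow>
      tt x y p (f \<oplus>\<^bsub>homC x y\<^esub> f') q = tt x y p f q \<oplus>\<^bsub>H x y\<^esub> tt x y p f' q" for f'
    unfolding defs using T.pure_add_right[of p f f'] by (simp add: H.pure_add_left T.pure_closed p f q)
  show "q' \<in> carrier (Q x) \<Longrightarrow> tt x y p f (q \<oplus>\<^bsub>Q x\<^esub> q') = tt x y p f q \<oplus>\<^bsub>H x y\<^esub> tt x y p f q'"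
    unfolding defs by (simp add: H.pure_add_right cl q)
  show "a \<in> hom y y \<Longrightarrow> tt x y (ract (P y) p a) f q = tt x y p (cmp x y y a f) q"
    unfolding defs using T.pure_middle[of p a f] by (simp add: p f q)
  show "a \<in> hom x x \<Longrightarrow> tt x y p (cmp x x y f a) q = tt x y p f (lact (Q x) a q)"
    unfolding defs using H.pure_middle[OF cl _ q, of a] T.ract_pure[OF p f', of a] by simp
  show "c \<in> carrier k \<Longrightarrow> c \<odot>\<^bsub>H x y\<^esub> tt x y p f q = tt x y p (c \<odot>\<^bsub>homC x y\<^esub> f) q"
    unfolding defs using H.smult_pure[OF _ cl q, of c] T.smult_pure[OF _ p f', of c] T.smult_pure_right[OF _ p f', of c]
    by simp
qed

text \<open>Two nested tensor inductions: the one on P_y \<otimes> Hom(x, y) runs inside the pure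
  case of the outer one, where a sum in the first factor becomes a sum of triple tensors.\<close>

lemma H_induct [consumes 3, case_names triple add]:
  assumes x: "x \<in> Ob" and y: "y \<in> Ob" and u: "u \<in> carrier (H x y)"
    and triple: "\<And>p f q. \<lbrakk>p \<in> carrier (P y); f \<in> hom x y; q \<in> carrier (Q x)\<rbrakk> \<Longrightarrow> R (tt x y p f q)"
    and add: "\<And>u v. \<lbrakk>u \<in> carrier (H x y); v \<in> carrier (H x y); R u; R v\<rbrakk> \<Longrightarrow> R (u \<oplus>\<^bsub>H x y\<^esub> v)"
  shows "R u"
proof -
  interpret T: bimodule_tensor k "B y" "A y" "A x" "P y" "hom_bimod C x y"
    by (rule T_tensor[OF x y])
  interpret H: bimodule_tensor k "B y" "A x" "B x" "T x y" "Q x"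
    by (rule H_tensor[OF x y])
  show ?thesis using u unfolding morita_hom_def
  proof (induction u rule: H.tensor_induct)
    case (pure s q)
    from pure(1) show ?case
    proof (induction s rule: T.tensor_induct)
      case (pure p f)
      then show ?case using triple[of p f q] \<open>q \<in> carrier (Q x)\<close> by (simp add: triple_tensor_def)
    next
      case (add s t)
      then show ?case
        using assms(5)[unfolded morita_hom_def] \<open>q \<in> carrier (Q x)\<close>
        by (simp add: H.pure_add_left H.pure_closed)
    qed
  next
    case (add s t)
    then show ?case using assms(5)[unfolded morita_hom_def] by simp
  qed
qed

lemma H_maps_eq:
  assumes "x \<in> Ob" "y \<in> Ob" "additive_map (H x y) W F" "additive_map (H x y) W G"
    and "\<And>p f q. \<lbrakk>p \<in> carrier (P y); f \<in> hom x y; q \<in> carrier (Q x)\<rbrakk> \<Longrightarrow> F (tt x y p f q) = G (tt x y p f q)"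
    and "u \<in> carrier (H x y)"
  shows "F u = G u"
  using assms(1,2,6)
  by (induction u rule: H_induct) (auto simp: assms(5) additive_map_add[OF assms(3)] additive_map_add[OF assms(4)])

section \<open>The universal property of the triple tensor product\<close>

definition trimap :: "'o \<Rightarrow> 'o \<Rightarrow> ('w, 'f) ring_scheme \<Rightarrow> ('p \<Rightarrow> 'm \<Rightarrow> 'q \<Rightarrow> 'w) \<Rightarrow> bool" where
  "trimap x y W g \<longleftrightarrow>
     (\<forall>p\<in>carrier (P y). \<forall>f\<in>hom x y. \<forall>q\<in>carrier (Q x).
        g p f q \<in> carrier W \<and>
        (\<forall>p'\<in>carrier (P y). g (p \<oplus>\<^bsub>P y\<^esub> p') f q = g p f q \<oplus>\<^bsub>W\<^esub> g p' f q) \<and>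
        (\<forall>f'\<in>hom x y. g p (f \<oplus>\<^bsub>homC x y\<^esub> f') q = g p f q \<oplus>\<^bsub>W\<^esub> g p f' q) \<and>
        (\<forall>q'\<in>carrier (Q x). g p f (q \<oplus>\<^bsub>Q x\<^esub> q') = g p f q \<oplus>\<^bsub>W\<^esub> g p f q') \<and>
        (\<forall>a\<in>hom y y. g (ract (P y) p a) f q = g p (cmp x y y a f) q) \<and>
        (\<forall>a\<in>hom x x. g p (cmp x x y f a) q = g p f (lact (Q x) a q)))"

text \<open>For fixed q the map on pairs (p, f) descends to s in P_y \<otimes> Hom(x, y). Additivity
  in q and balancedness over A_x are then identities between additive maps of s and are tested on p
  \<otimes> f.\<close>

lemma triple_lift_rules:
  assumes x: "x \<in> Ob" and y: "y \<in> Ob" and W: "abelian_group W" and g: "trimap x y W g"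
  shows triple_lift_additive: "additive_map (H x y) W (triple_lift W g)"
    and triple_lift_tt: "\<lbrakk>p \<in> carrier (P y); f \<in> hom x y; q \<in> carrier (Q x)\<rbrakk> \<Longrightarrow>
      triple_lift W g (tt x y p f q) = g p f q"
proof -
  interpret T: bimodule_tensor k "B y" "A y" "A x" "P y" "hom_bimod C x y"
    by (rule T_tensor[OF x y])
  interpret H: bimodule_tensor k "B y" "A x" "B x" "T x y" "Q x"
    by (rule H_tensor[OF x y])
  interpret W: abelian_group W by (rule W)
  note g' = g[unfolded trimap_def, rule_format]
  have inner: "balanced_map (A y) (P y) (hom_bimod C x y) W (\<lambda>p f. g p f q)" if "q \<in> carrier (Q x)" for q
    by (rule balanced_mapI) (use g' that in auto)
  let ?l = "\<lambda>s q. tensor_lift W (\<lambda>p f. g p f q) s"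
  note l_add = T.tensor_lift_additive[OF W inner]
  note l_pure = T.tensor_lift_pure[OF W inner]
  have outer: "balanced_map (A x) (T x y) (Q x) W ?l"
  proof (rule balanced_mapI)
    fix s q assume s: "s \<in> carrier (T x y)" and q: "q \<in> carrier (Q x)"
    show "?l s q \<in> carrier W" by (rule additive_map_closed[OF l_add[OF q] s])
    { fix q' assume q': "q' \<in> carrier (Q x)"
      show "?l s (q \<oplus>\<^bsub>Q x\<^esub> q') = ?l s q \<oplus>\<^bsub>W\<^esub> ?l s q'"
        by (rule T.additive_maps_eq[OF l_add W.additive_map_sum[OF l_add l_add] _ s])
          (use q q' g' Q_closed[OF x] in \<open>simp_all add: l_pure\<close>) }
    { fix s' assume s': "s' \<in> carrier (T x y)"
      show "?l (s \<oplus>\<^bsub>T x y\<^esub> s') q = ?l s q \<oplus>\<^bsub>W\<^esub> ?l s' q"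
        by (rule additive_map_add[OF l_add[OF q] s s']) }
    fix a assume a: "a \<in> carrier (A x)"
    show "?l (ract (T x y) s a) q = ?l s (lact (Q x) a q)"
      by (rule T.additive_maps_eq[OF additive_map_compose[OF T.ract_additive l_add] l_add _ s])
        (use a q x y g' Q_closed[OF x] in \<open>simp_all add: T.ract_pure l_pure C.comp_closed\<close>)
  qed
  show "additive_map (H x y) W (triple_lift W g)"
    unfolding morita_hom_def triple_lift_def by (rule H.tensor_lift_additive[OF W outer])
  show "triple_lift W g (tt x y p f q) = g p f q"
    if "p \<in> carrier (P y)" "f \<in> hom x y" "q \<in> carrier (Q x)"
    unfolding triple_lift_def triple_tensor_def
    using that T.pure_closed by (simp add: H.tensor_lift_pure[OF W outer] l_pure)
qed

end

lemma bchoice3: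
  assumes "\<And>x. x \<in> S \<Longrightarrow> \<exists>a b c. R x a b c"
  shows "\<exists>f g h. \<forall>x\<in>S. R x (f x) (g x) (h x)"
  using assms by metis

context morita_family
begin

lemma D_simps [simp]:
  "cat_obj D = Ob" "carrier (homD x y) = carrier (H x y)" "add (homD x y) = add (H x y)"
  "zero (homD x y) = zero (H x y)" "smult (homD x y) = smult (H x y)" "cat_comp D = dc"
  by (simp_all add: morita_cat_def)

lemma D_hom_module: "\<lbrakk>x \<in> Ob; y \<in> Ob\<rbrakk> \<Longrightarrow> module k (homD x y)"
  by (rule module_cong[OF H_module]) simp_all

lemma D_hom_abelian: "\<lbrakk>x \<in> Ob; y \<in> Ob\<rbrakk> \<Longrightarrow> abelian_group (homD x y)"
  using D_hom_module by (auto simp: module_def)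

lemma D_additive: "additive_map (homD x y) W = additive_map (H x y) W"
  "additive_map V (homD x y) = additive_map V (H x y)"
  by (simp_all add: additive_map_def fun_eq_iff)

lemmas H_add_closed = abelian_monoid.a_closed[OF abelian_group.axioms(1)[OF H_abelian]]

lemma smult_additive_H: "\<lbrakk>c \<in> carrier k; a \<in> Ob; b \<in> Ob\<rbrakk> \<Longrightarrow> additive_map (H a b) (H a b) (\<lambda>u. c \<odot>\<^bsub>H a b\<^esub> u)"
  using module.smult_closed[OF H_module] module.smult_r_distr[OF H_module]
  by (auto intro!: additive_mapI)

section \<open>Composition in D: well-definedness, bilinearity, associativity\<close>

abbreviation inner_comp where
  "inner_comp x y z pz g qy \<equiv>
     triple_lift (H x z) (\<lambda>py f qx. tt x z pz (cmp x y z g (cmp x y y (pr y qy py) f)) qx)"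

context
  fixes x y z assumes x: "x \<in> Ob" and y: "y \<in> Ob" and z: "z \<in> Ob"
begin

lemmas obj = x y z
lemmas pr_y = pr_closed[OF y] pr_add_left[OF y] pr_add_right[OF y] pr_lact[OF y] pr_ract[OF y]
lemmas tt_xz = tt_closed[OF x z] tt_add_left[OF x z] tt_add_middle[OF x z] tt_add_right[OF x z]
  tt_left[OF x z] tt_right[OF x z]

text \<open>Well-definedness in the right factor. An element of A_y passes from py to f by right
  linearity of the pairing, one of A_x from f to qx by associativity in C.\<close>

lemma inner_comp_trimap:
  assumes "pz \<in> carrier (P z)" "g \<in> hom y z" "qy \<in> carrier (Q y)"
  shows "trimap x y (H x z) (\<lambda>py f qx. tt x z pz (cmp x y z g (cmp x y y (pr y qy py) f)) qx)"
  unfolding trimap_def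
proof (intro ballI conjI)
  fix py f qx assume *: "py \<in> carrier (P y)" "f \<in> hom x y" "qx \<in> carrier (Q x)"
  let ?h = "cmp x y z g (cmp x y y (pr y qy py) f)"
  have cl: "cmp x y y (pr y qy py) f \<in> hom x y" "?h \<in> hom x z"
    using * assms obj by (simp_all add: C.comp_closed pr_y)
  show "tt x z pz ?h qx \<in> carrier (H x z)" using * assms cl by (simp add: tt_xz)
  { fix p' assume "p' \<in> carrier (P y)"
    then show "tt x z pz (cmp x y z g (cmp x y y (pr y qy (py \<oplus>\<^bsub>P y\<^esub> p')) f)) qx =
        tt x z pz ?h qx \<oplus>\<^bsub>H x z\<^esub> tt x z pz (cmp x y z g (cmp x y y (pr y qy p') f)) qx"
      using * assms obj by (simp add: C.comp_closed pr_y C.comp_add_left C.comp_add_right tt_xz) }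
  { fix f' assume "f' \<in> hom x y"
    then show "tt x z pz (cmp x y z g (cmp x y y (pr y qy py) (f \<oplus>\<^bsub>homC x y\<^esub> f'))) qx =
        tt x z pz ?h qx \<oplus>\<^bsub>H x z\<^esub> tt x z pz (cmp x y z g (cmp x y y (pr y qy py) f')) qx"
      using * assms obj by (simp add: C.comp_closed pr_y C.comp_add_left C.comp_add_right tt_xz) }
  { fix q' assume "q' \<in> carrier (Q x)"
    then show "tt x z pz ?h (qx \<oplus>\<^bsub>Q x\<^esub> q') = tt x z pz ?h qx \<oplus>\<^bsub>H x z\<^esub> tt x z pz ?h q'"
      using * assms cl by (simp add: tt_xz) }
  { fix a assume "a \<in> hom y y"
    then show "tt x z pz (cmp x y z g (cmp x y y (pr y qy (ract (P y) py a)) f)) qx =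
        tt x z pz (cmp x y z g (cmp x y y (pr y qy py) (cmp x y y a f))) qx"
      using * assms obj by (simp add: pr_y C.comp_assoc) }
  { fix a assume a: "a \<in> hom x x"
    have "cmp x y z g (cmp x y y (pr y qy py) (cmp x x y f a)) = cmp x x z ?h a"
      using * assms obj a cl
      by (simp add: C.comp_assoc[of x x y y] C.comp_assoc[of x x y z] C.comp_closed pr_y)
    then show "tt x z pz (cmp x y z g (cmp x y y (pr y qy py) (cmp x x y f a))) qx =
        tt x z pz ?h (lact (Q x) a qx)"
      using * assms a cl by (simp add: tt_xz) }
qed

lemmas inner_comp_additive = triple_lift_additive[OF x y H_abelian[OF x z] inner_comp_trimap]
lemmas inner_comp_tt = triple_lift_tt[OF x y H_abelian[OF x z] inner_comp_trimap]

text \<open>Well-definedness in the left factor for arbitrary u. Each condition equates additive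
  maps of u and is tested on triple tensors; an element of A_y passes from g to qy by left linearity
  of the pairing.\<close>

lemma outer_comp_trimap:
  assumes u: "u \<in> carrier (H x y)"
  shows "trimap y z (H x z) (\<lambda>pz g qy. inner_comp x y z pz g qy u)"
proof -
  interpret W: abelian_group "H x z" by (rule H_abelian[OF x z])
  have eqI: "F u = G u" if "additive_map (H x y) (H x z) F" "additive_map (H x y) (H x z) G"
    "\<And>p f q. \<lbrakk>p \<in> carrier (P y); f \<in> hom x y; q \<in> carrier (Q x)\<rbrakk> \<Longrightarrow> F (tt x y p f q) = G (tt x y p f q)" for F G
    by (rule H_maps_eq[OF x y that u])
  show ?thesis
    unfolding trimap_def
  proof (intro ballI conjI)
    fix pz g qy assume *: "pz \<in> carrier (P z)" "g \<in> hom y z" "qy \<in> carrier (Q y)"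
    show "inner_comp x y z pz g qy u \<in> carrier (H x z)"
      by (rule additive_map_closed[OF inner_comp_additive[OF *] u])
    { fix p' assume p': "p' \<in> carrier (P z)"
      show "inner_comp x y z (pz \<oplus>\<^bsub>P z\<^esub> p') g qy u = inner_comp x y z pz g qy u \<oplus>\<^bsub>H x z\<^esub> inner_comp x y z p' g qy u"
        by (rule eqI[OF inner_comp_additive W.additive_map_sum[OF inner_comp_additive inner_comp_additive]])
          (use * p' obj in \<open>simp_all add: inner_comp_tt P_closed tt_xz C.comp_closed pr_y\<close>) }
    { fix g' assume g': "g' \<in> hom y z"
      show "inner_comp x y z pz (g \<oplus>\<^bsub>homC y z\<^esub> g') qy u =
          inner_comp x y z pz g qy u \<oplus>\<^bsub>H x z\<^esub> inner_comp x y z pz g' qy u"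
        by (rule eqI[OF inner_comp_additive W.additive_map_sum[OF inner_comp_additive inner_comp_additive]])
          (use * g' obj in \<open>simp_all add: inner_comp_tt C.hom_add_closed tt_xz C.comp_closed pr_y C.comp_add_left\<close>) }
    { fix q' assume q': "q' \<in> carrier (Q y)"
      show "inner_comp x y z pz g (qy \<oplus>\<^bsub>Q y\<^esub> q') u = inner_comp x y z pz g qy u \<oplus>\<^bsub>H x z\<^esub> inner_comp x y z pz g q' u"
        by (rule eqI[OF inner_comp_additive W.additive_map_sum[OF inner_comp_additive inner_comp_additive]])
          (use * q' obj in \<open>simp_all add: inner_comp_tt Q_closed tt_xz C.comp_closed pr_y C.comp_add_left C.comp_add_right\<close>) }
    { fix a assume a: "a \<in> hom z z"
      show "inner_comp x y z (ract (P z) pz a) g qy u = inner_comp x y z pz (cmp y z z a g) qy u"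
        by (rule eqI[OF inner_comp_additive inner_comp_additive])
          (use * a obj in \<open>simp_all add: inner_comp_tt P_closed tt_xz C.comp_closed pr_y C.comp_assoc\<close>) }
    { fix a assume a: "a \<in> hom y y"
      show "inner_comp x y z pz (cmp y y z g a) qy u = inner_comp x y z pz g (lact (Q y) a qy) u"
        by (rule eqI[OF inner_comp_additive inner_comp_additive])
          (use * a obj in \<open>simp_all add: inner_comp_tt Q_closed C.comp_closed pr_y C.comp_assoc\<close>) }
  qed
qed

lemma dc_eq: "dc x y z v u = triple_lift (H x z) (\<lambda>pz g qy. inner_comp x y z pz g qy u) v"
  by (simp add: morita_comp_def pr_def)

lemma dc_additive_left: "u \<in> carrier (H x y) \<Longrightarrow> additive_map (H y z) (H x z) (\<lambda>v. dc x y z v u)"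
  unfolding dc_eq by (rule triple_lift_additive[OF y z H_abelian[OF x z] outer_comp_trimap])

lemma dc_tt_left:
  "\<lbrakk>pz \<in> carrier (P z); g \<in> hom y z; qy \<in> carrier (Q y); u \<in> carrier (H x y)\<rbrakk> \<Longrightarrow>
   dc x y z (tt y z pz g qy) u = inner_comp x y z pz g qy u"
  unfolding dc_eq by (rule triple_lift_tt[OF y z H_abelian[OF x z] outer_comp_trimap])

lemma dc_tt:
  assumes "pz \<in> carrier (P z)" "g \<in> hom y z" "qy \<in> carrier (Q y)"
    "py \<in> carrier (P y)" "f \<in> hom x y" "qx \<in> carrier (Q x)"
  shows "dc x y z (tt y z pz g qy) (tt x y py f qx) = tt x z pz (cmp x y z g (cmp x y y (pr y qy py) f)) qx"
  using assms by (simp add: dc_tt_left tt_closed x y inner_comp_tt)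

lemma dc_closed: "\<lbrakk>v \<in> carrier (H y z); u \<in> carrier (H x y)\<rbrakk> \<Longrightarrow> dc x y z v u \<in> carrier (H x z)"
  by (rule additive_map_closed[OF dc_additive_left])

text \<open>The lift over the left factor is the outermost one, which makes additivity on the left
  immediate. On the right it holds for a triple tensor v and is carried along sums in v.\<close>

lemma dc_additive_right:
  assumes v: "v \<in> carrier (H y z)"
  shows "additive_map (H x y) (H x z) (\<lambda>u. dc x y z v u)"
  using y z v
proof (induction v rule: H_induct)
  case (triple p f q)
  then show ?case
    using additive_map_closed[OF inner_comp_additive] additive_map_add[OF inner_comp_additive]
      H_add_closed[OF x y]
    by (intro additive_mapI) (simp_all add: dc_tt_left)
next
  case (add v v')
  interpret W: abelian_group "H x z" by (rule H_abelian[OF x z])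
  have "additive_map (H x y) (H x z) (\<lambda>u. dc x y z v u \<oplus>\<^bsub>H x z\<^esub> dc x y z v' u)"
    by (rule W.additive_map_sum[OF add(3,4)])
  then show ?case
    using additive_map_add[OF dc_additive_left add(1,2)] H_add_closed[OF x y]
    by (auto simp: additive_map_def)
qed

lemma dc_smult_left:
  assumes c: "c \<in> carrier k" and v: "v \<in> carrier (H y z)" and u: "u \<in> carrier (H x y)"
  shows "dc x y z (c \<odot>\<^bsub>H y z\<^esub> v) u = c \<odot>\<^bsub>H x z\<^esub> dc x y z v u"
proof (rule H_maps_eq[OF y z additive_map_compose[OF smult_additive_H[OF c y z] dc_additive_left[OF u]]
      additive_map_compose[OF dc_additive_left[OF u] smult_additive_H[OF c x z]] _ v])
  fix pz g qy assume *: "pz \<in> carrier (P z)" "g \<in> hom y z" "qy \<in> carrier (Q y)"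
  note cg = C.hom_smult_closed[OF y z c *(2)]
  show "dc x y z (c \<odot>\<^bsub>H y z\<^esub> tt y z pz g qy) u = c \<odot>\<^bsub>H x z\<^esub> dc x y z (tt y z pz g qy) u"
    unfolding tt_smult[OF y z * c] dc_tt_left[OF * u] dc_tt_left[OF *(1) cg *(3) u]
    by (rule H_maps_eq[OF x y inner_comp_additive[OF *(1) cg *(3)]
          additive_map_compose[OF inner_comp_additive[OF *] smult_additive_H[OF c x z]] _ u])
      (use * c cg obj in \<open>simp_all add: inner_comp_tt tt_smult C.comp_closed pr_y C.comp_smult_left\<close>)
qed

lemma dc_smult_right:
  assumes c: "c \<in> carrier k" and v: "v \<in> carrier (H y z)" and u: "u \<in> carrier (H x y)"
  shows "dc x y z v (c \<odot>\<^bsub>H x y\<^esub> u) = c \<odot>\<^bsub>H x z\<^esub> dc x y z v u"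
proof (rule H_maps_eq[OF x y additive_map_compose[OF smult_additive_H[OF c x y] dc_additive_right[OF v]]
      additive_map_compose[OF dc_additive_right[OF v] smult_additive_H[OF c x z]] _ u])
  fix p f q assume *: "p \<in> carrier (P y)" "f \<in> hom x y" "q \<in> carrier (Q x)"
  note cf = C.hom_smult_closed[OF x y c *(2)]
  show "dc x y z v (c \<odot>\<^bsub>H x y\<^esub> tt x y p f q) = c \<odot>\<^bsub>H x z\<^esub> dc x y z v (tt x y p f q)"
    unfolding tt_smult[OF x y * c]
    by (rule H_maps_eq[OF y z dc_additive_left additive_map_compose[OF dc_additive_left smult_additive_H[OF c x z]] _ v])
      (use * c cf obj in \<open>simp_all add: dc_tt tt_closed tt_smult C.comp_closed pr_y C.comp_smult_right\<close>)
qed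

end

text \<open>Both sides are additive in each of h, g and f. Reducing one argument at a time leaves
  triple tensors, where associativity in C decides.\<close>

lemma dc_assoc:
  assumes obj: "w \<in> Ob" "x \<in> Ob" "y \<in> Ob" "z \<in> Ob"
    and f: "f \<in> carrier (H w x)" and g: "g \<in> carrier (H x y)" and h: "h \<in> carrier (H y z)"
  shows "dc w y z h (dc w x y g f) = dc w x z (dc x y z h g) f"
proof (rule H_maps_eq[OF obj(3,4) dc_additive_left _ _ h])
  note cl = dc_closed[OF obj(1,2,3)] dc_closed[OF obj(2,3,4)]
  show "additive_map (H y z) (H w z) (\<lambda>h. dc w x z (dc x y z h g) f)"
    by (rule additive_map_compose[OF dc_additive_left[OF obj(2,3,4) g] dc_additive_left[OF obj(1,2,4) f]])
  fix p1 f1 q1 assume 1: "p1 \<in> carrier (P z)" "f1 \<in> hom y z" "q1 \<in> carrier (Q y)"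
  note t1 = tt_closed[OF obj(3,4) 1]
  show "dc w y z (tt y z p1 f1 q1) (dc w x y g f) = dc w x z (dc x y z (tt y z p1 f1 q1) g) f"
  proof (rule H_maps_eq[OF obj(2,3) additive_map_compose[OF dc_additive_left[OF obj(1,2,3) f] dc_additive_right[OF obj(1,3,4) t1]]
        additive_map_compose[OF dc_additive_right[OF obj(2,3,4) t1] dc_additive_left[OF obj(1,2,4) f]] _ g])
    fix p2 f2 q2 assume 2: "p2 \<in> carrier (P y)" "f2 \<in> hom x y" "q2 \<in> carrier (Q x)"
    note t2 = tt_closed[OF obj(2,3) 2]
    note t12 = dc_closed[OF obj(2,3,4) t1 t2]
    show "dc w y z (tt y z p1 f1 q1) (dc w x y (tt x y p2 f2 q2) f) =
        dc w x z (dc x y z (tt y z p1 f1 q1) (tt x y p2 f2 q2)) f"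
    proof (rule H_maps_eq[OF obj(1,2) additive_map_compose[OF dc_additive_right[OF obj(1,2,3) t2] dc_additive_right[OF obj(1,3,4) t1]]
          dc_additive_right[OF obj(1,2,4) t12] _ f])
      fix p3 f3 q3 assume 3: "p3 \<in> carrier (P x)" "f3 \<in> hom w x" "q3 \<in> carrier (Q w)"
      have pr: "pr y q1 p2 \<in> hom y y" "pr x q2 p3 \<in> hom x x"
        using 1 2 3 obj by (simp_all add: pr_closed)
      \<comment> \<open>Both sides are the word f1 \<phi>(q1, p2) f2 \<phi>(q2, p3) f3, bracketed
        differently.\<close>
      have "cmp w y z f1 (cmp w y y (pr y q1 p2) (cmp w x y f2 (cmp w x x (pr x q2 p3) f3))) =
          cmp w x z (cmp x y z f1 (cmp x y y (pr y q1 p2) f2)) (cmp w x x (pr x q2 p3) f3)"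
        using 1 2 3 pr obj by (simp add: C.comp_assoc[of w x y y] C.comp_assoc[of w x y z] C.comp_closed)
      then show "dc w y z (tt y z p1 f1 q1) (dc w x y (tt x y p2 f2 q2) (tt w x p3 f3 q3)) =
        dc w x z (dc x y z (tt y z p1 f1 q1) (tt x y p2 f2 q2)) (tt w x p3 f3 q3)"
        using 1 2 3 pr obj by (simp add: dc_tt C.comp_closed)
    qed
  qed
qed (use obj f g in \<open>auto intro: dc_closed\<close>)

section \<open>Finite expansions chosen at every object\<close>

lemma ex_dual_basis:
  "\<exists>r p q. \<forall>x\<in>Ob. (\<forall>i<r x. p x i \<in> carrier (P x) \<and> q x i \<in> carrier (Q x)) \<and>
     (\<forall>v\<in>carrier (P x). (\<Oplus>\<^bsub>P x\<^esub>i\<in>{..<r x :: nat}. ract (P x) (p x i) (pr x (q x i) v)) = v) \<and>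
     (\<forall>v\<in>carrier (Q x). (\<Oplus>\<^bsub>Q x\<^esub>i\<in>{..<r x}. lact (Q x) (pr x v (p x i)) (q x i)) = v)"
proof -
  have "\<exists>r p q. (\<forall>i<r. p i \<in> carrier (P x) \<and> q i \<in> carrier (Q x)) \<and>
     (\<forall>v\<in>carrier (P x). (\<Oplus>\<^bsub>P x\<^esub>i\<in>{..<r :: nat}. ract (P x) (p i) (pr x (q i) v)) = v) \<and>
     (\<forall>v\<in>carrier (Q x). (\<Oplus>\<^bsub>Q x\<^esub>i\<in>{..<r}. lact (Q x) (pr x v (p i)) (q i)) = v)" if x: "x \<in> Ob" for x
  proof -
    interpret morita_context k "A x" "B x" "P x" "Q x" "vphi x" "psi x" by (rule context_at[OF x])
    obtain r :: nat and p q where e: "\<forall>i<r. p i \<in> carrier (P x) \<and> q i \<in> carrier (Q x)"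
      "\<forall>v\<in>carrier (P x). (\<Oplus>\<^bsub>P x\<^esub>i\<in>{..<r}. ract (P x) (p i) (QP.pair (q i) v)) = v"
      "\<forall>v\<in>carrier (Q x). (\<Oplus>\<^bsub>Q x\<^esub>i\<in>{..<r}. lact (Q x) (QP.pair v (p i)) (q i)) = v"
      using dual_basis by blast
    have "(\<Oplus>\<^bsub>P x\<^esub>i\<in>{..<r}. ract (P x) (p i) (pr x (q i) v)) = (\<Oplus>\<^bsub>P x\<^esub>i\<in>{..<r}. ract (P x) (p i) (QP.pair (q i) v))"
      if "v \<in> carrier (P x)" for v
      using e(1) that pr_pair[OF x] QP.pair_closed
      by (intro P.M.finsum_cong') (auto intro!: P.ract_closed)
    moreover have "(\<Oplus>\<^bsub>Q x\<^esub>i\<in>{..<r}. lact (Q x) (pr x v (p i)) (q i)) = (\<Oplus>\<^bsub>Q x\<^esub>i\<in>{..<r}. lact (Q x) (QP.pair v (p i)) (q i))"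
      if "v \<in> carrier (Q x)" for v
      using e(1) that pr_pair[OF x] QP.pair_closed
      by (intro Q.M.finsum_cong') (auto intro!: Q.lact_closed)
    ultimately show ?thesis using e by (intro exI[of _ r] exI[of _ p] exI[of _ q]) simp
  qed
  then show ?thesis by (rule bchoice3)
qed

lemma ex_unit_expansion:
  "\<exists>r p q. \<forall>x\<in>Ob. (\<forall>i<r x. p x i \<in> carrier (P x) \<and> q x i \<in> carrier (Q x)) \<and>
     (\<Oplus>\<^bsub>homC x x\<^esub>i\<in>{..<r x :: nat}. pr x (q x i) (p x i)) = cat_id C x"
proof -
  have "\<exists>r p q. (\<forall>i<r. p i \<in> carrier (P x) \<and> q i \<in> carrier (Q x)) \<and>
     (\<Oplus>\<^bsub>homC x x\<^esub>i\<in>{..<r :: nat}. pr x (q i) (p i)) = cat_id C x" if x: "x \<in> Ob" for x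
  proof -
    interpret morita_context k "A x" "B x" "P x" "Q x" "vphi x" "psi x" by (rule context_at[OF x])
    interpret hxx: abelian_group "homC x x" by (rule C.hom_abelian[OF x x])
    obtain r :: nat and p q where e: "\<forall>i<r. p i \<in> carrier (P x) \<and> q i \<in> carrier (Q x)"
      "(\<Oplus>\<^bsub>A x\<^esub>i\<in>{..<r}. QP.pair (q i) (p i)) = \<one>\<^bsub>A x\<^esub>"
      using QP.unit_expansion by blast
    have "(\<Oplus>\<^bsub>homC x x\<^esub>i\<in>{..<r}. pr x (q i) (p i)) = (\<Oplus>\<^bsub>homC x x\<^esub>i\<in>{..<r}. QP.pair (q i) (p i))"
      using e(1) pr_pair[OF x] QP.pair_closed by (intro hxx.finsum_cong') auto
    \<comment> \<open>\<open>homC x x\<close> and \<open>A x\<close> are different records with the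
      same additive structure; the identity map is additive and carries the finite sum
      across.\<close>
    also have "\<dots> = (\<Oplus>\<^bsub>A x\<^esub>i\<in>{..<r}. QP.pair (q i) (p i))"
      using e(1) QP.pair_closed
      by (intro additive_map_finsum[of "homC x x" "A x" "\<lambda>a. a", OF _ hxx.abelian_group_axioms P.R.abelian_group_axioms])
        (auto simp: additive_map_def)
    finally show ?thesis using e by (intro exI[of _ r] exI[of _ p] exI[of _ q]) simp
  qed
  then show ?thesis by (rule bchoice3)
qed

end

text \<open>Two expansions at each object. \<open>pd\<close> and \<open>qd\<close>, of length
  \<open>r\<close>, are the dual basis; they give the identities of D and the multiplicativity of
  \<open>to_C\<close>. \<open>pu\<close> and \<open>qu\<close>, of length \<open>n\<close>, expand
  the unit of A_x and give the multiplicativity of \<open>to_D\<close>.\<close>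

locale based_morita_family = morita_family k C B P Q vphi psi
  for k :: "'k ring" and C :: "('k, 'o, 'm) kcat"
    and B :: "'o \<Rightarrow> ('k, 'b) module" and P :: "'o \<Rightarrow> ('k, 'p, 'b, 'm) bimod"
    and Q :: "'o \<Rightarrow> ('k, 'q, 'm, 'b) bimod" and vphi psi +
  fixes r :: "'o \<Rightarrow> nat" and pd :: "'o \<Rightarrow> nat \<Rightarrow> 'p" and qd :: "'o \<Rightarrow> nat \<Rightarrow> 'q"
    and n :: "'o \<Rightarrow> nat" and pu :: "'o \<Rightarrow> nat \<Rightarrow> 'p" and qu :: "'o \<Rightarrow> nat \<Rightarrow> 'q"
  assumes pd: "\<lbrakk>x \<in> Ob; i < r x\<rbrakk> \<Longrightarrow> pd x i \<in> carrier (P x)"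
    and qd: "\<lbrakk>x \<in> Ob; i < r x\<rbrakk> \<Longrightarrow> qd x i \<in> carrier (Q x)"
    and dual_P: "\<lbrakk>x \<in> Ob; v \<in> carrier (P x)\<rbrakk> \<Longrightarrow>
      (\<Oplus>\<^bsub>P x\<^esub>i\<in>{..<r x}. ract (P x) (pd x i) (pr x (qd x i) v)) = v"
    and dual_Q: "\<lbrakk>x \<in> Ob; w \<in> carrier (Q x)\<rbrakk> \<Longrightarrow>
      (\<Oplus>\<^bsub>Q x\<^esub>i\<in>{..<r x}. lact (Q x) (pr x w (pd x i)) (qd x i)) = w"
    and pu: "\<lbrakk>x \<in> Ob; i < n x\<rbrakk> \<Longrightarrow> pu x i \<in> carrier (P x)"
    and qu: "\<lbrakk>x \<in> Ob; i < n x\<rbrakk> \<Longrightarrow> qu x i \<in> carrier (Q x)"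
    and unit_sum: "x \<in> Ob \<Longrightarrow> (\<Oplus>\<^bsub>homC x x\<^esub>i\<in>{..<n x}. pr x (qu x i) (pu x i)) = cat_id C x"
begin

text \<open>Pair the expansion of q in the dual basis with p. This collapse of products of pairings
  yields the matrix product for \<open>to_C\<close> and the relation t s = 1 over C.\<close>

lemma pr_dual_sum:
  assumes x: "x \<in> Ob" and q: "q \<in> carrier (Q x)" and p: "p \<in> carrier (P x)"
  shows "(\<Oplus>\<^bsub>homC x x\<^esub>i\<in>{..<r x}. cmp x x x (pr x q (pd x i)) (pr x (qd x i) p)) = pr x q p"
proof -
  interpret hxx: abelian_group "homC x x" by (rule C.hom_abelian[OF x x])
  have "additive_map (Q x) (homC x x) (\<lambda>q. pr x q p)"
    using x p by (auto intro!: additive_mapI pr_rules)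
  from additive_map_finsum[OF this Q_closed(3)[OF x] hxx.abelian_group_axioms,
      of "{..<r x}" "\<lambda>i. lact (Q x) (pr x q (pd x i)) (qd x i)"]
  have "pr x q p = (\<Oplus>\<^bsub>homC x x\<^esub>i\<in>{..<r x}. pr x (lact (Q x) (pr x q (pd x i)) (qd x i)) p)"
    using x q p by (simp add: dual_Q Q_closed pr_closed pd qd)
  also have "\<dots> = (\<Oplus>\<^bsub>homC x x\<^esub>i\<in>{..<r x}. cmp x x x (pr x q (pd x i)) (pr x (qd x i) p))"
    by (rule hxx.finsum_cong') (use x q p in \<open>auto simp: pr_rules pd qd intro!: C.comp_closed\<close>)
  finally show ?thesis by simp
qed

lemma tt_additive:
  assumes "x \<in> Ob" "y \<in> Ob"
  shows tt_additive_left: "\<lbrakk>f \<in> hom x y; q \<in> carrier (Q x)\<rbrakk> \<Longrightarrow>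
      additive_map (P y) (homD x y) (\<lambda>p. tt x y p f q)"
    and tt_additive_middle: "\<lbrakk>p \<in> carrier (P y); q \<in> carrier (Q x)\<rbrakk> \<Longrightarrow>
      additive_map (homC x y) (homD x y) (\<lambda>f. tt x y p f q)"
    and tt_additive_right: "\<lbrakk>p \<in> carrier (P y); f \<in> hom x y\<rbrakk> \<Longrightarrow>
      additive_map (Q x) (homD x y) (\<lambda>q. tt x y p f q)"
  using assms by (simp_all add: additive_map_def tt_closed tt_add_left tt_add_middle tt_add_right)

section \<open>The identity morphisms of D\<close>

definition unit_at :: "'o \<Rightarrow> (('p, 'm) tensor, 'q) tensor" where
  "unit_at x = (\<Oplus>\<^bsub>homD x x\<^esub>i\<in>{..<r x}. tt x x (pd x i) (cat_id C x) (qd x i))"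

lemma unit_at_closed: "x \<in> Ob \<Longrightarrow> unit_at x \<in> carrier (H x x)"
proof -
  assume x: "x \<in> Ob"
  interpret h: abelian_group "homD x x" by (rule D_hom_abelian[OF x x])
  have "unit_at x \<in> carrier (homD x x)"
    unfolding unit_at_def by (rule h.finsum_closed) (use x in \<open>auto intro!: tt_closed pd qd C.id_closed\<close>)
  then show ?thesis by simp
qed

text \<open>(\<Sum> p_i \<otimes> 1 \<otimes> q_i)(p \<otimes> f \<otimes> q) = \<Sum> p_i
  \<phi>(q_i, p) \<otimes> f \<otimes> q once the pairing has crossed the tensor sign over A_y, and
  the first factors sum to p.\<close>

lemma unit_at_left:
  assumes x: "x \<in> Ob" and y: "y \<in> Ob" and u: "u \<in> carrier (H x y)"
  shows "dc x y y (unit_at y) u = u"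
proof (rule H_maps_eq[OF x y dc_additive_right[OF x y y unit_at_closed[OF y]] _ _ u])
  show "additive_map (H x y) (H x y) (\<lambda>u. u)" by (simp add: additive_map_def)
  fix p f q assume *: "p \<in> carrier (P y)" "f \<in> hom x y" "q \<in> carrier (Q x)"
  interpret h: abelian_group "homD x y" by (rule D_hom_abelian[OF x y])
  have "additive_map (homD y y) (homD x y) (\<lambda>v. dc x y y v (tt x y p f q))"
    unfolding D_additive using x y * by (intro dc_additive_left tt_closed)
  from additive_map_finsum[OF this D_hom_abelian[OF y y] h.abelian_group_axioms,
      of "{..<r y}" "\<lambda>i. tt y y (pd y i) (cat_id C y) (qd y i)"]
  have "dc x y y (unit_at y) (tt x y p f q) =
      (\<Oplus>\<^bsub>homD x y\<^esub>i\<in>{..<r y}. dc x y y (tt y y (pd y i) (cat_id C y) (qd y i)) (tt x y p f q))"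
    unfolding unit_at_def using y by (simp add: tt_closed pd qd C.id_closed)
  also have "\<dots> = (\<Oplus>\<^bsub>homD x y\<^esub>i\<in>{..<r y}. tt x y (ract (P y) (pd y i) (pr y (qd y i) p)) f q)"
    by (rule h.finsum_cong')
      (use x y * in \<open>auto simp: dc_tt pd qd C.id_closed C.comp_id_left C.comp_closed pr_closed tt_left
        intro!: tt_closed P_closed\<close>)
  also have "\<dots> = tt x y (\<Oplus>\<^bsub>P y\<^esub>i\<in>{..<r y}. ract (P y) (pd y i) (pr y (qd y i) p)) f q"
    by (rule additive_map_finsum[symmetric, OF tt_additive_left[OF x y *(2,3)] P_closed(3)[OF y] h.abelian_group_axioms])
      (use y * in \<open>auto intro!: P_closed pd qd pr_closed\<close>)
  finally show "dc x y y (unit_at y) (tt x y p f q) = tt x y p f q" using y * by (simp add: dual_P)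
qed

text \<open>Here the pairing \<phi>(q, p_i) crosses the tensor sign over A_x to the right, and the
  other half of the dual basis property sums the last factors to q.\<close>

lemma unit_at_right:
  assumes x: "x \<in> Ob" and y: "y \<in> Ob" and u: "u \<in> carrier (H x y)"
  shows "dc x x y u (unit_at x) = u"
proof (rule H_maps_eq[OF x y dc_additive_left[OF x x y unit_at_closed[OF x]] _ _ u])
  show "additive_map (H x y) (H x y) (\<lambda>u. u)" by (simp add: additive_map_def)
  fix p f q assume *: "p \<in> carrier (P y)" "f \<in> hom x y" "q \<in> carrier (Q x)"
  interpret h: abelian_group "homD x y" by (rule D_hom_abelian[OF x y])
  have "additive_map (homD x x) (homD x y) (\<lambda>v. dc x x y (tt x y p f q) v)"
    unfolding D_additive using x y * by (intro dc_additive_right tt_closed)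
  from additive_map_finsum[OF this D_hom_abelian[OF x x] h.abelian_group_axioms,
      of "{..<r x}" "\<lambda>i. tt x x (pd x i) (cat_id C x) (qd x i)"]
  have "dc x x y (tt x y p f q) (unit_at x) =
      (\<Oplus>\<^bsub>homD x y\<^esub>i\<in>{..<r x}. dc x x y (tt x y p f q) (tt x x (pd x i) (cat_id C x) (qd x i)))"
    unfolding unit_at_def using x by (simp add: tt_closed pd qd C.id_closed)
  also have "\<dots> = (\<Oplus>\<^bsub>homD x y\<^esub>i\<in>{..<r x}. tt x y p f (lact (Q x) (pr x q (pd x i)) (qd x i)))"
    by (rule h.finsum_cong')
      (use x y * in \<open>auto simp: dc_tt pd qd C.id_closed C.comp_id_right C.comp_closed pr_closed tt_right
        intro!: tt_closed Q_closed\<close>)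
  also have "\<dots> = tt x y p f (\<Oplus>\<^bsub>Q x\<^esub>i\<in>{..<r x}. lact (Q x) (pr x q (pd x i)) (qd x i))"
    by (rule additive_map_finsum[symmetric, OF tt_additive_right[OF x y *(1,2)] Q_closed(3)[OF x] h.abelian_group_axioms])
      (use x * in \<open>auto intro!: Q_closed pd qd pr_closed\<close>)
  finally show "dc x x y (tt x y p f q) (unit_at x) = tt x y p f q" using x * by (simp add: dual_Q)
qed

text \<open>\<open>morita_cat\<close> takes its identities by description. The description
  determines them, since any candidate e satisfies e = \<open>unit_at x\<close> e =
  \<open>unit_at x\<close>.\<close>

lemma D_id: assumes x: "x \<in> Ob" shows "cat_id D x = unit_at x"
proof -
  have "(THE e. e \<in> carrier (H x x) \<and>
        (\<forall>y\<in>Ob. \<forall>u\<in>carrier (H x y). dc x x y u e = u) \<and>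
        (\<forall>y\<in>Ob. \<forall>u\<in>carrier (H y x). dc y x x e u = u)) = unit_at x"
  proof (rule the_equality)
    show "unit_at x \<in> carrier (H x x) \<and>
        (\<forall>y\<in>Ob. \<forall>u\<in>carrier (H x y). dc x x y u (unit_at x) = u) \<and>
        (\<forall>y\<in>Ob. \<forall>u\<in>carrier (H y x). dc y x x (unit_at x) u = u)"
      using x unit_at_closed unit_at_left unit_at_right by blast
    fix e assume e: "e \<in> carrier (H x x) \<and>
        (\<forall>y\<in>Ob. \<forall>u\<in>carrier (H x y). dc x x y u e = u) \<and>
        (\<forall>y\<in>Ob. \<forall>u\<in>carrier (H y x). dc y x x e u = u)"
    then have "dc x x x (unit_at x) e = unit_at x" using x unit_at_closed by blast
    moreover have "dc x x x (unit_at x) e = e" by (rule unit_at_left[OF x x conjunct1[OF e]])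
    ultimately show "e = unit_at x" by simp
  qed
  then show ?thesis by (simp add: morita_cat_def)
qed

lemma D_category: "k_category k D"
proof (intro k_category.intro k_category_axioms.intro)
  show "field k" by (rule C.field_axioms)
next
  fix x y z f assume *: "x \<in> cat_obj D" "y \<in> cat_obj D" "z \<in> cat_obj D" "f \<in> carrier (homD x y)"
  then show "linear_map k (homD y z) (homD x z) (\<lambda>g. cat_comp D x y z g f)"
    by (intro linear_mapI)
      (simp_all add: dc_closed dc_smult_left additive_map_add[OF dc_additive_left])
next
  fix x y z g assume *: "x \<in> cat_obj D" "y \<in> cat_obj D" "z \<in> cat_obj D" "g \<in> carrier (homD y z)"
  then show "linear_map k (homD x y) (homD x z) (\<lambda>f. cat_comp D x y z g f)"
    by (intro linear_mapI)
      (simp_all add: dc_closed dc_smult_right additive_map_add[OF dc_additive_right])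
qed (simp_all add: D_hom_module D_id unit_at_closed unit_at_left unit_at_right dc_closed dc_assoc)

section \<open>The two matrix functors and their composites\<close>

definition to_D :: "'o \<Rightarrow> 'o \<Rightarrow> 'm \<Rightarrow> nat \<Rightarrow> nat \<Rightarrow> (('p, 'm) tensor, 'q) tensor" where
  "to_D x y f i j = tt x y (pu y i) f (qu x j)"

definition to_C :: "'o \<Rightarrow> 'o \<Rightarrow> (('p, 'm) tensor, 'q) tensor \<Rightarrow> nat \<Rightarrow> nat \<Rightarrow> 'm" where
  "to_C x y u a b = triple_lift (homC x y)
     (\<lambda>p f q. cmp x y y (pr y (qd y a) p) (cmp x x y f (pr x q (pd x b)))) u"

lemma to_C_trimap:
  assumes x: "x \<in> Ob" and y: "y \<in> Ob" and a: "a < r y" and b: "b < r x"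
  shows "trimap x y (homC x y) (\<lambda>p f q. cmp x y y (pr y (qd y a) p) (cmp x x y f (pr x q (pd x b))))"
  unfolding trimap_def
  using x y pd[OF x b] qd[OF y a]
  by (auto simp: C.comp_closed pr_rules C.comp_add_left C.comp_add_right C.comp_assoc P_closed Q_closed)

lemma to_C_additive:
  assumes "x \<in> Ob" "y \<in> Ob" "a < r y" "b < r x"
  shows "additive_map (H x y) (homC x y) (\<lambda>u. to_C x y u a b)"
  unfolding to_C_def
  by (rule triple_lift_additive[OF assms(1,2) C.hom_abelian[OF assms(1,2)] to_C_trimap[OF assms]])

lemma to_C_tt:
  assumes "x \<in> Ob" "y \<in> Ob" "a < r y" "b < r x"
    and "p \<in> carrier (P y)" "f \<in> hom x y" "q \<in> carrier (Q x)"
  shows "to_C x y (tt x y p f q) a b = cmp x y y (pr y (qd y a) p) (cmp x x y f (pr x q (pd x b)))"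
  unfolding to_C_def
  by (rule triple_lift_tt[OF assms(1,2) C.hom_abelian[OF assms(1,2)] to_C_trimap[OF assms(1-4)] assms(5-7)])

lemma to_C_closed:
  "\<lbrakk>x \<in> Ob; y \<in> Ob; a < r y; b < r x; u \<in> carrier (H x y)\<rbrakk> \<Longrightarrow> to_C x y u a b \<in> hom x y"
  by (rule additive_map_closed[OF to_C_additive])

lemma to_C_smult:
  assumes x: "x \<in> Ob" and y: "y \<in> Ob" and ab: "a < r y" "b < r x"
    and c: "c \<in> carrier k" and u: "u \<in> carrier (H x y)"
  shows "to_C x y (c \<odot>\<^bsub>H x y\<^esub> u) a b = c \<odot>\<^bsub>homC x y\<^esub> to_C x y u a b"
proof (rule H_maps_eq[OF x y additive_map_compose[OF smult_additive_H[OF c x y] to_C_additive[OF x y ab]]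
      additive_map_compose[OF to_C_additive[OF x y ab]] _ u])
  interpret h: module k "homC x y" by (rule C.hom_module[OF x y])
  show "additive_map (homC x y) (homC x y) (\<lambda>f. c \<odot>\<^bsub>homC x y\<^esub> f)"
    using c by (auto intro!: additive_mapI simp: h.smult_r_distr)
  fix p f q assume *: "p \<in> carrier (P y)" "f \<in> hom x y" "q \<in> carrier (Q x)"
  then show "to_C x y (c \<odot>\<^bsub>H x y\<^esub> tt x y p f q) a b = c \<odot>\<^bsub>homC x y\<^esub> to_C x y (tt x y p f q) a b"
    using x y ab c
    by (simp add: tt_smult to_C_tt C.comp_smult_left C.comp_smult_right C.comp_closed pr_closed pd qd)
qed

text \<open>On triple tensors the right side contains \<Sum>_b \<phi>(qy, p_b) \<phi>(q_b, py)
  between the two outer parts, and \<open>pr_dual_sum\<close> turns it into the factor \<phi>(qy,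
  py) of the composition in D.\<close>

lemma to_C_comp:
  assumes x: "x \<in> Ob" and y: "y \<in> Ob" and z: "z \<in> Ob"
    and u: "u \<in> carrier (H x y)" and v: "v \<in> carrier (H y z)" and a: "a < r z" and e: "e < r x"
  shows "to_C x z (dc x y z v u) a e =
    (\<Oplus>\<^bsub>homC x z\<^esub>b\<in>{..<r y}. cmp x y z (to_C y z v a b) (to_C x y u b e))"
proof -
  interpret h: module k "homC x z" by (rule C.hom_module[OF x z])
  have cmp_left: "additive_map (homC y z) (homC x z) (\<lambda>g. cmp x y z g f)" if "f \<in> hom x y" for f
    by (rule linear_map_additive[OF C.comp_linear_left[OF x y z that]])
  have cmp_right: "additive_map (homC x y) (homC x z) (\<lambda>f. cmp x y z g f)" if "g \<in> hom y z" for g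
    by (rule linear_map_additive[OF C.comp_linear_right[OF x y z that]])
  show ?thesis
  proof (rule H_maps_eq[OF y z additive_map_compose[OF dc_additive_left[OF x y z u] to_C_additive[OF x z a e]] _ _ v])
    show "additive_map (H y z) (homC x z)
        (\<lambda>v. \<Oplus>\<^bsub>homC x z\<^esub>b\<in>{..<r y}. cmp x y z (to_C y z v a b) (to_C x y u b e))"
      using x y z a e u
      by (intro h.additive_map_sum_family additive_map_compose[OF to_C_additive cmp_left]) (auto intro: to_C_closed)
    fix pz g qy assume 1: "pz \<in> carrier (P z)" "g \<in> hom y z" "qy \<in> carrier (Q y)"
    note t1 = tt_closed[OF y z 1]
    show "to_C x z (dc x y z (tt y z pz g qy) u) a e =
        (\<Oplus>\<^bsub>homC x z\<^esub>b\<in>{..<r y}. cmp x y z (to_C y z (tt y z pz g qy) a b) (to_C x y u b e))"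
    proof (rule H_maps_eq[OF x y additive_map_compose[OF dc_additive_right[OF x y z t1] to_C_additive[OF x z a e]] _ _ u])
      show "additive_map (H x y) (homC x z)
          (\<lambda>u. \<Oplus>\<^bsub>homC x z\<^esub>b\<in>{..<r y}. cmp x y z (to_C y z (tt y z pz g qy) a b) (to_C x y u b e))"
        using x y z a e t1
        by (intro h.additive_map_sum_family additive_map_compose[OF to_C_additive cmp_right]) (auto intro: to_C_closed)
      fix py f qx assume 2: "py \<in> carrier (P y)" "f \<in> hom x y" "qx \<in> carrier (Q x)"
      let ?l = "cmp y z z (pr z (qd z a) pz) g" and ?r = "cmp x x y f (pr x qx (pd x e))"
      have l: "?l \<in> hom y z" and r: "?r \<in> hom x y"
        using 1 2 x y z a e by (simp_all add: C.comp_closed pr_closed pd qd)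
      have m: "pr y qy py \<in> hom y y" using 1 2 y by (simp add: pr_closed)
      have ac: "pr z (qd z a) pz \<in> hom z z" "pr x qx (pd x e) \<in> hom x x"
        using 1 2 x z a e by (simp_all add: pr_closed pd qd)
      have lhs: "to_C x z (dc x y z (tt y z pz g qy) (tt x y py f qx)) a e = cmp x y z (cmp y y z ?l (pr y qy py)) ?r"
        using 1 2 x y z a e l r m ac
        by (simp add: dc_tt to_C_tt C.comp_closed C.comp_assoc)
      have cl: "pr y qy (pd y b) \<in> hom y y" "pr y (qd y b) py \<in> hom y y" if "b < r y" for b
        using that 1 2 y by (simp_all add: pr_closed pd qd)
      have entry: "cmp x y z (to_C y z (tt y z pz g qy) a b) (to_C x y (tt x y py f qx) b e) =
          cmp x y z (cmp y y z ?l (cmp y y y (pr y qy (pd y b)) (pr y (qd y b) py))) ?r" if b: "b < r y" for b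
        using 1 2 x y z a e b l r cl[OF b] ac by (simp add: to_C_tt C.comp_closed C.comp_assoc)
      have entry_closed: "cmp x y z (cmp y y z ?l (cmp y y y (pr y qy (pd y b)) (pr y (qd y b) py))) ?r \<in> hom x z"
        if b: "b < r y" for b
        using x y z l r cl[OF b] by (simp add: C.comp_closed)
      have "(\<Oplus>\<^bsub>homC x z\<^esub>b\<in>{..<r y}. cmp x y z (to_C y z (tt y z pz g qy) a b) (to_C x y (tt x y py f qx) b e)) =
          (\<Oplus>\<^bsub>homC x z\<^esub>b\<in>{..<r y}. cmp x y z (cmp y y z ?l (cmp y y y (pr y qy (pd y b)) (pr y (qd y b) py))) ?r)"
        by (rule h.finsum_cong') (simp_all add: entry entry_closed)
      also have "\<dots> = cmp x y z (cmp y y z ?l (\<Oplus>\<^bsub>homC y y\<^esub>b\<in>{..<r y}. cmp y y y (pr y qy (pd y b)) (pr y (qd y b) py))) ?r"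
        by (rule additive_map_finsum[symmetric, OF additive_map_compose[OF
              linear_map_additive[OF C.comp_linear_right[OF y y z l]] cmp_left[OF r]]
              C.hom_abelian[OF y y] h.M.abelian_group_axioms])
          (use y cl in \<open>auto intro!: C.comp_closed\<close>)
      finally show "to_C x z (dc x y z (tt y z pz g qy) (tt x y py f qx)) a e =
          (\<Oplus>\<^bsub>homC x z\<^esub>b\<in>{..<r y}. cmp x y z (to_C y z (tt y z pz g qy) a b) (to_C x y (tt x y py f qx) b e))"
        using pr_dual_sum[OF y 1(3) 2(1)] lhs by simp
    qed
  qed
qed

text \<open>Insert 1 = \<Sum> \<phi>(q'_j, p'_j) between g and f; each term is then a composite in
  D.\<close>

lemma to_D_comp:
  assumes x: "x \<in> Ob" and y: "y \<in> Ob" and z: "z \<in> Ob"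
    and f: "f \<in> hom x y" and g: "g \<in> hom y z" and i: "i < n z" and l: "l < n x"
  shows "to_D x z (cmp x y z g f) i l =
    (\<Oplus>\<^bsub>homD x z\<^esub>j\<in>{..<n y}. dc x y z (to_D y z g i j) (to_D x y f j l))"
proof -
  interpret h: abelian_group "homD x z" by (rule D_hom_abelian[OF x z])
  note pq = pu[OF z i] qu[OF x l]
  note tt_add = tt_additive_middle[OF x z pq]
  have "additive_map (homC y y) (homD x z) (\<lambda>a. tt x z (pu z i) (cmp x y z g (cmp x y y a f)) (qu x l))"
    by (rule additive_map_compose[OF additive_map_compose[OF linear_map_additive[OF C.comp_linear_left[OF x y y f]]
            linear_map_additive[OF C.comp_linear_right[OF x y z g]]] tt_add])
  from additive_map_finsum[OF this C.hom_abelian[OF y y] h.abelian_group_axioms,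
      of "{..<n y}" "\<lambda>j. pr y (qu y j) (pu y j)"]
  have "tt x z (pu z i) (cmp x y z g f) (qu x l) =
      (\<Oplus>\<^bsub>homD x z\<^esub>j\<in>{..<n y}. tt x z (pu z i) (cmp x y z g (cmp x y y (pr y (qu y j) (pu y j)) f)) (qu x l))"
    using x y f by (simp add: unit_sum pr_closed pu qu C.comp_id_left)
  also have "\<dots> = (\<Oplus>\<^bsub>homD x z\<^esub>j\<in>{..<n y}. dc x y z (to_D y z g i j) (to_D x y f j l))"
    unfolding to_D_def
    by (rule h.finsum_cong')
      (use x y z f g pq in \<open>auto simp: dc_tt pu qu pr_closed C.comp_closed intro!: dc_closed tt_closed\<close>)
  finally show ?thesis by (simp add: to_D_def)
qed

context
  fixes enc :: "nat \<Rightarrow> (nat \<Rightarrow> 'u) \<Rightarrow> 'u" and dec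
  assumes coding: "tuple_coding enc dec"
begin

lemma to_D_functor: "matrix_functor enc dec k C D n to_D"
proof (intro matrix_functor.intro matrix_functor_axioms.intro coding D_category C.k_category_axioms)
  fix x y i j assume "x \<in> Ob" "y \<in> Ob" "i < n y" "j < n x"
  then show "linear_map k (homC x y) (homD x y) (\<lambda>f. to_D x y f i j)"
    by (intro linear_mapI) (simp_all add: to_D_def tt_closed tt_add_middle tt_smult pu qu)
qed (simp_all add: to_D_comp)

lemma to_C_functor: "matrix_functor enc dec k D C r to_C"
proof (intro matrix_functor.intro matrix_functor_axioms.intro coding D_category C.k_category_axioms)
  fix x y i j assume "x \<in> cat_obj D" "y \<in> cat_obj D" "i < r y" "j < r x"
  then show "linear_map k (homD x y) (homC x y) (\<lambda>u. to_C x y u i j)"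
    by (intro linear_mapI) (simp_all add: to_C_closed to_C_smult additive_map_add[OF to_C_additive])
qed (simp_all add: to_C_comp)

text \<open>The composite is f \<mapsto> \<phi>(q_a, p'_i) f \<phi>(q'_j, p_b), which shows s and t.
  In t s the sum over a collapses to \<phi>(q'_i, p'_i) by \<open>pr_dual_sum\<close>, and the sum
  over i is 1.\<close>

lemma inverse_on_C:
  "inverse_matrix_functors enc dec k C D n to_D r to_C
     (\<lambda>x i a. pr x (qd x a) (pu x i)) (\<lambda>x i a. pr x (qu x i) (pd x a))"
proof (intro inverse_matrix_functors.intro inverse_matrix_functors_axioms.intro to_C_functor to_D_functor)
  fix x assume x: "x \<in> Ob"
  interpret h: abelian_group "homC x x" by (rule C.hom_abelian[OF x x])
  have "(\<Oplus>\<^bsub>homC x x\<^esub>i\<in>{..<n x}. \<Oplus>\<^bsub>homC x x\<^esub>a\<in>{..<r x}.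
      cmp x x x (pr x (qu x i) (pd x a)) (pr x (qd x a) (pu x i))) =
      (\<Oplus>\<^bsub>homC x x\<^esub>i\<in>{..<n x}. pr x (qu x i) (pu x i))"
    by (rule h.finsum_cong') (use x in \<open>auto simp: pr_dual_sum pu qu pr_closed\<close>)
  then show "(\<Oplus>\<^bsub>homC x x\<^esub>i\<in>{..<n x}. \<Oplus>\<^bsub>homC x x\<^esub>a\<in>{..<r x}.
      cmp x x x (pr x (qu x i) (pd x a)) (pr x (qd x a) (pu x i))) = cat_id C x"
    using unit_sum[OF x] by simp
qed (simp_all add: pr_closed pd qd pu qu to_D_def to_C_tt)

text \<open>Now s_ai = p'_i \<otimes> 1 \<otimes> q_a and t_ai = p_a \<otimes> 1 \<otimes> q'_i. In
  t s the sum over i puts \<Sum> \<phi>(q'_i, p'_i) = 1 in the middle, and the sum over a is then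
  the identity of x in D.\<close>

lemma inverse_on_D:
  "inverse_matrix_functors enc dec k D C r to_C n to_D
     (\<lambda>x a i. tt x x (pu x i) (cat_id C x) (qd x a)) (\<lambda>x a i. tt x x (pd x a) (cat_id C x) (qu x i))"
proof (intro inverse_matrix_functors.intro inverse_matrix_functors_axioms.intro to_C_functor to_D_functor)
  fix x assume "x \<in> cat_obj D"
  then have x: "x \<in> Ob" by simp
  interpret h: abelian_group "homD x x" by (rule D_hom_abelian[OF x x])
  have "(\<Oplus>\<^bsub>homD x x\<^esub>i\<in>{..<n x}. dc x x x (tt x x (pd x a) (cat_id C x) (qu x i)) (tt x x (pu x i) (cat_id C x) (qd x a)))
      = tt x x (pd x a) (cat_id C x) (qd x a)" if a: "a < r x" for a
  proof -
    have "(\<Oplus>\<^bsub>homD x x\<^esub>i\<in>{..<n x}. dc x x x (tt x x (pd x a) (cat_id C x) (qu x i)) (tt x x (pu x i) (cat_id C x) (qd x a))) =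
        (\<Oplus>\<^bsub>homD x x\<^esub>i\<in>{..<n x}. tt x x (pd x a) (pr x (qu x i) (pu x i)) (qd x a))"
      by (rule h.finsum_cong')
        (use x a in \<open>auto simp: dc_tt pu qu pd qd C.id_closed pr_closed C.comp_id_left C.comp_id_right C.comp_closed intro!: tt_closed\<close>)
    also have "\<dots> = tt x x (pd x a) (\<Oplus>\<^bsub>homC x x\<^esub>i\<in>{..<n x}. pr x (qu x i) (pu x i)) (qd x a)"
      by (rule additive_map_finsum[symmetric, OF tt_additive_middle[OF x x pd[OF x a] qd[OF x a]]
            C.hom_abelian[OF x x] h.abelian_group_axioms])
        (use x in \<open>auto intro!: pu qu pr_closed\<close>)
    finally show ?thesis using unit_sum[OF x] by simp
  qed
  then have "(\<Oplus>\<^bsub>homD x x\<^esub>a\<in>{..<r x}. \<Oplus>\<^bsub>homD x x\<^esub>i\<in>{..<n x}.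
      dc x x x (tt x x (pd x a) (cat_id C x) (qu x i)) (tt x x (pu x i) (cat_id C x) (qd x a))) = unit_at x"
    unfolding unit_at_def
    by (intro h.finsum_cong') (use x in \<open>auto intro!: tt_closed pd qd C.id_closed\<close>)
  then show "(\<Oplus>\<^bsub>homD x x\<^esub>a\<in>{..<r x}. \<Oplus>\<^bsub>homD x x\<^esub>i\<in>{..<n x}.
      cat_comp D x x x (tt x x (pd x a) (cat_id C x) (qu x i)) (tt x x (pu x i) (cat_id C x) (qd x a))) = cat_id D x"
    using D_id[OF x] by simp
next
  fix x y u a b i j assume "x \<in> cat_obj D" "y \<in> cat_obj D" "u \<in> carrier (homD x y)"
    and ab: "a < r y" "b < r x" "i < n y" "j < n x"
  then have x: "x \<in> Ob" and y: "y \<in> Ob" and u: "u \<in> carrier (H x y)" by simp_all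
  let ?s = "tt y y (pu y i) (cat_id C y) (qd y a)" and ?t = "tt x x (pd x b) (cat_id C x) (qu x j)"
  have s: "?s \<in> carrier (H y y)" and t: "?t \<in> carrier (H x x)"
    using x y ab by (simp_all add: tt_closed pu qu pd qd C.id_closed)
  \<comment> \<open>On p \<otimes> f \<otimes> q both sides are p'_i \<otimes> \<phi>(q_a, p) f
    \<phi>(q, p_b) \<otimes> q'_j.\<close>
  have "to_D x y (to_C x y u a b) i j = dc x y y ?s (dc x x y u ?t)"
  proof (rule H_maps_eq[OF x y additive_map_compose[OF to_C_additive[OF x y ab(1,2)]]
        additive_map_compose[OF dc_additive_left[OF x x y t] dc_additive_right[OF x y y s]] _ u])
    show "additive_map (homC x y) (H x y) (\<lambda>f. to_D x y f i j)"
      unfolding to_D_def using tt_additive_middle[OF x y pu[OF y ab(3)] qu[OF x ab(4)]] by (simp add: D_additive)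
    fix p f q assume *: "p \<in> carrier (P y)" "f \<in> hom x y" "q \<in> carrier (Q x)"
    show "to_D x y (to_C x y (tt x y p f q) a b) i j = dc x y y ?s (dc x x y (tt x y p f q) ?t)"
      using x y ab *
      by (simp add: to_D_def to_C_tt dc_tt pu qu pd qd C.id_closed pr_closed C.comp_closed
          C.comp_id_left C.comp_id_right)
  qed
  then show "to_D x y (to_C x y u a b) i j = cat_comp D x y y ?s (cat_comp D x x y u ?t)" by simp
qed (simp_all add: tt_closed pd qd pu qu C.id_closed)

lemma morita_equivalent_D: "morita_equivalent TYPE('u) k C D"
  by (rule morita_equivalent_of_matrix_functors[OF inverse_on_C inverse_on_D])

end

end

text \<open>The data of \<open>morita_cat\<close> are given by lifts evaluated on representatives
  and by a description of the identities. The first two conclusions therefore confirm that D is a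
  category and that its composition obeys the prescribed formula. Infinity of \<open>'u\<close>
  supplies the coding of finite tuples.\<close>

theorem proposition4p4:
  fixes k :: "'k ring"
    and C :: "('k, 'o, 'm) kcat"
    and B :: "'o \<Rightarrow> ('k, 'b) module"
    and P :: "'o \<Rightarrow> ('k, 'p, 'b, 'm) bimod"
    and Q :: "'o \<Rightarrow> ('k, 'q, 'm, 'b) bimod"
    and vphi :: "'o \<Rightarrow> ('q, 'p) tensor \<Rightarrow> 'm"
  assumes "field k"
    and "k_category k C"
    and "\<And>x. x \<in> cat_obj C \<Longrightarrow> k_algebra k (B x)"
    and "\<And>x. x \<in> cat_obj C \<Longrightarrow> bimodule k (B x) (end_algebra C x) (P x)"
    and "\<And>x. x \<in> cat_obj C \<Longrightarrow> bimodule k (end_algebra C x) (B x) (Q x)"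
    and "\<And>x. x \<in> cat_obj C \<Longrightarrow>
           bimod_isomorphic k (B x) (B x) (tensor (end_algebra C x) (P x) (Q x)) (regular_bimod (B x))"
    and "\<And>x. x \<in> cat_obj C \<Longrightarrow>
           bimod_isomorphic k (end_algebra C x) (end_algebra C x)
             (tensor (B x) (Q x) (P x)) (regular_bimod (end_algebra C x))"
    and "\<And>x. x \<in> cat_obj C \<Longrightarrow>
           bimod_iso k (end_algebra C x) (end_algebra C x)
             (tensor (B x) (Q x) (P x)) (regular_bimod (end_algebra C x)) (vphi x)"
    and "infinite (UNIV :: 'u set)"
  shows "k_category k (morita_cat k C B P Q vphi) \<and>
    (\<forall>x\<in>cat_obj C. \<forall>y\<in>cat_obj C. \<forall>z\<in>cat_obj C.
       \<forall>pz\<in>carrier (P z). \<forall>g\<in>carrier (cat_hom C y z). \<forall>qy\<in>carrier (Q y).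
       \<forall>py\<in>carrier (P y). \<forall>f\<in>carrier (cat_hom C x y). \<forall>qx\<in>carrier (Q x).
         cat_comp (morita_cat k C B P Q vphi) x y z
           (triple_tensor C P Q y z pz g qy) (triple_tensor C P Q x y py f qx) =
         triple_tensor C P Q x z pz
           (cat_comp C x y z g
             (cat_comp C x y y
               (pairing B P Q vphi y
                 (pure_tensor k (scalar_bimod (Q y)) (scalar_bimod (P y)) qy py))
               f))
           qx) \<and>
    morita_equivalent TYPE('u) k C (morita_cat k C B P Q vphi)"
proof -
  \<comment> \<open>One isomorphism is chosen at each object, in no prescribed relation to
    \<open>vphi\<close>.\<close>
  obtain psi where psi: "\<And>x. x \<in> cat_obj C \<Longrightarrow>
      bimod_iso k (B x) (B x) (tensor (end_algebra C x) (P x) (Q x)) (regular_bimod (B x)) (psi x)"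
    using assms(6) unfolding bimod_isomorphic_def by metis
  interpret morita_family k C B P Q vphi psi
    by (intro morita_family.intro morita_family_axioms.intro morita_context.intro
        morita_context_axioms.intro assms psi)
  obtain r pd qd where dual: "\<forall>x\<in>Ob. (\<forall>i<r x. pd x i \<in> carrier (P x) \<and> qd x i \<in> carrier (Q x)) \<and>
     (\<forall>v\<in>carrier (P x). (\<Oplus>\<^bsub>P x\<^esub>i\<in>{..<r x :: nat}. ract (P x) (pd x i) (pr x (qd x i) v)) = v) \<and>
     (\<forall>v\<in>carrier (Q x). (\<Oplus>\<^bsub>Q x\<^esub>i\<in>{..<r x}. lact (Q x) (pr x v (pd x i)) (qd x i)) = v)"
    using ex_dual_basis by (elim exE)
  obtain n pu qu where unit: "\<forall>x\<in>Ob. (\<forall>i<n x. pu x i \<in> carrier (P x) \<and> qu x i \<in> carrier (Q x)) \<and>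
     (\<Oplus>\<^bsub>homC x x\<^esub>i\<in>{..<n x :: nat}. pr x (qu x i) (pu x i)) = cat_id C x"
    using ex_unit_expansion by (elim exE)
  interpret based_morita_family k C B P Q vphi psi r pd qd n pu qu
    by unfold_locales (use dual unit in simp_all)
  obtain enc :: "nat \<Rightarrow> (nat \<Rightarrow> 'u) \<Rightarrow> 'u" and dec where "tuple_coding enc dec"
    using ex_tuple_coding[OF assms(9)] by (elim exE)
  then have "morita_equivalent TYPE('u) k C D" by (rule morita_equivalent_D)
  then show ?thesis using D_category dc_tt unfolding pr_def by simp
qed

end
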